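(* (a) Let $\pi/4<t<\pi/2$, let $\omega_1=E(1)$, $\omega_2=E(i)$ with $E(z)=\int_0^z\frac{du}{\sqrt{u^4-2(\cos 2t)u^2+1}}$, let $\wp$ be the Weierstrass function with primitive periods $2\omega_1,2\omega_2$, and let $e_1=\wp(\omega_1)$, $e_2=\wp(\omega_2)$, $e_3=\wp(\omega_1+\omega_2)$. Then the number $$z_0=\omega_1+\omega_2-\frac{i}{2}\int_0^{4\sqrt{e_3/((e_3+4)(3e_3-4))}}\frac{dv}{\sqrt{1-v^2}\,\sqrt{1-\frac{e_1-e_3}{4}v^2}}\qquad( * )$$ satisfies $\wp(z_0)=0$. (b) In general, for $\operatorname{Im}\tau>0$, let $\wp(\cdot\,|\,\tau)$ be the Weierstrass function with primitive periods $2\omega_1,2\omega_2$, where $\omega_2/\omega_1=\tau$ and the half-periods are normalized so that $e_1-e_2=4$, with $e_1=\wp(\omega_1\,|\,\tau)$, $e_2=\wp(\omega_2\,|\,\tau)$, $e_3=\wp(\omega_1+\omega_2\,|\,\tau)$. Then $\wp(z_0(\tau)\,|\,\tau)=0$ for $z_0(\tau)$ computed by formula $( * )$, and also for $z_0(\tau)$ computed by $$z_0(\tau)=\pm\frac{1}{\sqrt{e_1-e_2}}\int_0^{2\sqrt{-1/e_2}}\frac{dv}{\sqrt{1-v^2}\,\sqrt{1-\left(\frac{e_3-e_2}{e_1-e_2}\right)v^2}} .$$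
   Context: In (a), the square root in $E$ is the branch on the unit disk equal to $1$ at $u=0$; then $\omega_1$ is real, $\omega_2$ is purely imaginary, and $e_1-e_2=4$ holds automatically. In (b), $e_1,e_2,e_3$ and $z_0$ are regarded as analytic functions of $\tau$, and the formulas are understood by analytic continuation in $\tau$. *)

theory Defs
  imports "HOL-Complex_Analysis.Complex_Analysis"
begin

definition period_lattice :: "complex \<Rightarrow> complex \<Rightarrow> complex set" where
  "period_lattice \<omega>\<^sub>1 \<omega>\<^sub>2 =
     {2 * of_int m * \<omega>\<^sub>1 + 2 * of_int n * \<omega>\<^sub>2 | m n :: int. True}"

text \<open>The arguments \<open>\<omega>\<^sub>1\<close>, \<open>\<omega>\<^sub>2\<close> are half-periods. At a lattice point, where the Weierstrass
  function has a pole, the term below is a meaningless finite number (it is 0 at the origin).\<close>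

definition weierstrass_p :: "complex \<Rightarrow> complex \<Rightarrow> complex \<Rightarrow> complex" where
  "weierstrass_p \<omega>\<^sub>1 \<omega>\<^sub>2 z =
     1 / z\<^sup>2 + (\<Sum>\<^sub>\<infinity>\<omega>\<in>period_lattice \<omega>\<^sub>1 \<omega>\<^sub>2 - {0}. 1 / (z - \<omega>)\<^sup>2 - 1 / \<omega>\<^sup>2)"

definition is_zero_of_wp :: "complex \<Rightarrow> complex \<Rightarrow> complex \<Rightarrow> bool" where
  "is_zero_of_wp \<omega>\<^sub>1 \<omega>\<^sub>2 z \<longleftrightarrow>
     z \<notin> period_lattice \<omega>\<^sub>1 \<omega>\<^sub>2 \<and> weierstrass_p \<omega>\<^sub>1 \<omega>\<^sub>2 z = 0"

definition wp_e1 :: "complex \<Rightarrow> complex \<Rightarrow> complex" where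
  "wp_e1 \<omega>\<^sub>1 \<omega>\<^sub>2 = weierstrass_p \<omega>\<^sub>1 \<omega>\<^sub>2 \<omega>\<^sub>1"

definition wp_e2 :: "complex \<Rightarrow> complex \<Rightarrow> complex" where
  "wp_e2 \<omega>\<^sub>1 \<omega>\<^sub>2 = weierstrass_p \<omega>\<^sub>1 \<omega>\<^sub>2 \<omega>\<^sub>2"

definition wp_e3 :: "complex \<Rightarrow> complex \<Rightarrow> complex" where
  "wp_e3 \<omega>\<^sub>1 \<omega>\<^sub>2 = weierstrass_p \<omega>\<^sub>1 \<omega>\<^sub>2 (\<omega>\<^sub>1 + \<omega>\<^sub>2)"

definition is_quartic_sqrt :: "real \<Rightarrow> (complex \<Rightarrow> complex) \<Rightarrow> bool" where
  "is_quartic_sqrt t S \<longleftrightarrow>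
     S holomorphic_on ball 0 1 \<and> S 0 = 1 \<and>
     (\<forall>u\<in>ball 0 1. (S u)\<^sup>2 = u ^ 4 - 2 * of_real (cos (2 * t)) * u\<^sup>2 + 1)"

text \<open>For \<open>z\<close> on the unit circle only the end point of the segment lies outside the disk where
  \<open>S\<close> is specified; it does not affect the integral.\<close>

definition elliptic_E :: "(complex \<Rightarrow> complex) \<Rightarrow> complex \<Rightarrow> complex" where
  "elliptic_E S z = contour_integral (linepath 0 z) (\<lambda>u. 1 / S u)"

text \<open>The number given by formula (*), with straight path of integration and principal roots.\<close>

definition z0_principal :: "complex \<Rightarrow> complex \<Rightarrow> complex" where
  "z0_principal \<omega>\<^sub>1 \<omega>\<^sub>2 =
     (let e1 = wp_e1 \<omega>\<^sub>1 \<omega>\<^sub>2; e3 = wp_e3 \<omega>\<^sub>1 \<omega>\<^sub>2 in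
      \<omega>\<^sub>1 + \<omega>\<^sub>2 - \<i> / 2 *
        contour_integral (linepath 0 (4 * csqrt (e3 / ((e3 + 4) * (3 * e3 - 4)))))
          (\<lambda>v. 1 / (csqrt (1 - v\<^sup>2) * csqrt (1 - (e1 - e3) / 4 * v\<^sup>2))))"

text \<open>\<open>I\<close> is a value of the multivalued integral of \<open>1 / (sqrt (1 - v\<^sup>2) * sqrt (1 - m * v\<^sup>2))\<close> from
  0 to \<open>s\<close>: \<open>g\<close> is a path of integration which avoids the branch points of the integrand, except
  possibly at its end, and \<open>r\<^sub>1\<close>, \<open>r\<^sub>2\<close> are the two roots, continued along \<open>g\<close> from the value 1
  at \<open>v = 0\<close>.\<close>

definition elliptic_integral_value :: "complex \<Rightarrow> complex \<Rightarrow> complex \<Rightarrow> bool" where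
  "elliptic_integral_value m s I \<longleftrightarrow>
     (\<exists>g r\<^sub>1 r\<^sub>2. valid_path g \<and> pathstart g = 0 \<and> pathfinish g = s \<and>
        continuous_on {0..1} r\<^sub>1 \<and> continuous_on {0..1} r\<^sub>2 \<and> r\<^sub>1 0 = 1 \<and> r\<^sub>2 0 = 1 \<and>
        (\<forall>x\<in>{0..1}. (r\<^sub>1 x)\<^sup>2 = 1 - (g x)\<^sup>2 \<and> (r\<^sub>2 x)\<^sup>2 = 1 - m * (g x)\<^sup>2) \<and>
        (\<forall>x\<in>{0..<1}. r\<^sub>1 x \<noteq> 0 \<and> r\<^sub>2 x \<noteq> 0) \<and>
        ((\<lambda>x. 1 / (r\<^sub>1 x * r\<^sub>2 x) * vector_derivative g (at x within {0..1}))
           has_integral I) {0..1})"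

text \<open>For given \<open>\<tau>\<close> the normalization determines the half-periods up to a common sign; the lattice
  and \<open>e\<^sub>1, e\<^sub>2, e\<^sub>3\<close> do not depend on that sign.\<close>

definition normalized_half_periods :: "complex \<Rightarrow> complex \<Rightarrow> complex \<Rightarrow> bool" where
  "normalized_half_periods \<tau> \<omega>\<^sub>1 \<omega>\<^sub>2 \<longleftrightarrow>
     \<omega>\<^sub>1 \<noteq> 0 \<and> \<omega>\<^sub>2 / \<omega>\<^sub>1 = \<tau> \<and> wp_e1 \<omega>\<^sub>1 \<omega>\<^sub>2 - wp_e2 \<omega>\<^sub>1 \<omega>\<^sub>2 = 4"

text \<open>The values at \<open>\<tau>\<close> of the two formulas, for all choices of the roots and of the path of
  integration. The upper limits of integration are infinite for \<open>e\<^sub>2 = 0\<close>, that is \<open>e\<^sub>3 = -4\<close>, so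
  these \<open>\<tau>\<close> get no value here.\<close>

definition z0_formula1 :: "complex \<Rightarrow> complex \<Rightarrow> bool" where
  "z0_formula1 \<tau> z \<longleftrightarrow>
     (\<exists>\<omega>\<^sub>1 \<omega>\<^sub>2 s I. normalized_half_periods \<tau> \<omega>\<^sub>1 \<omega>\<^sub>2 \<and>
        (let e1 = wp_e1 \<omega>\<^sub>1 \<omega>\<^sub>2; e3 = wp_e3 \<omega>\<^sub>1 \<omega>\<^sub>2 in
           (e3 + 4) * (3 * e3 - 4) \<noteq> 0 \<and>
           s\<^sup>2 = e3 / ((e3 + 4) * (3 * e3 - 4)) \<and>
           elliptic_integral_value ((e1 - e3) / 4) (4 * s) I \<and>
           z = \<omega>\<^sub>1 + \<omega>\<^sub>2 - \<i> / 2 * I))"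

definition z0_formula2 :: "complex \<Rightarrow> complex \<Rightarrow> bool" where
  "z0_formula2 \<tau> z \<longleftrightarrow>
     (\<exists>\<omega>\<^sub>1 \<omega>\<^sub>2 s I. normalized_half_periods \<tau> \<omega>\<^sub>1 \<omega>\<^sub>2 \<and>
        (let e1 = wp_e1 \<omega>\<^sub>1 \<omega>\<^sub>2; e2 = wp_e2 \<omega>\<^sub>1 \<omega>\<^sub>2; e3 = wp_e3 \<omega>\<^sub>1 \<omega>\<^sub>2 in
           e2 \<noteq> 0 \<and>
           s\<^sup>2 = - 1 / e2 \<and>
           elliptic_integral_value ((e3 - e2) / (e1 - e2)) (2 * s) I \<and>
           (z = 1 / csqrt (e1 - e2) * I \<or> z = - (1 / csqrt (e1 - e2) * I))))"

text \<open>The function elements \<open>(U, f)\<close> of the analytic functions on the upper half-plane that are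
  determined by a pointwise multivalued formula \<open>R\<close>: elements given by the formula itself, and all
  their analytic continuations through chains of domains.\<close>

inductive analytic_branch ::
  "(complex \<Rightarrow> complex \<Rightarrow> bool) \<Rightarrow> complex set \<Rightarrow> (complex \<Rightarrow> complex) \<Rightarrow> bool"
  for R where
  formula: "analytic_branch R U f"
    if "open U" "connected U" "U \<noteq> {}" "U \<subseteq> {\<tau>. Im \<tau> > 0}" "f holomorphic_on U"
       "\<forall>\<tau>\<in>U. R \<tau> (f \<tau>)"
| continuation: "analytic_branch R V g"
    if "analytic_branch R U f"
       "open V" "connected V" "V \<subseteq> {\<tau>. Im \<tau> > 0}" "g holomorphic_on V"
       "open W" "W \<noteq> {}" "W \<subseteq> U \<inter> V" "\<forall>\<tau>\<in>W. f \<tau> = g \<tau>"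

text \<open>\<open>z\<close> is a value at \<open>\<tau>\<close> of the formula \<open>R\<close>, understood by analytic continuation. The limit gives
  \<open>f \<tau>\<close> for \<open>\<tau> \<in> U\<close>, and the value at \<open>\<tau>\<close> if \<open>\<tau>\<close> is a branch point on the boundary of \<open>U\<close>.\<close>

definition analytic_value :: "(complex \<Rightarrow> complex \<Rightarrow> bool) \<Rightarrow> complex \<Rightarrow> complex \<Rightarrow> bool" where
  "analytic_value R \<tau> z \<longleftrightarrow>
     R \<tau> z \<or>
     (\<exists>U f. analytic_branch R U f \<and> \<tau> \<in> closure U \<and> (f \<longlongrightarrow> z) (at \<tau> within U))"

end

theory Submission
  imports Defs
begin

text \<open>With \<open>F = (\<wp>(z + \<omega>\<^sub>2) - e\<^sub>2) / (e\<^sub>3 - e\<^sub>2)\<close>, which is \<open>sn\<^sup>2\<close> up to scaling, the differential equation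
  of \<open>\<wp>\<close> becomes \<open>F'\<^sup>2 = 4 (e\<^sub>1 - e\<^sub>2) F (1 - F) (1 - m F)\<close>. Hence along any path the integral of
  \<open>dv / (sqrt (1 - v\<^sup>2) * sqrt (1 - m * v\<^sup>2))\<close> inverts \<open>F = v\<^sup>2\<close>: locally it is an inverse of a holomorphic
  root of \<open>F\<close>, and the set of parameters at which this holds is open and closed. The second formula follows
  at once, the first one after exchanging \<open>\<omega>\<^sub>1, \<omega>\<^sub>2\<close> and shifting by \<open>\<omega>\<^sub>1 + \<omega>\<^sub>2\<close>. Analytic continuation is
  the identity theorem for \<open>\<tau> \<mapsto> \<wp>(f \<tau> | \<tau>)\<close>.

  In part (a), inverting the integrals along the two axes shows that the half-periods of a rectangular
  lattice are \<open>K(m)\<close> and \<open>K(1 - m)\<close> divided by \<open>sqrt (e\<^sub>1 - e\<^sub>2)\<close>. As \<open>E(1)\<close> and \<open>E(\<i>)\<close> are half of the same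
  integrals with \<open>m = cos\<^sup>2 t\<close> and \<open>K\<close> is strictly increasing, no uniformization theorem is needed to
  identify \<open>e\<^sub>1, e\<^sub>2, e\<^sub>3\<close>.\<close>

section \<open>Lattices\<close>

text \<open>Everything is derived from the series, and zeros of \<wp> are not counted by residues.
  What replaces counting is that \<open>(\<wp> z - \<wp> h) * (\<wp> (z + h) - \<wp> h)\<close> is a
  nonzero constant for each half-period h: hence the half-period values are distinct and taken only
  at h modulo periods, F has explicit local roots at its zeros, and an inverted integral can be
  translated back into a value of \<wp>. The upper limits v are made for this. At the inverted point
  of the second formula \<wp> is e2 + 4 / v^2, which is 0 for v^2 = -4 / e2. In the first formula it
  is e1 - 4 / v^2, and v is such that the partner of this value under the shift by the sum of the
  half-periods is 0. A path may return to v = 0 or end at a branch point, and the sign of the root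
  has to be followed; so the derivative of F is carried along with its value. In the continuation a
  zero might run into a pole; this is impossible because z^2 * \<wp> z tends to 1 at the origin,
  even while the half-periods vary.\<close>

definition latpt :: "complex \<Rightarrow> complex \<Rightarrow> int \<times> int \<Rightarrow> complex" where
  "latpt a b p = 2 * of_int (fst p) * a + 2 * of_int (snd p) * b"

text \<open>The l1 norm of the index. It does not depend on the half-periods, so bounds in terms of
  it can be uniform while the lattice moves.\<close>

definition isize :: "int \<times> int \<Rightarrow> real" where
  "isize p = of_int (\<bar>fst p\<bar> + \<bar>snd p\<bar>)"

text \<open>Real linear independence, by the signed area of the parallelogram. No orientation is
  fixed, so the half-periods may be exchanged.\<close>

definition indep :: "complex \<Rightarrow> complex \<Rightarrow> bool" where
  "indep a b \<longleftrightarrow> Im (cnj a * b) \<noteq> 0"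

abbreviation nonzero_idx :: "(int \<times> int) set" where
  "nonzero_idx \<equiv> UNIV - {(0, 0)}"

lemma period_lattice_eq: "period_lattice a b = range (latpt a b)"
  unfolding period_lattice_def latpt_def by (auto simp: image_iff) blast

lemma latpt_add: "latpt a b (p + q) = latpt a b p + latpt a b q"
  by (simp add: latpt_def algebra_simps)

lemma latpt_diff: "latpt a b (p - q) = latpt a b p - latpt a b q"
  by (simp add: latpt_def algebra_simps)

lemma latpt_0 [simp]: "latpt a b (0, 0) = 0"
  by (simp add: latpt_def)

lemma latpt_uminus: "latpt a b (- p) = - latpt a b p"
  by (simp add: latpt_def algebra_simps)

lemma isize_ge_1: "p \<in> nonzero_idx \<Longrightarrow> isize p \<ge> 1"
  by (cases p) (auto simp: isize_def)

lemma isize_nonneg: "isize p \<ge> 0"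
  by (simp add: isize_def)

lemma indep_swap: "indep a b \<Longrightarrow> indep b a"
  unfolding indep_def by (simp add: algebra_simps)

lemma indep_add: "indep a b \<Longrightarrow> indep (a + b) b"
  unfolding indep_def by (simp add: algebra_simps)

lemma indep_scale: "indep a b \<Longrightarrow> c \<noteq> 0 \<Longrightarrow> indep (c * a) (c * b)"
proof -
  assume "indep a b" "c \<noteq> 0"
  have "Im (cnj (c * a) * (c * b)) = (cmod c)\<^sup>2 * Im (cnj a * b)"
  proof -
    have "cnj (c * a) * (c * b) = (cnj c * c) * (cnj a * b)" by simp
    also have "cnj c * c = of_real ((cmod c)\<^sup>2)"
      by (metis complex_norm_square mult.commute)
    finally show ?thesis by (metis Im_complex_of_real Re_complex_of_real add.right_neutral mult_zero_left times_complex.simps(2))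
  qed
  with \<open>indep a b\<close> \<open>c \<noteq> 0\<close> show ?thesis by (simp add: indep_def)
qed

lemma indep_iff_quotient:
  assumes "a \<noteq> 0" shows "indep a b \<longleftrightarrow> Im (b / a) \<noteq> 0"
proof -
  have "Im (b / a) = Im (cnj a * b) / (cmod a)\<^sup>2"
    by (metis Im_divide_of_real complex_div_cnj mult.commute of_real_power)
  then show ?thesis using assms by (simp add: indep_def)
qed

lemma indep_nonzero: "indep a b \<Longrightarrow> a \<noteq> 0 \<and> b \<noteq> 0"
  by (auto simp: indep_def)

text \<open>Cramer's rule: the imaginary part of the product with \<open>cnj a\<close> or
  \<open>cnj b\<close> kills one summand and isolates the coefficient of the other.\<close>

lemma norm_lincomb_ge:
  fixes x y :: real
  shows "(\<bar>x\<bar> + \<bar>y\<bar>) * \<bar>Im (cnj a * b)\<bar> \<le> (cmod a + cmod b) * cmod (of_real x * a + of_real y * b)"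
proof -
  let ?w = "of_real x * a + of_real y * b"
  have "\<bar>y\<bar> * \<bar>Im (cnj a * b)\<bar> = \<bar>Im (cnj a * ?w)\<bar>"
    by (simp add: algebra_simps flip: abs_mult)
  also have "\<dots> \<le> cmod (cnj a * ?w)" by (rule abs_Im_le_cmod)
  also have "\<dots> = cmod a * cmod ?w" by (simp add: norm_mult)
  finally have 1: "\<bar>y\<bar> * \<bar>Im (cnj a * b)\<bar> \<le> cmod a * cmod ?w" .
  have "\<bar>x\<bar> * \<bar>Im (cnj a * b)\<bar> = \<bar>Im (cnj b * ?w)\<bar>"
  proof -
    have "Im (cnj b * ?w) = - (x * Im (cnj a * b))" by (simp add: algebra_simps)
    then show ?thesis by (simp add: abs_mult)
  qed
  also have "\<dots> \<le> cmod (cnj b * ?w)" by (rule abs_Im_le_cmod)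
  also have "\<dots> = cmod b * cmod ?w" by (simp add: norm_mult)
  finally show ?thesis using 1 by (simp add: algebra_simps)
qed

lemma latpt_ge:
  assumes "indep a b"
  obtains c where "c > 0" "\<And>p. cmod (latpt a b p) \<ge> c * isize p"
proof
  let ?d = "\<bar>Im (cnj a * b)\<bar>" and ?s = "cmod a + cmod b"
  have d: "?d > 0" using assms by (simp add: indep_def)
  have s: "?s > 0" using indep_nonzero[OF assms] by (simp add: add_pos_pos)
  show "2 * ?d / ?s > 0" using d s by simp
  fix p :: "int \<times> int"
  have "(2 * isize p) * ?d \<le> ?s * cmod (latpt a b p)"
    using norm_lincomb_ge[of "2 * of_int (fst p)" "2 * of_int (snd p)" a b]
    by (simp add: isize_def latpt_def abs_mult algebra_simps)
  then show "2 * ?d / ?s * isize p \<le> cmod (latpt a b p)"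
    using s by (simp add: field_simps)
qed

lemma inj_latpt: "indep a b \<Longrightarrow> inj (latpt a b)"
proof (rule injI)
  fix p q assume "indep a b" and eq: "latpt a b p = latpt a b q"
  obtain c where "c > 0" "\<And>p. cmod (latpt a b p) \<ge> c * isize p"
    using latpt_ge[OF \<open>indep a b\<close>] by blast
  then have "c * isize (p - q) \<le> 0"
    by (metis eq diff_self latpt_diff norm_zero)
  then have "isize (p - q) \<le> 0" using \<open>c > 0\<close> by (simp add: mult_le_0_iff)
  then show "p = q"
    using isize_ge_1[of "p - q"] by (cases p; cases q) auto
qed

lemma latpt_eq_0_iff: "indep a b \<Longrightarrow> latpt a b p = 0 \<longleftrightarrow> p = (0, 0)"
  using inj_latpt[of a b] latpt_0[of a b] by (metis injD)

section \<open>Summability over the index lattice\<close>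

lemma finite_isize_le: "finite {p. isize p \<le> B}"
proof (rule finite_subset)
  show "{p. isize p \<le> B} \<subseteq> {-\<lfloor>B\<rfloor>..\<lfloor>B\<rfloor>} \<times> {-\<lfloor>B\<rfloor>..\<lfloor>B\<rfloor>}"
  proof
    fix p assume "p \<in> {p. isize p \<le> B}"
    then have "\<bar>fst p\<bar> + \<bar>snd p\<bar> \<le> \<lfloor>B\<rfloor>" by (simp add: isize_def le_floor_iff)
    then show "p \<in> {-\<lfloor>B\<rfloor>..\<lfloor>B\<rfloor>} \<times> {-\<lfloor>B\<rfloor>..\<lfloor>B\<rfloor>}" by (cases p) auto
  qed
qed auto

lemma int_powr_summable:
  "(\<lambda>m::int. (1 + \<bar>of_int m\<bar>) powr (-3/2) :: real) summable_on UNIV"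
proof -
  let ?f = "\<lambda>m::int. (1 + \<bar>of_int m\<bar>) powr (-3/2) :: real"
  have "summable (\<lambda>n. real (Suc n) powr (-3/2))"
    using summable_Suc_iff[of "\<lambda>n. real n powr (-3/2)"] summable_real_powr_iff[of "-3/2"] by simp
  then have *: "(\<lambda>n. real (Suc n) powr (-3/2)) summable_on UNIV"
    using summable_on_UNIV_nonneg_real_iff[of "\<lambda>n. real (Suc n) powr (-3/2)"] by simp
  have b1: "bij_betw int UNIV {0..}"
    by (rule bij_betwI[where g = nat]) auto
  have 1: "?f summable_on {0..}"
    using * summable_on_reindex_bij_betw[OF b1, of ?f] by (simp add: add.commute)
  have b2: "bij_betw uminus {0..} {..0::int}"
    by (rule bij_betwI[where g = uminus]) auto
  have 2: "?f summable_on {..0}"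
    using 1 summable_on_reindex_bij_betw[OF b2, of ?f] by simp
  have "UNIV = {0..} \<union> {..0::int}" by auto
  then show ?thesis using summable_on_union[OF 1 2] by simp
qed

text \<open>Since (1 + |m|) * (1 + |n|) \<le> (2 * s)^2 for an index of size s, the power s^(-3) is
  dominated by a product of two powers with exponent -3/2, each summable over the integers.\<close>

lemma isize_cube_summable: "(\<lambda>p. 1 / isize p ^ 3) summable_on nonzero_idx"
proof -
  let ?f = "\<lambda>m::int. (1 + \<bar>of_int m\<bar>) powr (-3/2) :: real"
  have "(\<lambda>p. ?f (fst p) * ?f (snd p)) summable_on (UNIV \<times> UNIV)"
  proof (rule summable_on_SigmaI)
    show "((\<lambda>y. ?f (fst (x, y)) * ?f (snd (x, y))) has_sum ?f x * infsum ?f UNIV) UNIV" for x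
      using has_sum_cmult_right[OF has_sum_infsum[OF int_powr_summable], of "?f x"] by simp
    show "(\<lambda>x. ?f x * infsum ?f UNIV) summable_on UNIV"
      by (rule summable_on_cmult_left[OF int_powr_summable])
  qed simp
  then have "(\<lambda>p. 8 * (?f (fst p) * ?f (snd p))) summable_on nonzero_idx"
    by (intro summable_on_cmult_right) (rule summable_on_subset, auto)
  then show ?thesis
  proof (rule summable_on_comparison_test)
    fix p :: "int \<times> int" assume p: "p \<in> nonzero_idx"
    let ?x = "\<bar>of_int (fst p)\<bar> :: real" and ?y = "\<bar>of_int (snd p)\<bar> :: real" and ?s = "isize p"
    have s: "?s \<ge> 1" "?s = ?x + ?y" using isize_ge_1[OF p] by (auto simp: isize_def)
    have "(1 + ?x) * (1 + ?y) \<le> (1 + ?s) * (1 + ?s)"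
      by (rule mult_mono) (auto simp: s)
    also have "\<dots> \<le> (2 * ?s) * (2 * ?s)" by (rule mult_mono) (use s in auto)
    finally have le: "(1 + ?x) * (1 + ?y) \<le> (2 * ?s)\<^sup>2" by (simp add: power2_eq_square)
    have "1 / ?s ^ 3 = 8 * ((2 * ?s) powr (-3))"
      using s(1) by (simp add: powr_minus powr_numeral field_simps)
    also have "(2 * ?s) powr (-3) = ((2 * ?s)\<^sup>2) powr (-3/2)"
      using s(1) by (subst powr_numeral[symmetric], simp, subst powr_powr) simp
    also have "\<dots> \<le> ((1 + ?x) * (1 + ?y)) powr (-3/2)"
      by (rule powr_mono2') (use le in auto)
    also have "\<dots> = ?f (fst p) * ?f (snd p)" by (simp add: powr_mult)
    finally show "1 / ?s ^ 3 \<le> 8 * (?f (fst p) * ?f (snd p))" by simp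
  qed (auto simp: isize_nonneg)
qed

section \<open>Locally uniform convergence of the Weierstrass series\<close>

definition wp_term :: "complex \<Rightarrow> complex \<Rightarrow> complex" where
  "wp_term z w = 1 / (z - w)\<^sup>2 - 1 / w\<^sup>2"

definition wp_reg :: "complex \<Rightarrow> complex \<Rightarrow> complex \<Rightarrow> complex" where
  "wp_reg a b z = (\<Sum>\<^sub>\<infinity>p\<in>nonzero_idx. wp_term z (latpt a b p))"

definition wp_reg_dom :: "(complex \<times> complex \<times> complex) set" where
  "wp_reg_dom = {(z, a, b). indep a b \<and> (\<forall>p\<in>nonzero_idx. z \<noteq> latpt a b p)}"

lemma weierstrass_p_eq:
  assumes "indep a b"
  shows "weierstrass_p a b z = 1 / z\<^sup>2 + wp_reg a b z"
proof -
  have "period_lattice a b - {0} = latpt a b ` nonzero_idx"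
    using latpt_eq_0_iff[OF assms] by (auto simp: period_lattice_eq)
  moreover have "inj_on (latpt a b) nonzero_idx"
    using inj_latpt[OF assms] by (rule inj_on_subset) auto
  ultimately show ?thesis
    by (simp add: weierstrass_p_def wp_reg_def infsum_reindex o_def wp_term_def)
qed

lemma latpt_lipschitz:
  assumes "dist a a0 \<le> d" "dist b b0 \<le> d"
  shows "cmod (latpt a b p - latpt a0 b0 p) \<le> 2 * d * isize p"
proof -
  have "latpt a b p - latpt a0 b0 p
      = 2 * of_int (fst p) * (a - a0) + 2 * of_int (snd p) * (b - b0)"
    by (simp add: latpt_def algebra_simps)
  also have "cmod \<dots> \<le> 2 * \<bar>of_int (fst p)\<bar> * dist a a0 + 2 * \<bar>of_int (snd p)\<bar> * dist b b0"
    by (rule norm_triangle_le) (simp add: norm_mult dist_norm)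
  also have "\<dots> \<le> 2 * \<bar>of_int (fst p)\<bar> * d + 2 * \<bar>of_int (snd p)\<bar> * d"
    using assms by (intro add_mono mult_left_mono) auto
  finally show ?thesis by (simp add: isize_def algebra_simps)
qed

text \<open>Outside a finite set of indices the lattice point has more than twice the modulus of z,
  which gives the constant \<open>c0 / 2\<close>; the finitely many remaining quotients have a
  positive minimum.\<close>

lemma latpt_dist_ge:
  assumes "indep a b" "\<And>p. p \<in> nonzero_idx \<Longrightarrow> z \<noteq> latpt a b p"
  obtains c where "c > 0" "\<And>p. p \<in> nonzero_idx \<Longrightarrow> cmod (z - latpt a b p) \<ge> c * isize p"
proof -
  obtain c0 where c0: "c0 > 0" "\<And>p. cmod (latpt a b p) \<ge> c0 * isize p"
    using latpt_ge[OF assms(1)] by blast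
  define K where "K = {p. isize p \<le> 2 * cmod z / c0} \<inter> nonzero_idx"
  have "finite K" unfolding K_def using finite_isize_le by blast
  define q where "q p = cmod (z - latpt a b p) / isize p" for p
  define c where "c = Min (insert (c0 / 2) (q ` K))"
  have "q p > 0" if "p \<in> K" for p
    using that assms(2)[of p] isize_ge_1[of p] by (auto simp: q_def K_def)
  then have "c > 0"
    using \<open>finite K\<close> c0 by (auto simp: c_def)
  moreover have "cmod (z - latpt a b p) \<ge> c * isize p" if p: "p \<in> nonzero_idx" for p
  proof (cases "p \<in> K")
    case True
    then have "c \<le> q p" using \<open>finite K\<close> by (simp add: c_def)
    then show ?thesis using isize_ge_1[OF p] by (simp add: q_def field_simps)
  next
    case False
    then have "cmod z < c0 * isize p / 2" using p c0 by (simp add: K_def field_simps)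
    moreover have "cmod (latpt a b p) - cmod z \<le> cmod (z - latpt a b p)"
      using norm_triangle_ineq2[of "latpt a b p" z] by (simp add: norm_minus_commute)
    moreover have "c \<le> c0 / 2" unfolding c_def using \<open>finite K\<close> by (intro Min_le) auto
    then have "c * isize p \<le> c0 / 2 * isize p"
      by (rule mult_right_mono) (rule isize_nonneg)
    ultimately show ?thesis using c0(2)[of p] by simp
  qed
  ultimately show ?thesis using that by blast
qed

lemma latpt_dist_ge_nbhd:
  assumes "(z0, a0, b0) \<in> wp_reg_dom"
  obtains c d where "c > 0" "d > 0"
    "\<And>z a b p. dist z z0 \<le> d \<Longrightarrow> dist a a0 \<le> d \<Longrightarrow> dist b b0 \<le> d \<Longrightarrow> p \<in> nonzero_idx
       \<Longrightarrow> cmod (z - latpt a b p) \<ge> c * isize p"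
proof -
  obtain c where c: "c > 0" "\<And>p. p \<in> nonzero_idx \<Longrightarrow> cmod (z0 - latpt a0 b0 p) \<ge> c * isize p"
  proof (rule latpt_dist_ge)
    show "indep a0 b0" using assms by (auto simp: wp_reg_dom_def)
    show "z0 \<noteq> latpt a0 b0 p" if "p \<in> nonzero_idx" for p
      using assms that by (auto simp: wp_reg_dom_def)
  qed blast
  \<comment> \<open>Moving z costs c/6 and moving the two half-periods costs 2c/6, each times the
    size of the index; half of c is left.\<close>
  have "cmod (z - latpt a b p) \<ge> (c / 2) * isize p"
    if "dist z z0 \<le> c / 6" "dist a a0 \<le> c / 6" "dist b b0 \<le> c / 6" "p \<in> nonzero_idx" for z a b p
  proof -
    have "cmod (z0 - latpt a0 b0 p) \<le> cmod (z - latpt a b p) + cmod (z0 - z) + cmod (latpt a b p - latpt a0 b0 p)"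
    proof -
      have "cmod (x + y + w) \<le> cmod x + cmod y + cmod w" for x y w
        using norm_triangle_ineq[of "x + y" w] norm_triangle_ineq[of x y] by linarith
      from this[of "z - latpt a b p" "z0 - z" "latpt a b p - latpt a0 b0 p"] show ?thesis by simp
    qed
    moreover have "cmod (z0 - z) \<le> c / 6 * isize p"
    proof -
      have "cmod (z0 - z) \<le> c / 6 * 1" using that(1) by (simp add: dist_norm norm_minus_commute)
      also have "\<dots> \<le> c / 6 * isize p" using c isize_ge_1[OF that(4)] by (intro mult_left_mono) auto
      finally show ?thesis .
    qed
    moreover have "cmod (latpt a b p - latpt a0 b0 p) \<le> 2 * (c / 6) * isize p"
      by (rule latpt_lipschitz) (use that in auto)
    ultimately show ?thesis using c(2)[OF that(4)] by (simp add: algebra_simps)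
  qed
  then show ?thesis using that[of "c / 2" "c / 6"] c(1) by simp
qed

lemma continuous_on_wp_term:
  assumes "continuous_on S f" "continuous_on S g"
    and "\<And>x. x \<in> S \<Longrightarrow> g x \<noteq> 0" "\<And>x. x \<in> S \<Longrightarrow> f x \<noteq> g x"
  shows "continuous_on S (\<lambda>x. wp_term (f x) (g x))"
  unfolding wp_term_def using assms by (intro continuous_intros) auto

lemma holomorphic_on_wp_term:
  assumes "f holomorphic_on S" "g holomorphic_on S"
    and "\<And>x. x \<in> S \<Longrightarrow> g x \<noteq> 0" "\<And>x. x \<in> S \<Longrightarrow> f x \<noteq> g x"
  shows "(\<lambda>x. wp_term (f x) (g x)) holomorphic_on S"
  unfolding wp_term_def using assms by (intro holomorphic_intros) auto

lemma DERIV_inverse_square: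
  assumes "z \<noteq> (w :: complex)"
  shows "((\<lambda>z. 1 / (z - w)\<^sup>2) has_field_derivative -2 / (z - w) ^ 3) (at z)"
proof -
  define u where "u = z - w"
  have "((\<lambda>v. 1 / v\<^sup>2) has_field_derivative -2 / u ^ 3) (at u)"
    using assms by (auto intro!: derivative_eq_intros simp: u_def[symmetric] field_simps power2_eq_square power3_eq_cube)
       (simp add: u_def)
  moreover have "((\<lambda>z. z - w) has_field_derivative 1) (at z)"
    by (auto intro!: derivative_eq_intros)
  ultimately show ?thesis
    unfolding u_def using DERIV_chain2[of "\<lambda>v. 1 / v\<^sup>2" _ "\<lambda>z. z - w"] by fastforce
qed

lemma DERIV_wp_term:
  assumes "z \<noteq> w"
  shows "((\<lambda>z. wp_term z w) has_field_derivative -2 / (z - w) ^ 3) (at z)"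
  using DERIV_diff[OF DERIV_inverse_square[OF assms] DERIV_const] by (simp add: wp_term_def)

text \<open>Over the common denominator w^2 cancels in the numerator, which becomes z * (2w - z).
  This leaves decay of order 3 instead of 2.\<close>

lemma wp_term_bound:
  assumes "c > 0" "s \<ge> 1" "cmod w \<ge> c * s" "cmod (z - w) \<ge> c * s" "cmod z \<le> R" "cmod w \<le> B * s"
  shows "cmod (wp_term z w) \<le> R * (2 * B + R) / c ^ 4 * (1 / s ^ 3)"
proof -
  have pos: "c * s > 0" using assms by simp
  then have nz: "w \<noteq> 0" "z - w \<noteq> 0" using assms(3,4) by fastforce+
  have "wp_term z w = z * (2 * w - z) / (w\<^sup>2 * (z - w)\<^sup>2)"
  proof -
    have "wp_term z w = (1 * w\<^sup>2 - 1 * (z - w)\<^sup>2) / ((z - w)\<^sup>2 * w\<^sup>2)"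
      unfolding wp_term_def by (rule diff_frac_eq) (use nz in simp_all)
    also have "1 * w\<^sup>2 - 1 * (z - w)\<^sup>2 = z * (2 * w - z)"
      by (simp add: power2_eq_square algebra_simps)
    finally show ?thesis by (simp add: mult.commute)
  qed
  then have "cmod (wp_term z w) = cmod z * cmod (2 * w - z) / ((cmod w)\<^sup>2 * (cmod (z - w))\<^sup>2)"
    by (simp add: norm_mult norm_divide norm_power)
  also have "\<dots> \<le> R * ((2 * B + R) * s) / ((c * s)\<^sup>2 * (c * s)\<^sup>2)"
  proof (rule frac_le)
    have R: "R \<ge> 0" using assms(5) norm_ge_zero order_trans by blast
    have "cmod (2 * w - z) \<le> 2 * cmod w + cmod z"
      using norm_triangle_ineq4[of "2 * w" z] by (simp add: norm_mult)
    also have "\<dots> \<le> 2 * (B * s) + R * s"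
      using assms R mult_left_mono[of 1 s R] by (intro add_mono) auto
    finally have "cmod (2 * w - z) \<le> (2 * B + R) * s" by (simp add: algebra_simps)
    then show "cmod z * cmod (2 * w - z) \<le> R * ((2 * B + R) * s)"
      by (intro mult_mono) (use assms R in auto)
    show "(c * s)\<^sup>2 * (c * s)\<^sup>2 \<le> (cmod w)\<^sup>2 * (cmod (z - w))\<^sup>2"
      by (intro mult_mono power_mono) (use assms pos in auto)
    show "0 < (c * s)\<^sup>2 * (c * s)\<^sup>2" by (intro mult_pos_pos zero_less_power pos)
    show "0 \<le> R * ((2 * B + R) * s)"
      using \<open>cmod z * cmod (2 * w - z) \<le> R * ((2 * B + R) * s)\<close>
      by (meson mult_nonneg_nonneg norm_ge_zero order_trans)
  qed
  also have "\<dots> = R * (2 * B + R) / c ^ 4 * (1 / s ^ 3)"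
    using assms by (simp add: field_simps power2_eq_square eval_nat_numeral)
  finally show ?thesis .
qed

text \<open>The M-test jointly in the point and both half-periods. Continuity, holomorphic
  dependence on parameters and termwise differentiation are all read off from it.\<close>

lemma wp_reg_uniform_limit:
  assumes x0: "x0 \<in> wp_reg_dom"
  obtains N where "open N" "x0 \<in> N"
    "\<And>z a b p. (z, a, b) \<in> N \<Longrightarrow> p \<in> nonzero_idx \<Longrightarrow> latpt a b p \<noteq> 0 \<and> z \<noteq> latpt a b p"
    "uniform_limit N (\<lambda>X (z, a, b). \<Sum>p\<in>X. wp_term z (latpt a b p)) (\<lambda>(z, a, b). wp_reg a b z)
       (finite_subsets_at_top nonzero_idx)"
proof -
  obtain z0 a0 b0 where x0_eq: "x0 = (z0, a0, b0)" by (cases x0)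
  have ind: "indep a0 b0" using x0 by (simp add: x0_eq wp_reg_dom_def)
  obtain c1 d1 where c1: "c1 > 0" "d1 > 0"
    "\<And>z a b p. dist z z0 \<le> d1 \<Longrightarrow> dist a a0 \<le> d1 \<Longrightarrow> dist b b0 \<le> d1 \<Longrightarrow> p \<in> nonzero_idx
       \<Longrightarrow> cmod (z - latpt a b p) \<ge> c1 * isize p"
    using latpt_dist_ge_nbhd x0 unfolding x0_eq by metis
  \<comment> \<open>The same neighbourhood bound at the origin bounds the lattice points themselves
    from below.\<close>
  have "(0, a0, b0) \<in> wp_reg_dom"
    using ind latpt_eq_0_iff[OF ind] by (auto simp: wp_reg_dom_def)
  then obtain c2 d2 where c2: "c2 > 0" "d2 > 0"
    "\<And>z a b p. dist z 0 \<le> d2 \<Longrightarrow> dist a a0 \<le> d2 \<Longrightarrow> dist b b0 \<le> d2 \<Longrightarrow> p \<in> nonzero_idx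
       \<Longrightarrow> cmod (z - latpt a b p) \<ge> c2 * isize p"
    using latpt_dist_ge_nbhd by metis
  define c where "c = min c1 c2"
  define d where "d = min d1 d2"
  have cd: "c > 0" "d > 0" using c1 c2 by (auto simp: c_def d_def)
  define N where "N = ball x0 d"
  define B where "B = 2 * (cmod a0 + d) + 2 * (cmod b0 + d)"
  define R where "R = cmod z0 + d"
  have NN: "dist z z0 \<le> d" "dist a a0 \<le> d" "dist b b0 \<le> d" if "(z, a, b) \<in> N" for z a b
    using that dist_fst_le[of x0 "(z, a, b)"] dist_snd_le[of x0 "(z, a, b)"]
      dist_fst_le[of "snd x0" "(a, b)"] dist_snd_le[of "snd x0" "(a, b)"]
    by (auto simp: N_def x0_eq dist_commute)
  have low: "cmod (z - latpt a b p) \<ge> c * isize p" "cmod (latpt a b p) \<ge> c * isize p"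
    if "(z, a, b) \<in> N" "p \<in> nonzero_idx" for z a b p
  proof -
    have "c * isize p \<le> c1 * isize p" "c * isize p \<le> c2 * isize p"
      by (auto intro!: mult_right_mono simp: c_def isize_nonneg[of p])
    then show "cmod (z - latpt a b p) \<ge> c * isize p" "cmod (latpt a b p) \<ge> c * isize p"
      using c1(3)[of z a b p] c2(3)[of 0 a b p] NN[OF that(1)] that(2) c2(2) by (auto simp: d_def)
  qed
  have bound: "cmod (wp_term z (latpt a b p)) \<le> R * (2 * B + R) / c ^ 4 * (1 / isize p ^ 3)"
    if zab: "(z, a, b) \<in> N" and p: "p \<in> nonzero_idx" for z a b p
  proof (rule wp_term_bound[OF cd(1) isize_ge_1[OF p] low(2)[OF that] low(1)[OF that]])
    show "cmod z \<le> R"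
      using NN(1)[OF zab] norm_triangle_ineq2[of z z0] by (simp add: R_def dist_norm)
    have "cmod a \<le> cmod a0 + d" "cmod b \<le> cmod b0 + d"
      using NN(2,3)[OF zab] norm_triangle_ineq2[of a a0] norm_triangle_ineq2[of b b0]
      by (auto simp: dist_norm)
    moreover have "cmod (latpt a b p) \<le> (2 * cmod a) * \<bar>of_int (fst p)\<bar> + (2 * cmod b) * \<bar>of_int (snd p)\<bar>"
      unfolding latpt_def by (rule norm_triangle_le) (simp add: norm_mult)
    moreover have "(2 * cmod a) * \<bar>of_int (fst p)\<bar> \<le> (2 * cmod a) * isize p"
      "(2 * cmod b) * \<bar>of_int (snd p)\<bar> \<le> (2 * cmod b) * isize p"
      by (intro mult_left_mono; simp add: isize_def)+
    moreover have "(2 * cmod a + 2 * cmod b) * isize p \<le> B * isize p"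
      using calculation(1,2) by (intro mult_right_mono isize_nonneg) (simp add: B_def)
    ultimately show "cmod (latpt a b p) \<le> B * isize p" by (simp add: algebra_simps)
  qed
  have lim: "uniform_limit N (\<lambda>X y. \<Sum>p\<in>X. (\<lambda>p (z, a, b). wp_term z (latpt a b p)) p y)
          (\<lambda>y. \<Sum>\<^sub>\<infinity>p\<in>nonzero_idx. (\<lambda>p (z, a, b). wp_term z (latpt a b p)) p y)
       (finite_subsets_at_top nonzero_idx)"
  proof (rule Weierstrass_m_test_general)
    show "(\<lambda>p. R * (2 * B + R) / c ^ 4 * (1 / isize p ^ 3)) summable_on nonzero_idx"
      by (rule summable_on_cmult_right[OF isize_cube_summable])
    show "cmod ((\<lambda>p (z, a, b). wp_term z (latpt a b p)) p y) \<le> R * (2 * B + R) / c ^ 4 * (1 / isize p ^ 3)"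
      if "p \<in> nonzero_idx" "y \<in> N" for p y
      using bound[OF _ that(1)] that(2) by (cases y) simp
  qed
  show ?thesis
  proof (rule that)
    show "open N" "x0 \<in> N" using cd by (auto simp: N_def)
    show "latpt a b p \<noteq> 0 \<and> z \<noteq> latpt a b p" if "(z, a, b) \<in> N" "p \<in> nonzero_idx" for z a b p
    proof -
      have "c * isize p > 0" using cd(1) isize_ge_1[OF that(2)] by (intro mult_pos_pos) auto
      then have "cmod (latpt a b p) > 0" "cmod (z - latpt a b p) > 0"
        using low[OF that] by linarith+
      then show ?thesis by auto
    qed
    show "uniform_limit N (\<lambda>X (z, a, b). \<Sum>p\<in>X. wp_term z (latpt a b p))
       (\<lambda>(z, a, b). wp_reg a b z) (finite_subsets_at_top nonzero_idx)"
      using lim by (simp add: case_prod_unfold wp_reg_def)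
  qed
qed

lemma tendsto_wp_reg:
  assumes x0: "(z0, a0, b0) \<in> wp_reg_dom"
    and lim: "(z \<longlongrightarrow> z0) F" "(a \<longlongrightarrow> a0) F" "(b \<longlongrightarrow> b0) F"
  shows "((\<lambda>t. wp_reg (a t) (b t) (z t)) \<longlongrightarrow> wp_reg a0 b0 z0) F"
proof -
  obtain N where N: "open N" "(z0, a0, b0) \<in> N"
    "\<And>z a b p. (z, a, b) \<in> N \<Longrightarrow> p \<in> nonzero_idx \<Longrightarrow> latpt a b p \<noteq> 0 \<and> z \<noteq> latpt a b p"
    "uniform_limit N (\<lambda>X (z, a, b). \<Sum>p\<in>X. wp_term z (latpt a b p)) (\<lambda>(z, a, b). wp_reg a b z)
       (finite_subsets_at_top nonzero_idx)"
    by (rule wp_reg_uniform_limit[OF x0]) (rule that; assumption)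
  have "continuous_on N (\<lambda>(z, a, b). wp_reg a b z)"
  proof (rule uniform_limit_theorem[OF _ N(4)])
    show "\<forall>\<^sub>F X in finite_subsets_at_top nonzero_idx.
            continuous_on N (\<lambda>(z, a, b). \<Sum>p\<in>X. wp_term z (latpt a b p))"
    proof (rule eventually_finite_subsets_at_top_weakI)
      fix X assume X: "finite X" "X \<subseteq> nonzero_idx"
      show "continuous_on N (\<lambda>(z, a, b). \<Sum>p\<in>X. wp_term z (latpt a b p))"
        unfolding case_prod_unfold
      proof (intro continuous_on_sum continuous_on_wp_term)
        fix p assume "p \<in> X"
        then have p: "p \<in> nonzero_idx" using X by blast
        show "continuous_on N (\<lambda>x. latpt (fst (snd x)) (snd (snd x)) p)"
          unfolding latpt_def by (intro continuous_intros)
        show "latpt (fst (snd x)) (snd (snd x)) p \<noteq> 0" "fst x \<noteq> latpt (fst (snd x)) (snd (snd x)) p"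
          if "x \<in> N" for x
          using N(3)[OF _ p, of "fst x" "fst (snd x)" "snd (snd x)"] that by auto
      qed (intro continuous_intros)
    qed
  qed simp
  then have "isCont (\<lambda>(z, a, b). wp_reg a b z) (z0, a0, b0)"
    using N(1,2) continuous_on_eq_continuous_at by blast
  from isCont_tendsto_compose[OF this tendsto_Pair[OF lim(1) tendsto_Pair[OF lim(2,3)]]]
  show ?thesis by simp
qed

text \<open>The point and the half-periods move together along one complex parameter. It is the
  point itself for a fixed lattice, and \<tau> in the continuation argument.\<close>

lemma holomorphic_on_wp_reg:
  assumes U: "open U" "z holomorphic_on U" "a holomorphic_on U" "b holomorphic_on U"
    and dom: "\<And>t. t \<in> U \<Longrightarrow> (z t, a t, b t) \<in> wp_reg_dom"
  shows "(\<lambda>t. wp_reg (a t) (b t) (z t)) holomorphic_on U"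
proof -
  have "(\<lambda>t. wp_reg (a t) (b t) (z t)) field_differentiable at t0" if t0: "t0 \<in> U" for t0
  proof -
    let ?c = "\<lambda>t. (z t, a t, b t)"
    obtain N where N: "open N" "?c t0 \<in> N"
      "\<And>z a b p. (z, a, b) \<in> N \<Longrightarrow> p \<in> nonzero_idx \<Longrightarrow> latpt a b p \<noteq> 0 \<and> z \<noteq> latpt a b p"
      "uniform_limit N (\<lambda>X (z, a, b). \<Sum>p\<in>X. wp_term z (latpt a b p)) (\<lambda>(z, a, b). wp_reg a b z)
         (finite_subsets_at_top nonzero_idx)"
      by (rule wp_reg_uniform_limit[OF dom[OF t0]]) (rule that; assumption)
    have "continuous_on U ?c"
      using U by (intro continuous_intros holomorphic_on_imp_continuous_on)
    then have "open (?c -` N \<inter> U)" using U(1) N(1) continuous_on_open_vimage by blast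
    moreover have "t0 \<in> ?c -` N \<inter> U" using t0 N(2) by simp
    ultimately obtain r where r: "r > 0" "cball t0 r \<subseteq> ?c -` N \<inter> U"
      using open_contains_cball by metis
    have lim: "uniform_limit (cball t0 r) (\<lambda>X t. \<Sum>p\<in>X. wp_term (z t) (latpt (a t) (b t) p))
           (\<lambda>t. wp_reg (a t) (b t) (z t)) (finite_subsets_at_top nonzero_idx)"
      unfolding uniform_limit_iff
    proof (intro allI impI)
      fix e :: real assume "e > 0"
      with N(4) have "\<forall>\<^sub>F X in finite_subsets_at_top nonzero_idx. \<forall>x\<in>N.
            dist (case x of (z, a, b) \<Rightarrow> \<Sum>p\<in>X. wp_term z (latpt a b p)) (case x of (z, a, b) \<Rightarrow> wp_reg a b z) < e"
        unfolding uniform_limit_iff by blast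
      then show "\<forall>\<^sub>F X in finite_subsets_at_top nonzero_idx. \<forall>t\<in>cball t0 r.
            dist (\<Sum>p\<in>X. wp_term (z t) (latpt (a t) (b t) p)) (wp_reg (a t) (b t) (z t)) < e"
        by (rule eventually_mono) (use r(2) in fastforce)
    qed
    have hol: "(\<lambda>t. \<Sum>p\<in>X. wp_term (z t) (latpt (a t) (b t) p)) holomorphic_on cball t0 r"
      if X: "finite X" "X \<subseteq> nonzero_idx" for X
    proof (rule holomorphic_on_sum)
      fix p assume p: "p \<in> X"
      have sub: "cball t0 r \<subseteq> U" using r(2) by blast
      show "(\<lambda>t. wp_term (z t) (latpt (a t) (b t) p)) holomorphic_on cball t0 r"
      proof (rule holomorphic_on_wp_term)
        show "(\<lambda>t. latpt (a t) (b t) p) holomorphic_on cball t0 r"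
          unfolding latpt_def
          by (intro holomorphic_intros holomorphic_on_subset[OF U(3) sub] holomorphic_on_subset[OF U(4) sub])
        show "latpt (a t) (b t) p \<noteq> 0" "z t \<noteq> latpt (a t) (b t) p" if "t \<in> cball t0 r" for t
          using N(3)[of "z t" "a t" "b t" p] r(2) that subsetD[OF X(2) p] by blast+
      qed (rule holomorphic_on_subset[OF U(2) sub])
    qed
    have "(\<lambda>t. wp_reg (a t) (b t) (z t)) holomorphic_on ball t0 r"
    proof (rule holomorphic_uniform_limit[OF _ lim])
      show "\<forall>\<^sub>F X in finite_subsets_at_top nonzero_idx.
         continuous_on (cball t0 r) (\<lambda>t. \<Sum>p\<in>X. wp_term (z t) (latpt (a t) (b t) p)) \<and>
         (\<lambda>t. \<Sum>p\<in>X. wp_term (z t) (latpt (a t) (b t) p)) holomorphic_on ball t0 r"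
        by (rule eventually_finite_subsets_at_top_weakI)
           (intro conjI holomorphic_on_imp_continuous_on holomorphic_on_subset[OF hol ball_subset_cball] hol)
    qed auto
    then show ?thesis using r(1) by (meson centre_in_ball holomorphic_on_imp_differentiable_at open_ball)
  qed
  then show ?thesis using U(1) by (auto simp: holomorphic_on_def field_differentiable_at_within)
qed

lemma deriv_wp_reg:
  assumes x0: "(z0, a, b) \<in> wp_reg_dom"
  shows "((\<lambda>p. -2 / (z0 - latpt a b p) ^ 3) has_sum deriv (wp_reg a b) z0) nonzero_idx"
proof -
  obtain N where N: "open N" "(z0, a, b) \<in> N"
    "\<And>z a b p. (z, a, b) \<in> N \<Longrightarrow> p \<in> nonzero_idx \<Longrightarrow> latpt a b p \<noteq> 0 \<and> z \<noteq> latpt a b p"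
    "uniform_limit N (\<lambda>X (z, a, b). \<Sum>p\<in>X. wp_term z (latpt a b p)) (\<lambda>(z, a, b). wp_reg a b z)
       (finite_subsets_at_top nonzero_idx)"
    by (rule wp_reg_uniform_limit[OF x0]) (rule that; assumption)
  define A where "A = (\<lambda>z. (z, a, b)) -` N"
  have A: "open A" "z0 \<in> A"
    unfolding A_def using N by (auto intro!: continuous_open_vimage continuous_intros)
  have lim: "uniform_limit A (\<lambda>X z. \<Sum>p\<in>X. wp_term z (latpt a b p)) (wp_reg a b)
       (finite_subsets_at_top nonzero_idx)"
    unfolding uniform_limit_iff
  proof (intro allI impI)
    fix e :: real assume "e > 0"
    with N(4) have "\<forall>\<^sub>F X in finite_subsets_at_top nonzero_idx. \<forall>x\<in>N.
          dist (case x of (z, a, b) \<Rightarrow> \<Sum>p\<in>X. wp_term z (latpt a b p)) (case x of (z, a, b) \<Rightarrow> wp_reg a b z) < e"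
      unfolding uniform_limit_iff by blast
    then show "\<forall>\<^sub>F X in finite_subsets_at_top nonzero_idx. \<forall>z\<in>A.
          dist (\<Sum>p\<in>X. wp_term z (latpt a b p)) (wp_reg a b z) < e"
      by (rule eventually_mono) (fastforce simp: A_def)
  qed

  have der: "((\<lambda>z. \<Sum>p\<in>X. wp_term z (latpt a b p)) has_field_derivative
       (\<Sum>p\<in>X. -2 / (z - latpt a b p) ^ 3)) (at z)" if "X \<subseteq> nonzero_idx" "z \<in> A" for X z
  proof (rule DERIV_sum)
    fix p assume "p \<in> X"
    then have "z \<noteq> latpt a b p" using that N(3)[of z a b p] by (auto simp: A_def)
    then show "((\<lambda>z. wp_term z (latpt a b p)) has_field_derivative -2 / (z - latpt a b p) ^ 3) (at z)"
      by (rule DERIV_wp_term)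
  qed
  have "((\<lambda>X. deriv (\<lambda>z. \<Sum>p\<in>X. wp_term z (latpt a b p)) z0) \<longlongrightarrow> deriv (wp_reg a b) z0)
          (finite_subsets_at_top nonzero_idx)"
  proof (rule deriv_complex_uniform_limit[OF lim _ _ A])
    show "\<forall>\<^sub>F X in finite_subsets_at_top nonzero_idx. (\<lambda>z. \<Sum>p\<in>X. wp_term z (latpt a b p)) holomorphic_on A"
    proof (rule eventually_finite_subsets_at_top_weakI)
      fix X :: "(int \<times> int) set" assume "X \<subseteq> nonzero_idx"
      then show "(\<lambda>z. \<Sum>p\<in>X. wp_term z (latpt a b p)) holomorphic_on A"
        using der[of X] unfolding holomorphic_on_open[OF A(1)] by fast
    qed
  qed simp
  then show ?thesis
    unfolding has_sum_def
  proof (rule Lim_transform_eventually)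
    show "\<forall>\<^sub>F X in finite_subsets_at_top nonzero_idx.
      deriv (\<lambda>z. \<Sum>p\<in>X. wp_term z (latpt a b p)) z0 = (\<Sum>p\<in>X. -2 / (z0 - latpt a b p) ^ 3)"
      by (rule eventually_finite_subsets_at_top_weakI) (rule DERIV_imp_deriv[OF der[OF _ A(2)]])
  qed
qed

section \<open>Periodicity of the Weierstrass function\<close>

lemma lattice_0: "0 \<in> period_lattice a b"
  by (metis latpt_0 period_lattice_eq rangeI)

lemma lattice_add: "v \<in> period_lattice a b \<Longrightarrow> w \<in> period_lattice a b \<Longrightarrow> v + w \<in> period_lattice a b"
  unfolding period_lattice_eq by (auto simp flip: latpt_add)

lemma lattice_uminus: "w \<in> period_lattice a b \<Longrightarrow> - w \<in> period_lattice a b"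
  unfolding period_lattice_eq by (auto simp flip: latpt_uminus)

lemma lattice_uminus_iff: "- w \<in> period_lattice a b \<longleftrightarrow> w \<in> period_lattice a b"
  using lattice_uminus[of w] lattice_uminus[of "- w"] by auto

lemma lattice_add_iff: "w \<in> period_lattice a b \<Longrightarrow> z + w \<in> period_lattice a b \<longleftrightarrow> z \<in> period_lattice a b"
  using lattice_add[of z a b w] lattice_add[of "z + w" a b "- w"] lattice_uminus[of w a b] by auto

lemma lattice_diff_iff: "w \<in> period_lattice a b \<Longrightarrow> z - w \<in> period_lattice a b \<longleftrightarrow> z \<in> period_lattice a b"
  using lattice_add_iff[OF lattice_uminus[of w a b], of z] by simp

lemma lattice_periods: "2 * a \<in> period_lattice a b" "2 * b \<in> period_lattice a b"
proof -
  have "2 * a = latpt a b (1, 0)" "2 * b = latpt a b (0, 1)" by (simp_all add: latpt_def)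
  then show "2 * a \<in> period_lattice a b" "2 * b \<in> period_lattice a b"
    unfolding period_lattice_eq by (metis rangeI)+
qed

lemma lattice_real_coords:
  assumes ind: "indep a b"
  shows "of_real x * (2 * a) + of_real y * (2 * b) \<in> period_lattice a b \<longleftrightarrow> x \<in> \<int> \<and> y \<in> \<int>"
proof
  assume "of_real x * (2 * a) + of_real y * (2 * b) \<in> period_lattice a b"
  then obtain p where p: "of_real x * (2 * a) + of_real y * (2 * b) = latpt a b p"
    by (auto simp: period_lattice_eq)
  have "2 * (of_real (x - of_int (fst p)) * a + of_real (y - of_int (snd p)) * b) = 0"
    using p by (simp add: latpt_def algebra_simps)
  then have "of_real (x - of_int (fst p)) * a + of_real (y - of_int (snd p)) * b = 0"
    unfolding mult_eq_0_iff by simp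
  then have "(\<bar>x - of_int (fst p)\<bar> + \<bar>y - of_int (snd p)\<bar>) * \<bar>Im (cnj a * b)\<bar> \<le> 0"
    using norm_lincomb_ge[of "x - of_int (fst p)" "y - of_int (snd p)" a b] by (simp del: of_real_diff)
  moreover have "\<bar>Im (cnj a * b)\<bar> > 0" using ind by (simp add: indep_def)
  ultimately have "\<bar>x - of_int (fst p)\<bar> + \<bar>y - of_int (snd p)\<bar> \<le> 0"
    by (simp add: mult_le_0_iff)
  then have "x = of_int (fst p)" "y = of_int (snd p)" by auto
  then show "x \<in> \<int> \<and> y \<in> \<int>" by simp
next
  assume "x \<in> \<int> \<and> y \<in> \<int>"
  then obtain m n where "x = of_int m" "y = of_int n" by (auto elim!: Ints_cases)
  then have "of_real x * (2 * a) + of_real y * (2 * b) = latpt a b (m, n)"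
    by (simp add: latpt_def algebra_simps)
  then show "of_real x * (2 * a) + of_real y * (2 * b) \<in> period_lattice a b"
    by (simp add: period_lattice_eq)
qed

lemma half_not_Ints: "(1 / 2 :: real) \<notin> \<int>"
proof
  assume "(1 / 2 :: real) \<in> \<int>"
  then obtain n :: int where "(1 / 2 :: real) = of_int n" by (auto elim: Ints_cases)
  then have "(1 :: real) = of_int (2 * n)" by simp
  then have "1 = 2 * n" by linarith
  then show False by presburger
qed

lemma half_periods_not_lattice:
  assumes "indep a b"
  shows "a \<notin> period_lattice a b" "b \<notin> period_lattice a b" "a + b \<notin> period_lattice a b"
    "a - b \<notin> period_lattice a b"
  using lattice_real_coords[OF assms, of "1 / 2" 0] lattice_real_coords[OF assms, of 0 "1 / 2"]
    lattice_real_coords[OF assms, of "1 / 2" "1 / 2"] lattice_real_coords[OF assms, of "1 / 2" "- 1 / 2"]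
    half_not_Ints by auto

lemma lattice_swap: "period_lattice b a = period_lattice a b"
  unfolding period_lattice_def by (auto simp: add.commute) (metis add.commute)+

lemma lattice_shear: "period_lattice (a + b) b = period_lattice a b"
proof -
  have "2 * of_int m * (a + b) + 2 * of_int n * b = 2 * of_int m * a + 2 * of_int (n + m) * b"
    "2 * of_int m * a + 2 * of_int n * b = 2 * of_int m * (a + b) + 2 * of_int (n - m) * b"
    for m n :: int by (simp_all add: algebra_simps)
  then show ?thesis unfolding period_lattice_def by blast
qed

lemma lattice_minus_left: "period_lattice (- a) b = period_lattice a b"
proof -
  have "2 * of_int m * (- a) + 2 * of_int n * b = 2 * of_int (- m) * a + 2 * of_int n * b"
    "2 * of_int m * a + 2 * of_int n * b = 2 * of_int (- m) * (- a) + 2 * of_int n * b"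
    for m n :: int by simp_all
  then show ?thesis unfolding period_lattice_def by blast
qed

lemma weierstrass_p_lattice_cong:
  "period_lattice a b = period_lattice a' b' \<Longrightarrow> weierstrass_p a b = weierstrass_p a' b'"
  by (simp add: weierstrass_p_def fun_eq_iff)

lemma wp_reg_dom_iff:
  assumes "indep a b"
  shows "(z, a, b) \<in> wp_reg_dom \<longleftrightarrow> z \<notin> period_lattice a b - {0}"
  using assms latpt_eq_0_iff[OF assms] by (auto simp: wp_reg_dom_def period_lattice_eq)

lemma lattice_ball_disjoint:
  assumes "indep a b"
  obtains r where "r > 0" "\<And>w. w \<in> period_lattice a b \<Longrightarrow> dist z w < r \<Longrightarrow> w = z"
proof -
  \<comment> \<open>\<open>w0\<close> is z if z is a lattice point, and some lattice point
    otherwise. After translation by \<open>w0\<close> a bound over the nonzero indices covers every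
    other lattice point.\<close>
  obtain w0 where w0: "w0 \<in> period_lattice a b" "\<And>w. w \<in> period_lattice a b \<Longrightarrow> z = w \<Longrightarrow> z = w0"
    using lattice_0 by metis
  obtain c where c: "c > 0" "\<And>p. p \<in> nonzero_idx \<Longrightarrow> cmod (z - w0 - latpt a b p) \<ge> c * isize p"
  proof (cases "z \<in> period_lattice a b")
    case True
    then have "z = w0" using w0(2) by blast
    show ?thesis
    proof (rule latpt_dist_ge[OF assms, of 0])
      show "0 \<noteq> latpt a b p" if "p \<in> nonzero_idx" for p
        using that latpt_eq_0_iff[OF assms, of p] by auto
    qed (use that \<open>z = w0\<close> in auto)
  next
    case False
    then have "z - w0 \<notin> period_lattice a b" using lattice_diff_iff[OF w0(1)] by blast
    then have "z - w0 \<noteq> latpt a b p" for p by (auto simp: period_lattice_eq)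
    then show ?thesis using latpt_dist_ge[OF assms, of "z - w0"] that by blast
  qed
  define r where "r = (if z = w0 then c else min c (dist z w0))"
  have "r > 0" using c(1) by (simp add: r_def)
  moreover have "w = z" if w: "w \<in> period_lattice a b" "dist z w < r" for w
  proof (rule ccontr)
    assume "w \<noteq> z"
    have "w - w0 \<in> period_lattice a b" using w(1) w0(1) lattice_diff_iff by blast
    then obtain p where p: "w - w0 = latpt a b p" by (auto simp: period_lattice_eq)
    show False
    proof (cases "p = (0, 0)")
      case True
      then have "w = w0" using p by simp
      then show False using w(2) \<open>w \<noteq> z\<close> by (auto simp: r_def)
    next
      case False
      then have "c * isize p \<le> dist z w" using c(2)[of p] by (simp add: dist_norm flip: p)
      moreover have "c * 1 \<le> c * isize p"
        using c(1) False isize_ge_1[of p] by (intro mult_left_mono) auto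
      ultimately show False using w(2) by (auto simp: r_def split: if_splits)
    qed
  qed
  ultimately show ?thesis using that by blast
qed

lemma open_lattice_compl:
  assumes "indep a b" shows "open (- period_lattice a b)"
  unfolding open_dist
proof
  fix z assume z: "z \<in> - period_lattice a b"
  obtain r where r: "r > 0" "\<And>w. w \<in> period_lattice a b \<Longrightarrow> dist z w < r \<Longrightarrow> w = z"
    using lattice_ball_disjoint[OF assms, of z] by metis
  have "w \<in> - period_lattice a b" if "dist w z < r" for w
    using r(2)[of w] that z by (auto simp: dist_commute)
  then show "\<exists>e>0. \<forall>w. dist w z < e \<longrightarrow> w \<in> - period_lattice a b" using r(1) by blast
qed

lemma connected_lattice_compl: "connected (- period_lattice a b)"
proof -
  have "countable (period_lattice a b)" unfolding period_lattice_eq by auto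
  then show ?thesis
    using connected_open_diff_countable[of "UNIV :: complex set" "period_lattice a b"]
    by (simp add: Compl_eq_Diff_UNIV connected_UNIV)
qed

section \<open>Holomorphy, parity, homogeneity and periods of the Weierstrass function\<close>

lemma holomorphic_on_weierstrass_p_curve:
  assumes U: "open U" "z holomorphic_on U" "a holomorphic_on U" "b holomorphic_on U"
    and dom: "\<And>t. t \<in> U \<Longrightarrow> indep (a t) (b t)" "\<And>t. t \<in> U \<Longrightarrow> z t \<notin> period_lattice (a t) (b t)"
  shows "(\<lambda>t. weierstrass_p (a t) (b t) (z t)) holomorphic_on U"
proof -
  have "(\<lambda>t. 1 / (z t)\<^sup>2 + wp_reg (a t) (b t) (z t)) holomorphic_on U"
    using dom lattice_0 U
    by (intro holomorphic_intros holomorphic_on_wp_reg) (auto simp: wp_reg_dom_iff, metis lattice_0)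
  then show ?thesis
    by (rule holomorphic_transform) (simp add: weierstrass_p_eq dom)
qed

lemma holomorphic_on_weierstrass_p:
  "indep a b \<Longrightarrow> weierstrass_p a b holomorphic_on - period_lattice a b"
  by (rule holomorphic_on_weierstrass_p_curve) (auto intro: open_lattice_compl holomorphic_intros)

lemma holomorphic_on_wp_reg_0:
  assumes "indep a b"
  obtains r where "r > 0" "wp_reg a b holomorphic_on ball 0 r" "ball 0 r \<inter> period_lattice a b = {0}"
proof -
  obtain r where r: "r > 0" "\<And>w. w \<in> period_lattice a b \<Longrightarrow> dist 0 w < r \<Longrightarrow> w = 0"
    using lattice_ball_disjoint[OF assms, of 0] by metis
  have "wp_reg a b holomorphic_on ball 0 r"
    by (rule holomorphic_on_wp_reg) (use r assms in \<open>auto simp: wp_reg_dom_iff\<close>)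
  then show ?thesis using r lattice_0 that[of r] by fastforce
qed

lemma tendsto_weierstrass_p:
  assumes "indep a0 b0" "z0 \<notin> period_lattice a0 b0"
    and lim: "(z \<longlongrightarrow> z0) F" "(a \<longlongrightarrow> a0) F" "(b \<longlongrightarrow> b0) F"
    and ind: "\<forall>\<^sub>F t in F. indep (a t) (b t)"
  shows "((\<lambda>t. weierstrass_p (a t) (b t) (z t)) \<longlongrightarrow> weierstrass_p a0 b0 z0) F"
proof -
  have "z0 \<noteq> 0" using assms(2) lattice_0 by metis
  then have "((\<lambda>t. 1 / (z t)\<^sup>2 + wp_reg (a t) (b t) (z t)) \<longlongrightarrow> 1 / z0\<^sup>2 + wp_reg a0 b0 z0) F"
    using assms by (intro tendsto_intros tendsto_wp_reg) (auto simp: wp_reg_dom_iff)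
  then show ?thesis
    unfolding weierstrass_p_eq[OF assms(1)]
    by (rule Lim_transform_eventually) (use ind in \<open>auto elim!: eventually_mono simp: weierstrass_p_eq\<close>)
qed

lemma weierstrass_p_minus:
  assumes "indep a b" shows "weierstrass_p a b (- z) = weierstrass_p a b z"
proof -
  have bij: "bij_betw uminus nonzero_idx nonzero_idx"
    by (rule bij_betwI[where g = uminus]) (auto simp: zero_prod_def[symmetric])
  have "wp_term (- z) (- w) = wp_term z w" for w
    by (simp add: wp_term_def power2_commute[of w])
  then have "wp_reg a b (- z) = wp_reg a b z"
    unfolding wp_reg_def
    by (subst infsum_reindex_bij_betw[OF bij, symmetric]) (simp add: latpt_uminus)
  then show ?thesis using assms by (simp add: weierstrass_p_eq)
qed

lemma weierstrass_p_scale: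
  assumes "indep a b" "c \<noteq> 0"
  shows "weierstrass_p (c * a) (c * b) (c * z) = weierstrass_p a b z / c\<^sup>2"
proof -
  have l: "latpt (c * a) (c * b) p = c * latpt a b p" for p by (simp add: latpt_def algebra_simps)
  have "wp_term (c * z) (c * w) = (1 / c\<^sup>2) * wp_term z w" for w
  proof -
    have "(c * z - c * w)\<^sup>2 = c\<^sup>2 * (z - w)\<^sup>2"
      by (metis power_mult_distrib right_diff_distrib)
    then show ?thesis by (simp add: wp_term_def power_mult_distrib right_diff_distrib)
  qed
  then have "wp_reg (c * a) (c * b) (c * z) = (1 / c\<^sup>2) * wp_reg a b z"
    unfolding wp_reg_def l by (simp only: infsum_cmult_right')
  then show ?thesis
    using assms by (simp add: weierstrass_p_eq indep_scale power_mult_distrib add_divide_distrib)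
qed

lemma deriv_weierstrass_p_has_sum:
  assumes "indep a b" "z \<notin> period_lattice a b"
  shows "((\<lambda>p. -2 / (z - latpt a b p) ^ 3) has_sum deriv (weierstrass_p a b) z) UNIV"
proof -
  have z: "z \<noteq> 0" using assms(2) lattice_0 by metis
  have dom: "(z, a, b) \<in> wp_reg_dom" using assms by (simp add: wp_reg_dom_iff)
  have "wp_reg a b holomorphic_on - period_lattice a b"
    by (rule holomorphic_on_wp_reg) (use assms in \<open>auto simp: wp_reg_dom_iff open_lattice_compl\<close>)
  then have "(wp_reg a b has_field_derivative deriv (wp_reg a b) z) (at z)"
    by (rule holomorphic_derivI) (use assms open_lattice_compl in auto)
  moreover have "((\<lambda>z. 1 / z\<^sup>2) has_field_derivative -2 / z ^ 3) (at z)"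
    using DERIV_inverse_square[of z 0] z by simp
  ultimately have "((\<lambda>z. 1 / z\<^sup>2 + wp_reg a b z) has_field_derivative -2 / z ^ 3 + deriv (wp_reg a b) z) (at z)"
    by (rule DERIV_add[rotated])
  moreover have "weierstrass_p a b = (\<lambda>z. 1 / z\<^sup>2 + wp_reg a b z)"
    by (rule ext) (rule weierstrass_p_eq[OF assms(1)])
  ultimately have "deriv (weierstrass_p a b) z = -2 / z ^ 3 + deriv (wp_reg a b) z"
    by (simp only: DERIV_imp_deriv)
  \<comment> \<open>The derivative of 1 / z^2 is exactly the missing term of index (0, 0).\<close>
  moreover have "((\<lambda>p. -2 / (z - latpt a b p) ^ 3) has_sum (-2 / z ^ 3 + deriv (wp_reg a b) z))
      (insert (0, 0) nonzero_idx)"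
    using has_sum_insert[OF _ deriv_wp_reg[OF dom], of "(0, 0)"] by simp
  ultimately show ?thesis by (simp add: insert_Diff_if insert_UNIV)
qed

text \<open>The differentiated series has no subtracted terms and runs over all indices, so
  translation by a period merely permutes it.\<close>

lemma deriv_weierstrass_p_periodic:
  assumes "indep a b" "z \<notin> period_lattice a b" "w \<in> period_lattice a b"
  shows "deriv (weierstrass_p a b) (z + w) = deriv (weierstrass_p a b) z"
proof -
  obtain q where q: "w = latpt a b q" using assms(3) by (auto simp: period_lattice_eq)
  have bij: "bij_betw (\<lambda>p. p + q) UNIV UNIV"
    by (rule bij_betwI[where g = "\<lambda>p. p - q"]) auto
  have "((\<lambda>p. -2 / (z + w - latpt a b (p + q)) ^ 3) has_sum deriv (weierstrass_p a b) (z + w)) UNIV"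
    using deriv_weierstrass_p_has_sum[of a b "z + w"] assms
      has_sum_reindex_bij_betw[OF bij, of "\<lambda>p. -2 / (z + w - latpt a b p) ^ 3"]
    by (simp add: lattice_add_iff)
  then have "((\<lambda>p. -2 / (z - latpt a b p) ^ 3) has_sum deriv (weierstrass_p a b) (z + w)) UNIV"
    by (simp add: latpt_add q)
  then show ?thesis using deriv_weierstrass_p_has_sum[OF assms(1,2)] has_sum_unique by blast
qed

lemma periodic_of_int_multiple:
  assumes "\<And>z. z \<notin> L \<Longrightarrow> f (z + h) = f z" "\<And>z. z + h \<in> L \<longleftrightarrow> (z :: complex) \<in> L"
  shows "z \<notin> L \<Longrightarrow> f (z + of_int m * h) = f z"
proof (induction m arbitrary: z rule: int_induct[where k = 0])
  case base
  then show ?case by simp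
next
  case (step1 i)
  have "z + of_int i * h \<notin> L \<longleftrightarrow> z \<notin> L" for z
  proof (induction i rule: int_induct[where k = 0])
    case (step1 i)
    have "z + of_int (i + 1) * h = (z + of_int i * h) + h" by (simp add: algebra_simps)
    then show ?case using step1 assms(2) by metis
  next
    case (step2 i)
    have "z + of_int i * h = (z + of_int (i - 1) * h) + h" by (simp add: algebra_simps)
    then show ?case using step2 assms(2) by metis
  qed simp
  then have "f ((z + of_int i * h) + h) = f (z + of_int i * h)" using step1 assms(1) by blast
  then show ?case using step1 by (simp add: algebra_simps)
next
  case (step2 i)
  have "z - h \<notin> L" using step2 assms(2)[of "z - h"] by simp
  then have "f ((z - h) + of_int i * h) = f (z - h)" by (rule step2)
  also have "f (z - h) = f z" using assms(1)[OF \<open>z - h \<notin> L\<close>] by simp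
  finally show ?case by (simp add: algebra_simps)
qed

lemma periodic_lattice:
  assumes f: "\<And>z. z \<notin> period_lattice a b \<Longrightarrow> f (z + 2 * a) = f z"
      "\<And>z. z \<notin> period_lattice a b \<Longrightarrow> f (z + 2 * b) = f z"
    and w: "w \<in> period_lattice a b" and z: "z \<notin> period_lattice a b"
  shows "f (z + w) = f z"
proof -
  obtain m n where mn: "w = of_int m * (2 * a) + of_int n * (2 * b)"
    using w by (auto simp: period_lattice_def algebra_simps)
  have "of_int m * (2 * a) \<in> period_lattice a b"
    unfolding period_lattice_eq by (rule image_eqI[of _ _ "(m, 0)"]) (simp_all add: latpt_def)
  then have "z + of_int m * (2 * a) \<notin> period_lattice a b" using z lattice_add_iff by blast
  then have "f ((z + of_int m * (2 * a)) + of_int n * (2 * b)) = f (z + of_int m * (2 * a))"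
    by (intro periodic_of_int_multiple[where f = f and L = "period_lattice a b"] f(2) lattice_add_iff
          lattice_periods)
  also have "\<dots> = f z"
    by (intro periodic_of_int_multiple[where f = f and L = "period_lattice a b"] f(1) lattice_add_iff
          lattice_periods z)
  finally show ?thesis by (simp add: mn add.assoc)
qed

text \<open>The difference of both sides has derivative 0 on the connected complement of the
  lattice. Its constant value is found at -h, where evenness makes it 0.\<close>

lemma weierstrass_p_half_period_shift:
  assumes ind: "indep a b" and h: "2 * h \<in> period_lattice a b" "h \<notin> period_lattice a b"
    and z: "z \<notin> period_lattice a b"
  shows "weierstrass_p a b (z + 2 * h) = weierstrass_p a b z"
proof -
  let ?P = "weierstrass_p a b" and ?L = "period_lattice a b"
  have der: "(?P has_field_derivative deriv ?P z) (at z)" if "z \<notin> ?L" for z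
    using holomorphic_derivI[OF holomorphic_on_weierstrass_p[OF ind] open_lattice_compl[OF ind]] that by auto
  have "((\<lambda>z. ?P (z + 2 * h) - ?P z) has_field_derivative 0) (at z)" if z: "z \<notin> ?L" for z
  proof -
    have "z + 2 * h \<notin> ?L" using z h(1) lattice_add_iff by blast
    then have "((\<lambda>z. ?P (z + 2 * h)) has_field_derivative deriv ?P (z + 2 * h)) (at z)"
      using der DERIV_shift by blast
    from DERIV_diff[OF this der[OF z]] show ?thesis
      using deriv_weierstrass_p_periodic[OF ind z h(1)] by simp
  qed
  note der0 = this
  have "continuous_on (- ?L) (\<lambda>z. ?P (z + 2 * h) - ?P z)"
    by (intro continuous_at_imp_continuous_on ballI DERIV_isCont[OF der0]) simp
  then obtain c where c: "\<And>z. z \<in> - ?L \<Longrightarrow> ?P (z + 2 * h) - ?P z = c"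
    by (rule DERIV_zero_connected_constant[OF connected_lattice_compl open_lattice_compl[OF ind] finite.emptyI])
       (use der0 in auto)
  have "- h \<in> - ?L" using h(2) by (simp add: lattice_uminus_iff)
  from c[OF this] have "c = 0" using weierstrass_p_minus[OF ind, of h] by simp
  then show ?thesis using c z by force
qed

lemma weierstrass_p_periodic:
  assumes ind: "indep a b" and w: "w \<in> period_lattice a b" and z: "z \<notin> period_lattice a b"
  shows "weierstrass_p a b (z + w) = weierstrass_p a b z"
  by (rule periodic_lattice[OF _ _ w z])
     (auto intro!: weierstrass_p_half_period_shift[OF ind] lattice_periods half_periods_not_lattice[OF ind])

section \<open>Liouville's theorem for elliptic functions and its consequences\<close>

lemma indep_coords:
  assumes "indep a b"
  obtains x y :: real where "z = of_real x * (2 * a) + of_real y * (2 * b)"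
proof
  let ?D = "Im (cnj a * b)"
  have gen: "(of_real u * a + of_real v * b) / of_real d
      = of_real (u / (2 * d)) * (2 * a) + of_real (v / (2 * d)) * (2 * b)" for u v d :: real
    by (simp add: add_divide_distrib)
  have D: "?D \<noteq> 0" using assms by (simp add: indep_def)
  have "of_real ?D * z = of_real (- Im (cnj b * z)) * a + of_real (Im (cnj a * z)) * b"
    by (simp add: complex_eq_iff algebra_simps)
  then have "z = (of_real (- Im (cnj b * z)) * a + of_real (Im (cnj a * z)) * b) / of_real ?D"
    using D by (metis nonzero_mult_div_cancel_left of_real_eq_0_iff)
  also have "\<dots> = of_real (- Im (cnj b * z) / (2 * ?D)) * (2 * a) + of_real (Im (cnj a * z) / (2 * ?D)) * (2 * b)"
    by (rule gen)
  finally show "z = of_real (- Im (cnj b * z) / (2 * ?D)) * (2 * a) + of_real (Im (cnj a * z) / (2 * ?D)) * (2 * b)" .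
qed

text \<open>With the singularities filled by \<open>g\<close>, the function is entire and takes all
  its values on one compact period parallelogram. The constant is identified as \<open>g 0\<close>,
  which matters for showing that it is nonzero below.\<close>

lemma elliptic_liouville:
  assumes ind: "indep a b" and hol: "f holomorphic_on - period_lattice a b"
    and per: "\<And>z. z \<notin> period_lattice a b \<Longrightarrow> f (z + 2 * a) = f z"
      "\<And>z. z \<notin> period_lattice a b \<Longrightarrow> f (z + 2 * b) = f z"
    and g: "r > 0" "g holomorphic_on ball 0 r" "\<And>z. z \<in> ball 0 r \<Longrightarrow> z \<noteq> 0 \<Longrightarrow> f z = g z"
    and z: "z \<notin> period_lattice a b"
  shows "f z = g 0"
proof -
  let ?L = "period_lattice a b"
  define F where "F \<zeta> = (if \<zeta> \<in> ?L then g 0 else f \<zeta>)" for \<zeta>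
  obtain r' where r': "r' > 0" "\<And>w. w \<in> ?L \<Longrightarrow> dist 0 w < r' \<Longrightarrow> w = 0"
    using lattice_ball_disjoint[OF ind, of 0] by metis
  define s where "s = min r r'"
  have s: "s > 0" using g(1) r'(1) by (simp add: s_def)
  have Fper: "F (\<zeta> + w) = F \<zeta>" if "w \<in> ?L" for \<zeta> w
    using that lattice_add_iff[OF that, of \<zeta>] periodic_lattice[of a b f w \<zeta>] per
    by (auto simp: F_def)
  have near0: "F \<zeta> = g \<zeta>" if "\<zeta> \<in> ball 0 s" for \<zeta>
    using that r'(2)[of \<zeta>] g(3)[of \<zeta>] lattice_0 by (auto simp: F_def s_def)
  have "F field_differentiable at \<zeta>" for \<zeta>
  proof (cases "\<zeta> \<in> ?L")
    case True
    have "(\<lambda>u. g (u - \<zeta>)) holomorphic_on ball \<zeta> s"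
      by (rule holomorphic_on_compose_gen[OF _ g(2), of "\<lambda>u. u - \<zeta>", unfolded o_def])
         (auto intro!: holomorphic_intros simp: s_def dist_norm norm_minus_commute)
    then have "F holomorphic_on ball \<zeta> s"
    proof (rule holomorphic_transform)
      fix u assume "u \<in> ball \<zeta> s"
      then have "g (u - \<zeta>) = F (u - \<zeta>)" by (simp add: near0 dist_norm norm_minus_commute)
      also have "\<dots> = F u" using Fper[OF True, of "u - \<zeta>"] by simp
      finally show "g (u - \<zeta>) = F u" .
    qed
    then show ?thesis using s by (meson centre_in_ball holomorphic_on_imp_differentiable_at open_ball)
  next
    case False
    have "F holomorphic_on - ?L" by (rule holomorphic_transform[OF hol]) (simp add: F_def)
    then show ?thesis using False open_lattice_compl[OF ind]
      by (metis ComplI holomorphic_on_imp_differentiable_at)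
  qed
  then have holF: "F holomorphic_on UNIV"
    by (simp add: holomorphic_on_def)
  define K where "K = (\<lambda>(x, y). of_real x * (2 * a) + of_real y * (2 * b)) ` ({0..1::real} \<times> {0..1::real})"
  have "compact K" unfolding K_def case_prod_unfold
    by (intro compact_continuous_image continuous_intros compact_Times) auto
  then have "compact (F ` K)"
    using holF holomorphic_on_imp_continuous_on holomorphic_on_subset
    by (metis compact_continuous_image subset_UNIV)
  moreover have "range F = F ` K"
  proof safe
    fix \<zeta>
    obtain x y where xy: "\<zeta> = of_real x * (2 * a) + of_real y * (2 * b)"
      using indep_coords[OF ind] by metis
    define w where "w = of_real (frac x) * (2 * a) + of_real (frac y) * (2 * b)"
    have "w \<in> K"
      unfolding K_def w_def
      by (rule image_eqI[of _ _ "(frac x, frac y)"]) (auto simp: less_imp_le frac_lt_1)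
    have "\<zeta> = w + (of_real (of_int \<lfloor>x\<rfloor>) * (2 * a) + of_real (of_int \<lfloor>y\<rfloor>) * (2 * b))"
      unfolding xy w_def by (simp add: frac_def algebra_simps)
    then have "F \<zeta> = F w" using Fper lattice_real_coords[OF ind, of "of_int \<lfloor>x\<rfloor>" "of_int \<lfloor>y\<rfloor>"] by auto
    then show "F \<zeta> \<in> F ` K" using \<open>w \<in> K\<close> by blast
  qed auto
  ultimately have "bounded (range F)" by (simp add: compact_imp_bounded)
  then have "F constant_on UNIV" by (rule Liouville_theorem[OF holF])
  then have "F z = F 0" by (auto simp: constant_on_def)
  then show ?thesis using z lattice_0 by (simp add: F_def)
qed

text \<open>Evenness kills the derivative at 0, so the difference quotient can be formed twice. The
  quotient is even again, which allows the step to be repeated.\<close>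

lemma even_holomorphic_factor:
  assumes f: "f holomorphic_on ball 0 r" and "r > 0" and even: "\<And>z. z \<in> ball 0 r \<Longrightarrow> f (- z) = f z"
  obtains g where "g holomorphic_on ball 0 r" "\<And>z. z \<in> ball 0 r \<Longrightarrow> f z = f 0 + z\<^sup>2 * g z"
    "\<And>z. z \<in> ball 0 r \<Longrightarrow> g (- z) = g z"
proof -
  have 0: "0 \<in> ball 0 r" using \<open>r > 0\<close> by simp
  have D: "(f has_field_derivative deriv f 0) (at (- 0))"
    using holomorphic_derivI[OF f _ 0] by simp
  have "((\<lambda>z. f (- z)) has_field_derivative deriv f 0 * (- 1)) (at 0)"
    by (rule DERIV_chain2[where f = f and g = uminus, OF D]) (auto intro!: derivative_eq_intros)
  then have "(f has_field_derivative deriv f 0 * (- 1)) (at 0)"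
    by (rule has_field_derivative_transform_within_open[OF _ open_ball 0 even])
  then have "deriv f 0 = deriv f 0 * (- 1)" by (rule DERIV_imp_deriv)
  then have d0: "deriv f 0 = 0" by (simp add: eq_neg_iff_add_eq_0)
  define g1 where "g1 z = (if z = 0 then deriv f 0 else (f z - f 0) / (z - 0))" for z
  have hol1: "g1 holomorphic_on ball 0 r"
    unfolding g1_def by (rule pole_lemma_open[OF f]) simp
  define g where "g z = (if z = 0 then deriv g1 0 else (g1 z - g1 0) / (z - 0))" for z
  have ghol: "g holomorphic_on ball 0 r"
    unfolding g_def by (rule pole_lemma_open[OF hol1]) simp
  have gz: "g z = (f z - f 0) / z\<^sup>2" if "z \<noteq> 0" for z
    using that by (simp add: g_def g1_def d0 power2_eq_square)
  show ?thesis
  proof (rule that[OF ghol])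
    show "f z = f 0 + z\<^sup>2 * g z" if "z \<in> ball 0 r" for z
      by (cases "z = 0") (simp_all add: gz)
    show "g (- z) = g z" if "z \<in> ball 0 r" for z
      using that by (cases "z = 0") (simp_all add: gz even)
  qed
qed

lemma wp_reg_minus:
  assumes "indep a b" shows "wp_reg a b (- z) = wp_reg a b z"
  using weierstrass_p_minus[OF assms, of z] by (simp add: weierstrass_p_eq[OF assms])

lemma wp_reg_at_0: "wp_reg a b 0 = 0"
  by (simp add: wp_reg_def wp_term_def)

text \<open>Otherwise \<wp> would equal c on the whole complement of the lattice, and then z^2 *
  (\<wp> z - c) would be 0 near the origin, although it tends to 1.\<close>

lemma nonconstant_weierstrass_p:
  assumes ind: "indep a b" and S: "open S" "S \<noteq> {}" "S \<subseteq> - period_lattice a b"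
  shows "\<not> (\<forall>z\<in>S. weierstrass_p a b z = c)"
proof
  assume const: "\<forall>z\<in>S. weierstrass_p a b z = c"
  obtain r where r: "r > 0" "wp_reg a b holomorphic_on ball 0 r" "ball 0 r \<inter> period_lattice a b = {0}"
    using holomorphic_on_wp_reg_0[OF ind] by metis
  obtain z1 where z1: "z1 \<in> S" using S by blast
  have "weierstrass_p a b z = c" if "z \<in> - period_lattice a b" for z
    by (rule analytic_continuation_open[OF S(1) open_lattice_compl[OF ind] S(2) connected_lattice_compl S(3)
          holomorphic_on_weierstrass_p[OF ind] holomorphic_on_const _ that])
       (use const in auto)
  note const' = this
  have *: "1 + z\<^sup>2 * (wp_reg a b z - c) = 0" if z: "z \<in> ball 0 r - {0}" for z
  proof -
    have "z \<in> - period_lattice a b" using z r(3) by blast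
    then have "1 / z\<^sup>2 + wp_reg a b z = c"
      using const' weierstrass_p_eq[OF ind, of z] by metis
    then have "z\<^sup>2 * (1 / z\<^sup>2 + (wp_reg a b z - c)) = 0" by (simp only: add_diff_eq) simp
    moreover have "z\<^sup>2 * (1 / z\<^sup>2) = 1" using z by simp
    ultimately show ?thesis by (metis distrib_left)
  qed
  have "continuous_on (ball 0 r) (\<lambda>z. 1 + z\<^sup>2 * (wp_reg a b z - c))"
    by (intro continuous_intros holomorphic_on_imp_continuous_on r)
  then have "isCont (\<lambda>z. 1 + z\<^sup>2 * (wp_reg a b z - c)) 0"
    using r(1) by (simp add: continuous_on_eq_continuous_at)
  then have "((\<lambda>z. 1 + z\<^sup>2 * (wp_reg a b z - c)) \<longlongrightarrow> 1) (at 0)"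
    by (simp add: isCont_def)
  moreover have "((\<lambda>z. 1 + z\<^sup>2 * (wp_reg a b z - c)) \<longlongrightarrow> 0) (at 0)"
  proof (rule tendsto_eventually)
    show "\<forall>\<^sub>F z in at 0. 1 + z\<^sup>2 * (wp_reg a b z - c) = 0"
      unfolding eventually_at using r(1) * by (intro exI[of _ r]) (auto simp: dist_commute)
  qed
  ultimately show False using tendsto_unique[OF at_neq_bot] by fastforce
qed

text \<open>The second factor vanishes to second order at the origin and cancels the double pole of
  the first; the pole at -a is treated by symmetry, since translation by a exchanges the
  factors.\<close>

lemma half_period_product:
  assumes ind: "indep a b"
  obtains C where "C \<noteq> 0"
    "\<And>z. z \<notin> period_lattice a b \<Longrightarrow> z + a \<notin> period_lattice a b \<Longrightarrow>
       (weierstrass_p a b z - weierstrass_p a b a) * (weierstrass_p a b (z + a) - weierstrass_p a b a) = C"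
proof -
  let ?L = "period_lattice a b" and ?P = "weierstrass_p a b"
  define e where "e = ?P a"
  define f where "f z = (?P z - e) * (?P (z + a) - e)" for z
  \<comment> \<open>The product has period a, not only 2 * a. For the finer lattice all its
    singularities form the single class of 0, as Liouville's theorem requires here.\<close>
  let ?M = "period_lattice (a / 2) b"
  have aL: "a \<notin> ?L" using half_periods_not_lattice[OF ind] by blast
  have indM: "indep (a / 2) b" using ind by (simp add: indep_def)
  have M: "z \<in> ?M \<longleftrightarrow> z \<in> ?L \<or> z + a \<in> ?L" for z
  proof
    assume "z \<in> ?M"
    then obtain m n :: int where z: "z = of_int m * a + 2 * of_int n * b"
      by (auto simp: period_lattice_def)
    show "z \<in> ?L \<or> z + a \<in> ?L"
    proof (cases "even m")
      case True
      then obtain k where "m = 2 * k" by blast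
      then have "z = latpt a b (k, n)" by (simp add: z latpt_def)
      then show ?thesis by (simp add: period_lattice_eq)
    next
      case False
      then obtain k where "m = 2 * k + 1" by (elim oddE)
      then have "z + a = latpt a b (k + 1, n)" by (simp add: z latpt_def algebra_simps)
      then show ?thesis by (simp add: period_lattice_eq)
    qed
  next
    have sub: "w \<in> ?M" if "w \<in> ?L" for w
    proof -
      obtain p where "w = latpt a b p" using \<open>w \<in> ?L\<close> by (auto simp: period_lattice_eq)
      then have "w = latpt (a / 2) b (2 * fst p, snd p)" by (simp add: latpt_def)
      then show ?thesis by (simp add: period_lattice_eq)
    qed
    assume "z \<in> ?L \<or> z + a \<in> ?L"
    then show "z \<in> ?M" using sub lattice_diff_iff[OF lattice_periods(1)[of "a / 2" b], of "z + a"] sub[of "z + a"] by auto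
  qed
  have holP: "?P holomorphic_on - ?L" by (rule holomorphic_on_weierstrass_p[OF ind])
  have shift: "(\<lambda>z. ?P (z + a)) holomorphic_on S" if "\<And>z. z \<in> S \<Longrightarrow> z + a \<notin> ?L" for S
    by (rule holomorphic_on_compose_gen[OF _ holP, of "\<lambda>z. z + a", unfolded o_def])
       (use that in \<open>auto intro!: holomorphic_intros\<close>)
  have hol: "f holomorphic_on - ?M"
    unfolding f_def by (intro holomorphic_intros shift holomorphic_on_subset[OF holP]) (auto simp: M)
  have per: "?P (z + 2 * a) = ?P z" "?P (z + 2 * b) = ?P z" if "z \<notin> ?L" for z
    using weierstrass_p_periodic[OF ind _ that] lattice_periods by blast+
  have f1: "f (z + 2 * (a / 2)) = f z" if "z \<notin> ?M" for z
    using that per(1)[of z] by (simp add: f_def M algebra_simps flip: mult_2)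
  have f2: "f (z + 2 * b) = f z" if "z \<notin> ?M" for z
    using that per(2)[of z] per(2)[of "z + a"] by (simp add: f_def M algebra_simps)
  obtain r1 where r1: "r1 > 0" "wp_reg a b holomorphic_on ball 0 r1" "ball 0 r1 \<inter> ?L = {0}"
    using holomorphic_on_wp_reg_0[OF ind] by metis
  obtain r2 where r2: "r2 > 0" "\<And>w. w \<in> ?L \<Longrightarrow> dist a w < r2 \<Longrightarrow> w = a"
    using lattice_ball_disjoint[OF ind, of a] by metis
  define r where "r = min r1 r2"
  have r: "r > 0" using r1 r2 by (simp add: r_def)
  have near: "z + a \<notin> ?L" if "z \<in> ball 0 r" for z
    using r2(2)[of "z + a"] that aL by (auto simp: r_def dist_norm)
  define Q where "Q z = ?P (z + a) - e" for z
  have Qhol: "Q holomorphic_on ball 0 r"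
    unfolding Q_def by (intro holomorphic_intros shift near)
  have Qeven: "Q (- z) = Q z" if "z \<in> ball 0 r" for z
  proof -
    have "?P (- z + a) = ?P (z - a)" using weierstrass_p_minus[OF ind, of "z - a"] by simp
    also have "\<dots> = ?P ((z - a) + 2 * a)"
    proof (rule per(1)[symmetric])
      show "z - a \<notin> ?L" using near[OF that] lattice_diff_iff[OF lattice_periods(1), of "z + a" a b]
        by (simp add: algebra_simps flip: mult_2)
    qed
    finally show ?thesis by (simp add: Q_def algebra_simps flip: mult_2)
  qed
  obtain q where q: "q holomorphic_on ball 0 r" "\<And>z. z \<in> ball 0 r \<Longrightarrow> Q z = Q 0 + z\<^sup>2 * q z"
    using even_holomorphic_factor[OF Qhol r Qeven] by metis
  have Q0: "Q 0 = 0" by (simp add: Q_def e_def)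
  define g where "g z = (1 + z\<^sup>2 * (wp_reg a b z - e)) * q z" for z
  have wpr: "wp_reg a b holomorphic_on ball 0 r" by (rule holomorphic_on_subset[OF r1(2)]) (auto simp: r_def)
  have ghol: "g holomorphic_on ball 0 r"
    unfolding g_def by (intro holomorphic_intros q wpr)
  have fg: "f z = g z" if "z \<in> ball 0 r" "z \<noteq> 0" for z
  proof -
    have "f z = (1 / z\<^sup>2 + wp_reg a b z - e) * (z\<^sup>2 * q z)"
      using q(2)[OF that(1)] Q0 by (simp add: f_def Q_def weierstrass_p_eq[OF ind, of z])
    then show ?thesis using that(2) by (simp add: g_def algebra_simps)
  qed
  have C: "f z = g 0" if "z \<notin> ?M" for z
    by (rule elliptic_liouville[OF indM hol f1 f2 r ghol fg that])
  \<comment> \<open>If the product vanished identically, one of its factors would vanish on a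
    nonempty open set.\<close>
  have "g 0 \<noteq> 0"
  proof
    assume "g 0 = 0"
    then have f0: "?P z = e \<or> ?P (z + a) = e" if "z \<notin> ?M" for z
      using C[OF that] by (auto simp: f_def)
    have opM: "open (- ?M)" "- ?M \<subseteq> - ?L" by (auto simp: M open_lattice_compl[OF indM])
    obtain z1 where z1: "z1 \<notin> ?M" using half_periods_not_lattice[OF indM] by blast
    have "\<not> (\<forall>z\<in>- ?M. ?P z = e)"
      by (rule nonconstant_weierstrass_p[OF ind opM(1) _ opM(2)]) (use z1 in auto)
    then obtain z2 where z2: "z2 \<notin> ?M" "?P z2 \<noteq> e" by blast
    have "continuous_on (- ?M) ?P"
      using holP opM(2) holomorphic_on_imp_continuous_on holomorphic_on_subset by blast
    then have "open ((?P -` (- {e})) \<inter> - ?M)"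
      using opM(1) by (subst Int_commute) (rule continuous_open_preimage, auto)
    then have "open ((\<lambda>z. z - a) -` ((?P -` (- {e})) \<inter> - ?M))" (is "open ?S")
      by (intro continuous_open_vimage continuous_intros)
    moreover have "z2 + a \<in> ?S" using z2 by simp
    moreover have "?S \<subseteq> - ?L" by (auto simp: M)
    moreover have "\<forall>z\<in>?S. ?P z = e" using f0[of "z - a" for z] by fastforce
    ultimately show False using nonconstant_weierstrass_p[OF ind, of ?S e] by blast
  qed
  moreover have "(?P z - ?P a) * (?P (z + a) - ?P a) = g 0" if "z \<notin> ?L" "z + a \<notin> ?L" for z
    using C[of z] that by (simp add: M f_def e_def)
  ultimately show ?thesis using that by blast
qed

text \<open>Near 0 the function is 1 / z^2 + c * z^2 + z^4 * l z. A combination of \<wp>'^2, \<wp>^3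
  and \<wp> without a pole is constant by Liouville's theorem.\<close>

lemma weierstrass_p_differential_equation:
  assumes ind: "indep a b"
  obtains g2 g3 where "\<And>z. z \<notin> period_lattice a b \<Longrightarrow>
     (deriv (weierstrass_p a b) z)\<^sup>2 = 4 * weierstrass_p a b z ^ 3 - g2 * weierstrass_p a b z - g3"
proof -
  let ?L = "period_lattice a b" and ?P = "weierstrass_p a b"
  let ?P' = "deriv ?P" and ?h = "wp_reg a b"
  obtain r where r: "r > 0" "?h holomorphic_on ball 0 r" "ball 0 r \<inter> ?L = {0}"
    using holomorphic_on_wp_reg_0[OF ind] by metis
  obtain k where k: "k holomorphic_on ball 0 r" "\<And>z. z \<in> ball 0 r \<Longrightarrow> ?h z = ?h 0 + z\<^sup>2 * k z"
      "\<And>z. z \<in> ball 0 r \<Longrightarrow> k (- z) = k z"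
    by (rule even_holomorphic_factor[OF r(2,1) wp_reg_minus[OF ind]]) blast
  obtain l where l: "l holomorphic_on ball 0 r" "\<And>z. z \<in> ball 0 r \<Longrightarrow> k z = k 0 + z\<^sup>2 * l z"
  proof (rule even_holomorphic_factor[OF k(1) r(1)])
    show "k (- z) = k z" if "z \<in> ball 0 r" for z by (rule k(3)[OF that])
  qed (rule that; assumption)
  define c where "c = k 0"
  have hz: "?h z = c * z\<^sup>2 + z ^ 4 * l z" if "z \<in> ball 0 r" for z
    using k(2)[OF that] l(2)[OF that] wp_reg_at_0[of a b] by (simp add: c_def algebra_simps power2_eq_square eval_nat_numeral)
  define h' where "h' z = 2 * c * z + 4 * z ^ 3 * l z + z ^ 4 * deriv l z" for z
  \<comment> \<open>In the coefficient of z^(-2) the square of the derivative contributes -8c and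
    the cube -12c, so 20c times \<wp> cancels the pole.\<close>
  define D where "D z = (?P' z)\<^sup>2 - 4 * ?P z ^ 3 + 20 * c * ?P z" for z
  define g where "g z = - 28 * l z - 4 * z * deriv l z + (h' z)\<^sup>2 - 12 * z\<^sup>2 * (c + z\<^sup>2 * l z)\<^sup>2
      - 4 * (?h z) ^ 3 + 20 * c * ?h z" for z
  have P': "?P' z = - 2 / z ^ 3 + h' z" if z: "z \<in> ball 0 r" "z \<noteq> 0" for z
  proof -
    have "((\<lambda>z. 1 / z\<^sup>2) has_field_derivative - 2 / z ^ 3) (at z)"
      using DERIV_inverse_square[of z 0] z by simp
    moreover have "(l has_field_derivative deriv l z) (at z)"
      by (rule holomorphic_derivI[OF l(1) _ z(1)]) simp
    then have "((\<lambda>z. c * z\<^sup>2 + z ^ 4 * l z) has_field_derivative h' z) (at z)"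
      by (auto intro!: derivative_eq_intros simp: h'_def)
    ultimately have "((\<lambda>z. 1 / z\<^sup>2 + (c * z\<^sup>2 + z ^ 4 * l z)) has_field_derivative - 2 / z ^ 3 + h' z) (at z)"
      by (rule DERIV_add)
    then have "(?P has_field_derivative - 2 / z ^ 3 + h' z) (at z)"
      by (rule has_field_derivative_transform_within_open[OF _ open_ball z(1)])
         (simp add: weierstrass_p_eq[OF ind] hz)
    then show ?thesis by (rule DERIV_imp_deriv)
  qed
  have holP: "?P holomorphic_on - ?L" by (rule holomorphic_on_weierstrass_p[OF ind])
  have hol: "D holomorphic_on - ?L"
    unfolding D_def by (intro holomorphic_intros holP holomorphic_deriv open_lattice_compl[OF ind])
  have per: "D (z + w) = D z" if "z \<notin> ?L" "w \<in> ?L" for z w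
    using that by (simp add: D_def weierstrass_p_periodic[OF ind] deriv_weierstrass_p_periodic[OF ind])
  have ghol: "g holomorphic_on ball 0 r"
    unfolding g_def h'_def by (intro holomorphic_intros r l holomorphic_deriv open_ball)
  have Dg: "D z = g z" if z: "z \<in> ball 0 r" "z \<noteq> 0" for z
  proof -
    \<comment> \<open>With x as a separate variable subject to x * z = 1, the Laurent identities
      become polynomial ones.\<close>
    define x where "x = 1 / z"
    have x: "x * z = 1" using z by (simp add: x_def)
    have e1: "?P z = x\<^sup>2 + ?h z" using weierstrass_p_eq[OF ind, of z] by (simp add: x_def power_divide)
    have e2: "?P' z = - 2 * x ^ 3 + h' z" using P'[OF z] by (simp add: x_def power_divide)
    have i1: "x ^ 3 * h' z = 2 * c * x\<^sup>2 + 4 * l z + z * deriv l z"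
      unfolding h'_def using x by algebra
    have i2: "x ^ 4 * ?h z = c * x\<^sup>2 + l z"
      unfolding hz[OF z(1)] using x by algebra
    have i3: "x\<^sup>2 * (?h z)\<^sup>2 = z\<^sup>2 * (c + z\<^sup>2 * l z)\<^sup>2"
      unfolding hz[OF z(1)] using x by algebra
    have "D z = - 4 * (x ^ 3 * h' z) + (h' z)\<^sup>2 - 12 * (x ^ 4 * ?h z) - 12 * (x\<^sup>2 * (?h z)\<^sup>2)
        - 4 * (?h z) ^ 3 + 20 * c * x\<^sup>2 + 20 * c * ?h z"
      unfolding D_def e1 e2 by algebra
    also have "\<dots> = g z" unfolding i1 i2 i3 g_def by algebra
    finally show ?thesis .
  qed
  have "D z = g 0" if "z \<notin> ?L" for z
    by (rule elliptic_liouville[OF ind hol _ _ r(1) ghol Dg that]) (auto intro!: per lattice_periods)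
  then have "(?P' z)\<^sup>2 = 4 * ?P z ^ 3 - (20 * c) * ?P z - (- g 0)" if "z \<notin> ?L" for z
    using that by (auto simp: D_def algebra_simps)
  then show ?thesis using that by blast
qed

section \<open>Half-period values\<close>

text \<open>Each of the three half-periods can be the first member of a basis of the same lattice,
  so facts about the first half-period carry over to the others.\<close>

lemma half_period_basis:
  assumes "indep a b" "h \<in> {a, b, a + b}"
  obtains b' where "indep h b'" "period_lattice h b' = period_lattice a b"
  using assms indep_swap indep_add lattice_swap lattice_shear by (metis empty_iff insert_iff)

lemma half_period_props:
  assumes "indep a b" "h \<in> {a, b, a + b}"
  shows "h \<notin> period_lattice a b" "2 * h \<in> period_lattice a b"
  using half_period_basis[OF assms] half_periods_not_lattice lattice_periods by metis+

lemma half_period_product_nonzero: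
  assumes "indep a b" "h \<in> {a, b, a + b}"
  obtains C where "C \<noteq> 0"
    "\<And>z. z \<notin> period_lattice a b \<Longrightarrow> z + h \<notin> period_lattice a b \<Longrightarrow>
       (weierstrass_p a b z - weierstrass_p a b h) * (weierstrass_p a b (z + h) - weierstrass_p a b h) = C"
proof -
  obtain b' where b': "indep h b'" "period_lattice h b' = period_lattice a b"
    using half_period_basis[OF assms] by blast
  show ?thesis
    by (rule half_period_product[OF b'(1)])
       (use that in \<open>simp add: b'(2) weierstrass_p_lattice_cong[OF b'(2)]\<close>)
qed

text \<open>If z + h were not a period, the nonzero constant product would have a zero
  factor.\<close>

lemma weierstrass_p_eq_half_period_value:
  assumes "indep a b" "h \<in> {a, b, a + b}" "z \<notin> period_lattice a b"
    "weierstrass_p a b z = weierstrass_p a b h"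
  shows "z + h \<in> period_lattice a b"
  using half_period_product_nonzero[OF assms(1,2)] assms(3,4)
  by (metis cancel_comm_monoid_add_class.diff_cancel mult_zero_left)

lemma weierstrass_p_half_periods_distinct:
  assumes "indep a b"
  shows "wp_e1 a b \<noteq> wp_e2 a b" "wp_e1 a b \<noteq> wp_e3 a b" "wp_e2 a b \<noteq> wp_e3 a b"
proof -
  note nl = half_periods_not_lattice[OF assms]
  show "wp_e1 a b \<noteq> wp_e2 a b"
    using weierstrass_p_eq_half_period_value[OF assms, of b a] nl by (auto simp: wp_e1_def wp_e2_def add.commute)
  have "a + (a + b) = b + 2 * a" "b + (a + b) = a + 2 * b" by (simp_all add: algebra_simps)
  then have "a + (a + b) \<notin> period_lattice a b" "b + (a + b) \<notin> period_lattice a b"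
    using nl lattice_add_iff lattice_periods by metis+
  then show "wp_e1 a b \<noteq> wp_e3 a b" "wp_e2 a b \<noteq> wp_e3 a b"
    using weierstrass_p_eq_half_period_value[OF assms, of "a + b" a]
      weierstrass_p_eq_half_period_value[OF assms, of "a + b" b] nl
    unfolding wp_e1_def wp_e2_def wp_e3_def by blast+
qed

text \<open>The constant product is evaluated at a second half-period, which the shift carries to
  the third one modulo periods.\<close>

lemma half_period_shift_formula:
  assumes ind: "indep a b" and "z \<notin> period_lattice a b"
  shows "z + a \<notin> period_lattice a b \<Longrightarrow>
      (weierstrass_p a b z - wp_e1 a b) * (weierstrass_p a b (z + a) - wp_e1 a b)
       = (wp_e2 a b - wp_e1 a b) * (wp_e3 a b - wp_e1 a b)"
    and "z + b \<notin> period_lattice a b \<Longrightarrow>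
      (weierstrass_p a b z - wp_e2 a b) * (weierstrass_p a b (z + b) - wp_e2 a b)
       = (wp_e1 a b - wp_e2 a b) * (wp_e3 a b - wp_e2 a b)"
    and "z + (a + b) \<notin> period_lattice a b \<Longrightarrow>
      (weierstrass_p a b z - wp_e3 a b) * (weierstrass_p a b (z + (a + b)) - wp_e3 a b)
       = (wp_e1 a b - wp_e3 a b) * (wp_e2 a b - wp_e3 a b)"
proof -
  let ?L = "period_lattice a b" and ?P = "weierstrass_p a b"
  note nl = half_periods_not_lattice[OF ind]
  have *: "(?P z - ?P h) * (?P (z + h) - ?P h) = (?P u - ?P h) * (?P (u + h) - ?P h)"
    if "h \<in> {a, b, a + b}" "z + h \<notin> ?L" "u \<notin> ?L" "u + h \<notin> ?L" for h u
    using half_period_product_nonzero[OF ind that(1)] that assms(2) by metis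
  show "(?P z - wp_e1 a b) * (?P (z + a) - wp_e1 a b) = (wp_e2 a b - wp_e1 a b) * (wp_e3 a b - wp_e1 a b)"
    if "z + a \<notin> ?L"
    using *[of a b] that nl by (simp add: wp_e1_def wp_e2_def wp_e3_def add.commute)
  show "(?P z - wp_e2 a b) * (?P (z + b) - wp_e2 a b) = (wp_e1 a b - wp_e2 a b) * (wp_e3 a b - wp_e2 a b)"
    if "z + b \<notin> ?L"
    using *[of b a] that nl by (simp add: wp_e1_def wp_e2_def wp_e3_def)
  have s: "a + (a + b) = b + 2 * a" by simp
  have "?P (a + (a + b)) = ?P b" "a + (a + b) \<notin> ?L"
    unfolding s using weierstrass_p_periodic[OF ind lattice_periods(1) nl(2)] nl(2)
      lattice_add_iff[OF lattice_periods(1)] by metis+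
  then show "(?P z - wp_e3 a b) * (?P (z + (a + b)) - wp_e3 a b) = (wp_e1 a b - wp_e3 a b) * (wp_e2 a b - wp_e3 a b)"
    if "z + (a + b) \<notin> ?L"
    using *[of "a + b" a] that nl by (simp add: wp_e1_def wp_e2_def wp_e3_def)
qed

lemma weierstrass_p_deriv:
  assumes "indep a b" "z \<notin> period_lattice a b"
  shows "(weierstrass_p a b has_field_derivative deriv (weierstrass_p a b) z) (at z)"
  by (rule holomorphic_derivI[OF holomorphic_on_weierstrass_p open_lattice_compl]) (use assms in auto)

lemma deriv_weierstrass_p_half_period:
  assumes ind: "indep a b" and h: "h \<in> {a, b, a + b}"
  shows "deriv (weierstrass_p a b) h = 0"
proof -
  let ?P = "weierstrass_p a b"
  note hp = half_period_props[OF assms]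
  have nh: "- h \<notin> period_lattice a b" using hp by (simp add: lattice_uminus_iff)
  have "((\<lambda>z. ?P (- z)) has_field_derivative deriv ?P (- h) * (- 1)) (at h)"
    by (rule DERIV_chain2[where f = ?P and g = uminus, OF weierstrass_p_deriv[OF ind nh]])
       (auto intro!: derivative_eq_intros)
  then have "deriv ?P h = deriv ?P (- h) * (- 1)"
    by (simp add: weierstrass_p_minus[OF ind] DERIV_imp_deriv)
  moreover have "deriv ?P (- h + 2 * h) = deriv ?P (- h)"
    by (rule deriv_weierstrass_p_periodic[OF ind nh hp(2)])
  ultimately show ?thesis by (simp add: eq_neg_iff_add_eq_0)
qed

text \<open>The half-period values are three distinct roots of a cubic without quadratic term;
  divided differences give the vanishing sum and hence the factorization.\<close>

lemma
  assumes ind: "indep a b"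
  shows wp_e_sum: "wp_e1 a b + wp_e2 a b + wp_e3 a b = 0"
    and weierstrass_p_ode: "\<And>z. z \<notin> period_lattice a b \<Longrightarrow> (deriv (weierstrass_p a b) z)\<^sup>2 =
      4 * (weierstrass_p a b z - wp_e1 a b) * (weierstrass_p a b z - wp_e2 a b) * (weierstrass_p a b z - wp_e3 a b)"
proof -
  let ?P = "weierstrass_p a b"
  obtain g2 g3 where ode: "\<And>z. z \<notin> period_lattice a b \<Longrightarrow>
     (deriv ?P z)\<^sup>2 = 4 * ?P z ^ 3 - g2 * ?P z - g3"
    using weierstrass_p_differential_equation[OF ind] by blast
  have r: "4 * ?P h ^ 3 - g2 * ?P h - g3 = 0" if "h \<in> {a, b, a + b}" for h
    using ode[of h] half_period_props[OF ind that] deriv_weierstrass_p_half_period[OF ind that] by simp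
  define x y w where "x = wp_e1 a b" and "y = wp_e2 a b" and "w = wp_e3 a b"
  have roots: "4 * x ^ 3 - g2 * x - g3 = 0" "4 * y ^ 3 - g2 * y - g3 = 0" "4 * w ^ 3 - g2 * w - g3 = 0"
    using r by (simp_all add: x_def y_def w_def wp_e1_def wp_e2_def wp_e3_def)
  have ne: "x \<noteq> y" "x \<noteq> w" "y \<noteq> w"
    using weierstrass_p_half_periods_distinct[OF ind] by (simp_all add: x_def y_def w_def)
  have "(x - y) * (4 * (x\<^sup>2 + x * y + y\<^sup>2) - g2) = 0" using roots by algebra
  then have 1: "4 * (x\<^sup>2 + x * y + y\<^sup>2) = g2" using ne by simp
  have "(x - w) * (4 * (x\<^sup>2 + x * w + w\<^sup>2) - g2) = 0" using roots by algebra
  then have 2: "4 * (x\<^sup>2 + x * w + w\<^sup>2) = g2" using ne by simp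
  have "4 * (x\<^sup>2 + x * y + y\<^sup>2) = 4 * (x\<^sup>2 + x * w + w\<^sup>2)" using 1 2 by simp
  then have "x * y + y\<^sup>2 = x * w + w\<^sup>2" unfolding mult_cancel_left by simp
  then have "(y - w) * (x + y + w) = 0" by (simp add: algebra_simps power2_eq_square)
  then show sum: "wp_e1 a b + wp_e2 a b + wp_e3 a b = 0" using ne by (simp add: x_def y_def w_def)
  fix z assume z: "z \<notin> period_lattice a b"
  have s: "x + y + w = 0" using sum by (simp add: x_def y_def w_def)
  have "4 * p ^ 3 - g2 * p - g3 = 4 * (p - x) * (p - y) * (p - w)" for p
  proof -
    have w: "w = - (x + y)" using s by (simp add: add_eq_0_iff)
    have g3: "g3 = 4 * x ^ 3 - g2 * x" using roots(1) by simp
    show ?thesis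
      unfolding w g3 1[symmetric] by (simp add: algebra_simps power2_eq_square power3_eq_cube)
  qed
  then show "(deriv ?P z)\<^sup>2 = 4 * (?P z - wp_e1 a b) * (?P z - wp_e2 a b) * (?P z - wp_e3 a b)"
    using ode[OF z] by (simp add: x_def y_def w_def)
qed

section \<open>Inversion of elliptic integrals\<close>

text \<open>Away from zeros a branch of the root is immediate. At a zero it is supplied by the
  assumption \<open>zero\<close>, which the differential equation does not imply: the constant 0
  solves that equation too.\<close>

lemma local_square_root:
  fixes \<Phi> :: "complex \<Rightarrow> complex"
  assumes op: "open \<Omega>" and hol: "\<Phi> holomorphic_on \<Omega>"
    and ode: "\<And>z. z \<in> \<Omega> \<Longrightarrow> (deriv \<Phi> z)\<^sup>2 = 4 * \<Phi> z * (1 - \<Phi> z) * (1 - m * \<Phi> z)"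
    and zero: "\<And>z. z \<in> \<Omega> \<Longrightarrow> \<Phi> z = 0 \<Longrightarrow>
       \<exists>r>0. \<exists>S. S holomorphic_on ball z r \<and> ball z r \<subseteq> \<Omega> \<and> (\<forall>w\<in>ball z r. (S w)\<^sup>2 = \<Phi> w) \<and>
         (\<forall>w\<in>ball z r - {z}. S w \<noteq> 0) \<and> (deriv S z)\<^sup>2 = 1"
    and z: "z \<in> \<Omega>" "\<Phi> z = v\<^sup>2" "deriv \<Phi> z = 2 * v * q" "q\<^sup>2 = (1 - v\<^sup>2) * (1 - m * v\<^sup>2)"
  obtains r S where "r > 0" "S holomorphic_on ball z r" "ball z r \<subseteq> \<Omega>"
    "\<And>w. w \<in> ball z r \<Longrightarrow> (S w)\<^sup>2 = \<Phi> w" "S z = v" "deriv S z = q"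
    "\<And>w. w \<in> ball z r \<Longrightarrow> (deriv S w)\<^sup>2 = (1 - (S w)\<^sup>2) * (1 - m * (S w)\<^sup>2)"
    "\<And>w. w \<in> ball z r \<Longrightarrow> deriv \<Phi> w = 2 * S w * deriv S w"
proof -
  have dS: "deriv \<Phi> w = 2 * S w * deriv S w"
    if "S holomorphic_on ball z r" "\<And>w. w \<in> ball z r \<Longrightarrow> (S w)\<^sup>2 = \<Phi> w" "w \<in> ball z r" for S r w
  proof -
    have "(S has_field_derivative deriv S w) (at w)"
      by (rule holomorphic_derivI[OF that(1) open_ball that(3)])
    then have "((\<lambda>w. (S w)\<^sup>2) has_field_derivative 2 * S w * deriv S w) (at w)"
      by (auto intro!: derivative_eq_intros)
    then have "(\<Phi> has_field_derivative 2 * S w * deriv S w) (at w)"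
      by (rule has_field_derivative_transform_within_open[OF _ open_ball that(3) that(2)])
    then show ?thesis by (rule DERIV_imp_deriv)
  qed
  have odeS: "(deriv S w)\<^sup>2 = (1 - (S w)\<^sup>2) * (1 - m * (S w)\<^sup>2)"
    if "S holomorphic_on ball z r" "\<And>w. w \<in> ball z r \<Longrightarrow> (S w)\<^sup>2 = \<Phi> w" "w \<in> ball z r" "S w \<noteq> 0"
      "ball z r \<subseteq> \<Omega>" for S r w
  proof -
    have "(2 * S w * deriv S w)\<^sup>2 = 4 * (S w)\<^sup>2 * (1 - (S w)\<^sup>2) * (1 - m * (S w)\<^sup>2)"
      using ode[of w] dS[OF that(1-3)] that(2)[OF that(3)] that(3,5) by auto
    then have "(4 * (S w)\<^sup>2) * (deriv S w)\<^sup>2 = (4 * (S w)\<^sup>2) * ((1 - (S w)\<^sup>2) * (1 - m * (S w)\<^sup>2))"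
      by (simp add: power_mult_distrib mult.assoc)
    then show ?thesis using that(4) by simp
  qed
  show ?thesis
  proof (cases "v = 0")
    case True
    then obtain r S where S: "r > 0" "S holomorphic_on ball z r" "ball z r \<subseteq> \<Omega>"
      "\<And>w. w \<in> ball z r \<Longrightarrow> (S w)\<^sup>2 = \<Phi> w" "\<And>w. w \<in> ball z r \<Longrightarrow> w \<noteq> z \<Longrightarrow> S w \<noteq> 0" "(deriv S z)\<^sup>2 = 1"
      using zero[of z] z by auto
    have Sz: "S z = 0" using S(4)[of z] S(1) z(2) True by simp
    \<comment> \<open>Both factors have square 1, so this is the sign that turns the derivative of
      the given root into q.\<close>
    define \<epsilon> :: complex where "\<epsilon> = q * deriv S z"
    have q1: "q\<^sup>2 = 1" using z(4) True by simp
    then have eps: "\<epsilon>\<^sup>2 = 1" "\<epsilon> * deriv S z = q"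
      using S(6) by (simp_all add: \<epsilon>_def power_mult_distrib) (simp add: power2_eq_square mult.assoc)
    have dR: "deriv (\<lambda>w. \<epsilon> * S w) w = \<epsilon> * deriv S w" if "w \<in> ball z r" for w
      using holomorphic_on_imp_differentiable_at[OF S(2) open_ball that] by simp
    have holR: "(\<lambda>w. \<epsilon> * S w) holomorphic_on ball z r" by (intro holomorphic_intros S(2))
    have sqR: "(\<epsilon> * S w)\<^sup>2 = \<Phi> w" if "w \<in> ball z r" for w
      using S(4)[OF that] eps by (simp add: power_mult_distrib)
    show ?thesis
    proof (rule that[OF S(1) holR S(3) sqR _ _ _ dS[OF holR sqR]])
      show "\<epsilon> * S z = v" using Sz True by simp
      show "deriv (\<lambda>w. \<epsilon> * S w) z = q" using dR[of z] S(1) eps by simp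
      show "(deriv (\<lambda>w. \<epsilon> * S w) w)\<^sup>2 = (1 - (\<epsilon> * S w)\<^sup>2) * (1 - m * (\<epsilon> * S w)\<^sup>2)" if "w \<in> ball z r" for w
      proof (cases "w = z")
        case True
        then show ?thesis using dR[OF that] q1 Sz eps by (simp add: power_mult_distrib)
      next
        case False
        then have "\<epsilon> * S w \<noteq> 0" using S(5)[OF that] eps by auto
        then show ?thesis by (intro odeS[where S = "\<lambda>w. \<epsilon> * S w" and r = r] holR sqR that S(3))
      qed
    qed assumption+
  next
    case False
    have "continuous_on \<Omega> \<Phi>" using hol holomorphic_on_imp_continuous_on by blast
    then have "isCont (\<lambda>w. \<Phi> w / v\<^sup>2) z"
      using op z(1) by (intro continuous_intros) (auto simp: continuous_on_eq_continuous_at False)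
    then have "((\<lambda>w. \<Phi> w / v\<^sup>2) \<longlongrightarrow> 1) (at z)" using z(2) False by (simp add: isCont_def)
    then have "\<forall>\<^sub>F w in at z. dist (\<Phi> w / v\<^sup>2) 1 < 1" by (rule tendstoD) simp
    then obtain d where d: "d > 0" "\<And>w. w \<noteq> z \<Longrightarrow> dist w z < d \<Longrightarrow> dist (\<Phi> w / v\<^sup>2) 1 < 1"
      by (auto simp: eventually_at)
    obtain d' where d': "d' > 0" "ball z d' \<subseteq> \<Omega>" using op z(1) open_contains_ball by blast
    define r where "r = min d d'"
    have r: "r > 0" "ball z r \<subseteq> \<Omega>" using d d' by (auto simp: r_def)
    have near: "dist (\<Phi> w / v\<^sup>2) 1 < 1" if "w \<in> ball z r" for w
      using d(2)[of w] that z(2) False by (cases "w = z") (auto simp: r_def dist_commute)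
    have pos: "Re (\<Phi> w / v\<^sup>2) > 0" if "w \<in> ball z r" for w
      using near[OF that] abs_Re_le_cmod[of "\<Phi> w / v\<^sup>2 - 1"] by (simp add: dist_norm)
    \<comment> \<open>The quotient stays in the right half-plane, where the principal root is
      holomorphic, and it is 1 at z.\<close>
    define S where "S w = v * csqrt (\<Phi> w / v\<^sup>2)" for w
    have holS: "S holomorphic_on ball z r"
      unfolding S_def
      by (intro holomorphic_intros holomorphic_on_subset[OF hol r(2)])
         (use pos False in \<open>auto simp: complex_nonpos_Reals_iff\<close>, force)
    have sq: "(S w)\<^sup>2 = \<Phi> w" for w using False by (simp add: S_def power_mult_distrib)
    have nz: "S w \<noteq> 0" if "w \<in> ball z r" for w
      using pos[OF that] False by (auto simp: S_def)
    show ?thesis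
    proof (rule that[OF r(1) holS r(2) sq _ _ odeS[OF holS sq _ nz r(2)] dS[OF holS sq]])
      show Sz: "S z = v" using z(2) False by (simp add: S_def)
      show "deriv S z = q" using dS[OF holS sq, of z] z(3) r(1) Sz False by simp
    qed
  qed
qed

text \<open>Here q is the continued root of (1 - v^2) * (1 - m * v^2) along the path. It may vanish
  at the end, so the integrand is assumed integrable instead of continuous.\<close>

lemma elliptic_integral_inverts:
  fixes \<Phi> :: "complex \<Rightarrow> complex" and g g' q w :: "real \<Rightarrow> complex"
  assumes op: "open \<Omega>" and hol: "\<Phi> holomorphic_on \<Omega>"
    and ode: "\<And>z. z \<in> \<Omega> \<Longrightarrow> (deriv \<Phi> z)\<^sup>2 = 4 * \<Phi> z * (1 - \<Phi> z) * (1 - m * \<Phi> z)"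
    and zero: "\<And>z. z \<in> \<Omega> \<Longrightarrow> \<Phi> z = 0 \<Longrightarrow>
       \<exists>r>0. \<exists>S. S holomorphic_on ball z r \<and> ball z r \<subseteq> \<Omega> \<and> (\<forall>w\<in>ball z r. (S w)\<^sup>2 = \<Phi> w) \<and>
         (\<forall>w\<in>ball z r - {z}. S w \<noteq> 0) \<and> (deriv S z)\<^sup>2 = 1"
    and pole: "\<And>p. p \<notin> \<Omega> \<Longrightarrow> filterlim \<Phi> at_infinity (at p within \<Omega>)"
    and init: "0 \<in> \<Omega>" "\<Phi> 0 = 0" "g 0 = 0"
    and contg: "continuous_on {0..1} g" and contq: "continuous_on {0..1} q"
    and K: "finite K" "\<And>x. x \<in> {0<..<1} - K \<Longrightarrow> (g has_vector_derivative g' x) (at x)"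
    and q: "\<And>x. x \<in> {0..1} \<Longrightarrow> (q x)\<^sup>2 = (1 - (g x)\<^sup>2) * (1 - m * (g x)\<^sup>2)" "\<And>x. x \<in> {0..<1} \<Longrightarrow> q x \<noteq> 0"
    and w: "\<And>x. w x = 1 / q x * g' x" "w integrable_on {0..1}"
    and x: "x \<in> {0..1}"
  shows "integral {0..x} w \<in> \<Omega> \<and> \<Phi> (integral {0..x} w) = (g x)\<^sup>2"
proof -
  define z where "z x = integral {0..x} w" for x
  have contz: "continuous_on {0..1} z"
    unfolding z_def by (rule indefinite_integral_continuous_1[OF w(2)])
  have cont\<Phi>: "continuous_on \<Omega> \<Phi>" and contd: "continuous_on \<Omega> (deriv \<Phi>)"
    using hol holomorphic_deriv[OF hol op] by (auto intro: holomorphic_on_imp_continuous_on)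
  \<comment> \<open>The condition on the derivative records which of the two roots is being
    followed; the value of \<Phi> alone would not exclude a passage to the opposite sign.\<close>
  define A where "A = {x \<in> {0..<1}. z x \<in> \<Omega> \<and> \<Phi> (z x) = (g x)\<^sup>2 \<and> deriv \<Phi> (z x) = 2 * g x * q x}"

  have limit: "z x \<in> \<Omega> \<and> \<Phi> (z x) = (g x)\<^sup>2 \<and> deriv \<Phi> (z x) = 2 * g x * q x"
    if x: "x \<in> {0..1}" and xn: "\<And>n. xn n \<in> A" "xn \<longlonglongrightarrow> x" for x and xn :: "nat \<Rightarrow> real"
  proof -
    have xn01: "xn n \<in> {0..1}" for n using xn(1)[of n] by (auto simp: A_def)
    have lz: "(\<lambda>n. z (xn n)) \<longlonglongrightarrow> z x" and lg: "(\<lambda>n. g (xn n)) \<longlonglongrightarrow> g x" and lq: "(\<lambda>n. q (xn n)) \<longlonglongrightarrow> q x"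
      using continuous_on_tendsto_compose[OF contz xn(2) x] continuous_on_tendsto_compose[OF contg xn(2) x]
        continuous_on_tendsto_compose[OF contq xn(2) x] xn01 by auto
    have zn: "z (xn n) \<in> \<Omega>" "\<Phi> (z (xn n)) = (g (xn n))\<^sup>2" "deriv \<Phi> (z (xn n)) = 2 * g (xn n) * q (xn n)" for n
      using xn(1)[of n] by (auto simp: A_def)
    have l1: "(\<lambda>n. \<Phi> (z (xn n))) \<longlonglongrightarrow> (g x)\<^sup>2" unfolding zn(2) by (intro tendsto_intros lg)
    have l2: "(\<lambda>n. deriv \<Phi> (z (xn n))) \<longlonglongrightarrow> 2 * g x * q x" unfolding zn(3) by (intro tendsto_intros lg lq)
    \<comment> \<open>Outside \<Omega> there are only poles, but along the sequence \<Phi> has the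
      finite limit (g x)^2.\<close>
    have zx: "z x \<in> \<Omega>"
    proof (rule ccontr)
      assume "z x \<notin> \<Omega>"
      then have "filterlim (\<lambda>n. z (xn n)) (at (z x) within \<Omega>) sequentially"
        unfolding filterlim_at using lz zn(1) by (intro conjI always_eventually allI; metis)
      then have "filterlim (\<lambda>n. \<Phi> (z (xn n))) at_infinity sequentially"
        using filterlim_compose[OF pole[OF \<open>z x \<notin> \<Omega>\<close>]] by blast
      then show False using l1 not_tendsto_and_filterlim_at_infinity[of sequentially] by auto
    qed
    have "(\<lambda>n. \<Phi> (z (xn n))) \<longlonglongrightarrow> \<Phi> (z x)" "(\<lambda>n. deriv \<Phi> (z (xn n))) \<longlonglongrightarrow> deriv \<Phi> (z x)"
      using continuous_on_tendsto_compose[OF cont\<Phi> lz zx] continuous_on_tendsto_compose[OF contd lz zx] zn(1)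
      by auto
    then show ?thesis using zx l1 l2 LIMSEQ_unique by blast
  qed

  have step: "\<exists>d>0. \<forall>x\<in>{0..<1}. dist x x0 < d \<longrightarrow> x \<in> A" if x0: "x0 \<in> A" for x0
  proof -
    have x01: "x0 \<in> {0..<1}" "z x0 \<in> \<Omega>" "\<Phi> (z x0) = (g x0)\<^sup>2" "deriv \<Phi> (z x0) = 2 * g x0 * q x0"
      using x0 by (auto simp: A_def)
    have q0: "q x0 \<noteq> 0" and q0': "(q x0)\<^sup>2 = (1 - (g x0)\<^sup>2) * (1 - m * (g x0)\<^sup>2)" using q x01(1) by auto
    obtain r S where S: "r > 0" "S holomorphic_on ball (z x0) r" "ball (z x0) r \<subseteq> \<Omega>"
      "\<And>w. w \<in> ball (z x0) r \<Longrightarrow> (S w)\<^sup>2 = \<Phi> w" "S (z x0) = g x0" "deriv S (z x0) = q x0"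
      "\<And>w. w \<in> ball (z x0) r \<Longrightarrow> (deriv S w)\<^sup>2 = (1 - (S w)\<^sup>2) * (1 - m * (S w)\<^sup>2)"
      "\<And>w. w \<in> ball (z x0) r \<Longrightarrow> deriv \<Phi> w = 2 * S w * deriv S w"
      by (rule local_square_root[OF op hol ode zero x01(2,3,4) q0']) (assumption+, (rule that; assumption))
    \<comment> \<open>As the derivative q of S is not 0 at this point, S has a local inverse T, and
      T (g x) is the candidate for the value of the integral.\<close>
    obtain r' where r': "r' > 0" "ball (z x0) r' \<subseteq> ball (z x0) r" "open (S ` ball (z x0) r')" "inj_on S (ball (z x0) r')"
      using has_complex_derivative_locally_invertible[OF S(2) _ open_ball, of "z x0"] S(1,6) q0 by auto
    let ?B = "ball (z x0) r'" and ?V = "S ` ball (z x0) r'"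
    obtain T where T: "T holomorphic_on ?V" "\<And>u. u \<in> ?B \<Longrightarrow> deriv S u * deriv T (S u) = 1"
        "\<And>u. u \<in> ?B \<Longrightarrow> T (S u) = u"
      using holomorphic_has_inverse[OF holomorphic_on_subset[OF S(2) r'(2)] open_ball r'(4)] by metis
    have TV: "T v \<in> ?B" "S (T v) = v" "deriv S (T v) * deriv T v = 1" if "v \<in> ?V" for v
      using that T by auto
    have gV: "g x0 \<in> ?V" using S(5) r'(1) by (metis centre_in_ball imageI)
    have Tg0: "T (g x0) = z x0" using T(3)[of "z x0"] S(5) r'(1) by simp
    have dT0: "deriv T (g x0) = 1 / q x0"
      using TV(3)[OF gV] Tg0 S(6) q0 by (simp add: field_simps)
    have x0': "x0 \<in> {0..1}" using x01 by auto
    have lg: "(g \<longlongrightarrow> g x0) (at x0 within {0..1})" and lq: "(q \<longlongrightarrow> q x0) (at x0 within {0..1})"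
      using contg contq x0' by (auto simp: continuous_on_def)
    have contT: "continuous_on ?V T" "continuous_on ?V (deriv T)"
      using T(1) holomorphic_deriv[OF T(1) r'(3)] by (auto intro: holomorphic_on_imp_continuous_on)
    have ldT: "((\<lambda>x. deriv T (g x) * q x) \<longlongrightarrow> 1) (at x0 within {0..1})"
    proof -
      have "isCont (deriv T) (g x0)" using contT(2) r'(3) gV continuous_on_eq_continuous_at by blast
      then have "((\<lambda>x. deriv T (g x)) \<longlongrightarrow> deriv T (g x0)) (at x0 within {0..1})"
        using lg isCont_tendsto_compose by blast
      from tendsto_mult[OF this lq] show ?thesis using dT0 q0 by simp
    qed
    have "\<forall>\<^sub>F x in at x0 within {0..1}. g x \<in> ?V \<and> dist (deriv T (g x) * q x) 1 < 1"
      using topological_tendstoD[OF lg r'(3) gV] tendstoD[OF ldT, of 1] by (auto elim: eventually_conj)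
    then obtain d where d: "d > 0" "\<And>x. x \<in> {0..1} \<Longrightarrow> x \<noteq> x0 \<Longrightarrow> dist x x0 < d \<Longrightarrow>
        g x \<in> ?V \<and> dist (deriv T (g x) * q x) 1 < 1"
      unfolding eventually_at by metis
    \<comment> \<open>The differential equation leaves the values 1 and -1 for this product;
      closeness to its value 1 at \<open>x0\<close> excludes -1.\<close>
    have dT: "g x \<in> ?V" "deriv T (g x) * q x = 1" if "x \<in> {0..<1}" "dist x x0 < d" for x
    proof -
      have gx: "g x \<in> ?V \<and> dist (deriv T (g x) * q x) 1 < 1"
        using d(2)[of x] that gV dT0 q0 by (cases "x = x0") auto
      then show "g x \<in> ?V" by blast
      let ?u = "deriv S (T (g x))"
      have u: "?u * deriv T (g x) = 1" "S (T (g x)) = g x" "T (g x) \<in> ball (z x0) r" using TV gx r'(2) by blast+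
      have "?u\<^sup>2 = (q x)\<^sup>2" using S(7)[OF u(3)] q(1)[of x] that u(2) by simp
      then have "(deriv T (g x) * q x)\<^sup>2 = (?u * deriv T (g x))\<^sup>2" by (simp add: power_mult_distrib)
      then have "deriv T (g x) * q x = 1 \<or> deriv T (g x) * q x = - 1" using u(1) by (simp add: power2_eq_1_iff)
      moreover have "deriv T (g x) * q x \<noteq> - 1" using gx by (auto simp: dist_norm)
      ultimately show "deriv T (g x) * q x = 1" by blast
    qed
    \<comment> \<open>The derivative of T along g is g' / q, the integrand itself, except at the
      finitely many corners of the path.\<close>
    have int: "(w has_integral T (g t) - T (g s)) {s..t}"
      if st: "s \<le> t" "{s..t} \<subseteq> {0..<1}" "\<And>x. x \<in> {s..t} \<Longrightarrow> dist x x0 < d" for s t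
    proof (rule fundamental_theorem_of_calculus_interior_strong[OF K(1) st(1), of "\<lambda>x. T (g x)"])
      have "continuous_on {s..t} g" by (rule continuous_on_subset[OF contg]) (use st in auto)
      moreover have "g ` {s..t} \<subseteq> ?V" using dT(1) st by blast
      ultimately show "continuous_on {s..t} (\<lambda>x. T (g x))"
        using continuous_on_compose2[OF contT(1)] by blast
      show "((\<lambda>x. T (g x)) has_vector_derivative w x) (at x)" if "x \<in> {s<..<t} - K" for x
      proof -
        have xst: "x \<in> {s..t}" "s \<in> {s..t}" "s < x" using that by auto
        have x: "x \<in> {0..<1}" "dist x x0 < d" using xst st(2,3) by blast+
        have "0 \<le> s" using xst(2) st(2) by auto
        then have x': "x \<in> {0<..<1} - K" using x(1) xst(3) that by auto
        have "(T has_field_derivative deriv T (g x)) (at (g x))"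
          by (rule holomorphic_derivI[OF T(1) r'(3) dT(1)[OF x(1,2)]])
        from field_vector_diff_chain_at[OF K(2)[OF x'] this]
        have "((\<lambda>x. T (g x)) has_vector_derivative g' x * deriv T (g x)) (at x)" by (simp add: o_def)
        moreover have "deriv T (g x) = 1 / q x" using dT(2)[OF x(1,2)] q(2)[OF x(1)] by (simp add: field_simps)
        ultimately show ?thesis by (simp add: w(1))
      qed
    qed
    have zT: "z x = T (g x)" if "x \<in> {0..<1}" "dist x x0 < d" for x
    proof (cases "x0 \<le> x")
      case True
      have "(w has_integral T (g x) - T (g x0)) {x0..x}"
        by (rule int) (use True x01(1) that in \<open>auto simp: dist_real_def\<close>)
      moreover have "z x0 + integral {x0..x} w = z x"
        unfolding z_def by (rule Henstock_Kurzweil_Integration.integral_combine)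
          (use True x01(1) that in \<open>auto intro: integrable_on_subinterval[OF w(2)]\<close>)
      ultimately show ?thesis using Tg0 by (simp add: integral_unique)
    next
      case False
      then have "(w has_integral T (g x0) - T (g x)) {x..x0}"
        by (intro int) (use x01(1) that in \<open>auto simp: dist_real_def\<close>)
      moreover have "z x + integral {x..x0} w = z x0"
        unfolding z_def by (rule Henstock_Kurzweil_Integration.integral_combine)
          (use False x01(1) that in \<open>auto intro: integrable_on_subinterval[OF w(2)]\<close>)
      ultimately show ?thesis using Tg0 by (simp add: integral_unique algebra_simps)
    qed
    have "x \<in> A" if x: "x \<in> {0..<1}" "dist x x0 < d" for x
    proof -
      have u: "z x \<in> ball (z x0) r" "S (z x) = g x" "deriv S (z x) * deriv T (g x) = 1"
        using TV[OF dT(1)[OF x]] r'(2) zT[OF x] by auto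
      have "deriv S (z x) = q x" using u(3) dT(2)[OF x] by (metis mult.commute mult_cancel_left mult_zero_left zero_neq_one)
      then show ?thesis using x u S(3) S(4)[OF u(1)] S(8)[OF u(1)] by (auto simp: A_def)
    qed
    then show ?thesis using d(1) by blast
  qed

  have "deriv \<Phi> 0 = 0" using ode[OF init(1)] init(2) by simp
  then have "0 \<in> A" using init by (simp add: A_def z_def)
  moreover have "openin (top_of_set {0..<1}) A"
    unfolding openin_contains_ball using step by (fastforce simp: A_def dist_commute)
  moreover have "closedin (top_of_set {0..<1}) A"
    unfolding closedin_limpt
  proof (intro conjI allI impI)
    show "A \<subseteq> {0..<1}" by (auto simp: A_def)
    fix x assume x: "x islimpt A \<and> x \<in> {0..<1}"
    then obtain xn where "\<And>n. xn n \<in> A" "xn \<longlonglongrightarrow> x" unfolding islimpt_sequential by auto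
    then show "x \<in> A" using limit[of x xn] x by (auto simp: A_def)
  qed
  ultimately have A: "A = {0..<1}"
    using connected_clopen[of "{0..<1::real}"] by (metis connected_Ico empty_iff)
  have "z x \<in> \<Omega> \<and> \<Phi> (z x) = (g x)\<^sup>2"
  proof (cases "x = 1")
    case True
    \<comment> \<open>At the end of the path q may be 0 and S need not be invertible, so this point
      is reached as a limit.\<close>
    have "(\<lambda>n. 1 - inverse (real (Suc n))) \<longlonglongrightarrow> 1 - 0"
      by (intro tendsto_intros LIMSEQ_inverse_real_of_nat)
    moreover have "1 - inverse (real (Suc n)) \<in> A" for n unfolding A by (auto simp: field_simps)
    ultimately show ?thesis using limit[of x "\<lambda>n. 1 - inverse (real (Suc n))"] True by simp
  next
    case False
    then have "x \<in> A" using x A by auto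
    then show ?thesis by (simp add: A_def)
  qed
  then show ?thesis by (simp add: z_def)
qed

section \<open>Zeros of the Weierstrass function from elliptic integrals\<close>

lemma weierstrass_p_at_0:
  assumes "indep a b"
  shows "filterlim (weierstrass_p a b) at_infinity (at 0)"
proof -
  have dom: "(0, a, b) \<in> wp_reg_dom" using assms by (simp add: wp_reg_dom_iff)
  have "(wp_reg a b \<longlongrightarrow> wp_reg a b 0) (at 0)"
    using tendsto_wp_reg[OF dom tendsto_ident_at tendsto_const tendsto_const] .
  moreover have "filterlim (\<lambda>z. 1 / z\<^sup>2) at_infinity (at (0 :: complex))"
    unfolding divide_inverse mult_1_left
    by (rule filterlim_compose[OF filterlim_inverse_at_infinity])
       (auto simp: filterlim_at eventually_at_filter intro!: tendsto_eq_intros)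
  ultimately have "filterlim (\<lambda>z. 1 / z\<^sup>2 + wp_reg a b z) at_infinity (at 0)"
    by (subst add.commute) (rule tendsto_add_filterlim_at_infinity)
  moreover have "weierstrass_p a b = (\<lambda>z. 1 / z\<^sup>2 + wp_reg a b z)"
    by (rule ext) (rule weierstrass_p_eq[OF assms])
  ultimately show ?thesis by (simp only:)
qed

lemma weierstrass_p_at_lattice:
  assumes ind: "indep a b" and w: "w \<in> period_lattice a b"
  shows "filterlim (weierstrass_p a b) at_infinity (at w)"
proof -
  obtain r where r: "r > 0" "\<And>v. v \<in> period_lattice a b \<Longrightarrow> dist w v < r \<Longrightarrow> v = w"
    using lattice_ball_disjoint[OF ind, of w] by metis
  have "filterlim (\<lambda>v. v - w) (at 0) (at w)"
    by (auto simp: filterlim_at eventually_at_filter intro!: tendsto_eq_intros)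
  then have "filterlim (\<lambda>v. weierstrass_p a b (v - w)) at_infinity (at w)"
    by (rule filterlim_compose[OF weierstrass_p_at_0[OF ind]])
  moreover have "\<forall>\<^sub>F v in at w. weierstrass_p a b (v - w) = weierstrass_p a b v"
    unfolding eventually_at
  proof (intro exI conjI ballI impI)
    fix v assume v: "v \<noteq> w \<and> dist v w < r"
    then have "v \<notin> period_lattice a b" using r(2)[of v] by (auto simp: dist_commute)
    then have "v - w \<notin> period_lattice a b" using lattice_diff_iff[OF w] by blast
    from weierstrass_p_periodic[OF ind w this]
    show "weierstrass_p a b (v - w) = weierstrass_p a b v" by simp
  qed (rule r(1))
  ultimately show ?thesis using filterlim_cong by fast
qed

text \<open>Up to scaling, \<open>(\<wp>(z + b) - e\<^sub>2) / (e\<^sub>3 - e\<^sub>2)\<close> is \<open>sn\<^sup>2\<close>; it has the advantage of being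
  defined without a choice of root.\<close>

definition sn_square :: "complex \<Rightarrow> complex \<Rightarrow> complex \<Rightarrow> complex" where
  "sn_square a b z = (weierstrass_p a b (z + b) - wp_e2 a b) / (wp_e3 a b - wp_e2 a b)"

text \<open>With u = (w - z) / k the shift formula for b turns the function into (k * u)^2 / D u,
  where D u = u^2 * (\<wp> u - e2) tends to 1. The root (w - z) / sqrt (D u) therefore has
  derivative 1 at z.\<close>

lemma sn_square_local_root:
  assumes ind: "indep a b" and k: "k\<^sup>2 = wp_e1 a b - wp_e2 a b"
    and z: "z / k + b \<notin> period_lattice a b" "sn_square a b (z / k) = 0"
  shows "\<exists>r>0. \<exists>S. S holomorphic_on ball z r \<and> ball z r \<subseteq> {w. w / k + b \<notin> period_lattice a b} \<and>
      (\<forall>w\<in>ball z r. (S w)\<^sup>2 = sn_square a b (w / k)) \<and> (\<forall>w\<in>ball z r - {z}. S w \<noteq> 0) \<and> (deriv S z)\<^sup>2 = 1"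
proof -
  let ?L = "period_lattice a b" and ?P = "weierstrass_p a b"
  note ne = weierstrass_p_half_periods_distinct[OF ind]
  have k0: "k \<noteq> 0" using k ne by auto
  have "?P (z / k + b) = ?P b" using z(2) ne(3) by (simp add: sn_square_def wp_e2_def)
  then have "z / k + b + b \<in> ?L" using weierstrass_p_eq_half_period_value[OF ind _ z(1), of b] by auto
  then have zL: "z / k \<in> ?L"
    using lattice_diff_iff[OF lattice_periods(2)[where b = b], of "z / k + b + b" a] by (simp add: algebra_simps)
  obtain r0 where r0: "r0 > 0" "wp_reg a b holomorphic_on ball 0 r0" "ball 0 r0 \<inter> ?L = {0}"
    using holomorphic_on_wp_reg_0[OF ind] by metis
  obtain r1 where r1: "r1 > 0" "\<And>w. w \<in> ?L \<Longrightarrow> dist b w < r1 \<Longrightarrow> w = b"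
    using lattice_ball_disjoint[OF ind, of b] by metis
  define D where "D u = 1 + u\<^sup>2 * (wp_reg a b u - wp_e2 a b)" for u
  have holD: "D holomorphic_on ball 0 r0" unfolding D_def by (intro holomorphic_intros r0)
  then have "isCont D 0"
    using r0(1) holomorphic_on_imp_continuous_on[OF holD] by (simp add: continuous_on_eq_continuous_at)
  then have "(D \<longlongrightarrow> 1) (at 0)" by (simp add: isCont_def D_def)
  then have "\<forall>\<^sub>F u in at 0. dist (D u) 1 < 1" by (rule tendstoD) simp
  then obtain r2 where r2: "r2 > 0" "\<And>u. u \<noteq> 0 \<Longrightarrow> dist u 0 < r2 \<Longrightarrow> dist (D u) 1 < 1"
    by (auto simp: eventually_at)
  define r where "r = min r0 (min r1 r2)"
  have r: "r > 0" "ball 0 r \<subseteq> ball 0 r0" using r0(1) r1(1) r2(1) by (auto simp: r_def)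
  have D1: "Re (D u) > 0" if "u \<in> ball 0 r" for u
  proof -
    have "dist (D u) 1 < 1" using r2(2)[of u] that by (cases "u = 0") (auto simp: r_def D_def)
    then show ?thesis using abs_Re_le_cmod[of "D u - 1"] by (simp add: dist_norm)
  qed
  have ub: "u + b \<notin> ?L" if "u \<in> ball 0 r" for u
    using r1(2)[of "u + b"] that half_periods_not_lattice[OF ind] by (auto simp: r_def dist_norm)
  have sn: "sn_square a b u = (k * u)\<^sup>2 / D u" if "u \<in> ball 0 r" for u
  proof (cases "u = 0")
    case True
    then show ?thesis by (simp add: sn_square_def wp_e2_def)
  next
    case False
    \<comment> \<open>The shift formula applies only off the lattice; the value at u = 0 was checked
      directly.\<close>
    then have uL: "u \<notin> ?L" using that r(2) r0(3) by blast
    have "(?P u - wp_e2 a b) * (?P (u + b) - wp_e2 a b) = k\<^sup>2 * (wp_e3 a b - wp_e2 a b)"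
      using half_period_shift_formula(2)[OF ind uL ub[OF that]] k by simp
    then have "(?P u - wp_e2 a b) * sn_square a b u = k\<^sup>2"
      using ne(3) by (simp add: sn_square_def field_simps)
    moreover have "u\<^sup>2 * (?P u - wp_e2 a b) = D u"
      using False by (simp add: weierstrass_p_eq[OF ind] D_def algebra_simps)
    ultimately have "D u * sn_square a b u = (k * u)\<^sup>2"
      by (metis mult.assoc mult.commute power_mult_distrib)
    moreover have "D u \<noteq> 0" using D1[OF that] by auto
    ultimately show ?thesis by (simp add: field_simps)
  qed
  define F where "F w = 1 / csqrt (D ((w - z) / k))" for w
  define S where "S w = (w - z) * F w" for w
  define R where "R = r * cmod k"
  have R: "R > 0" using r(1) k0 by (simp add: R_def)
  have uw: "(w - z) / k \<in> ball 0 r" if "w \<in> ball z R" for w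
    using that k0 by (simp add: R_def dist_norm norm_divide norm_minus_commute field_simps)
  have holDw: "(\<lambda>w. D ((w - z) / k)) holomorphic_on ball z R"
    by (rule holomorphic_on_compose_gen[OF _ holD, of "\<lambda>w. (w - z) / k", unfolded o_def])
       (use uw r(2) k0 in \<open>auto intro!: holomorphic_intros\<close>)
  have nz: "csqrt (D ((w - z) / k)) \<noteq> 0" if "w \<in> ball z R" for w
    using D1[OF uw[OF that]] by auto
  have holF: "F holomorphic_on ball z R"
    unfolding F_def
    by (intro holomorphic_intros holDw nz) (use D1 uw in \<open>auto simp: complex_nonpos_Reals_iff, force\<close>)
  have "deriv S z = 1"
  proof (rule DERIV_imp_deriv)
    have "(F has_field_derivative deriv F z) (at z)"
      by (rule holomorphic_derivI[OF holF open_ball]) (use R in simp)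
    then have "(S has_field_derivative 1 * F z + deriv F z * (z - z)) (at z)"
      unfolding S_def by (intro DERIV_mult) (auto intro!: derivative_eq_intros)
    then show "(S has_field_derivative 1) (at z)" by (simp add: F_def D_def)
  qed
  moreover have "S holomorphic_on ball z R" unfolding S_def by (intro holomorphic_intros holF)
  moreover have "w / k + b \<notin> ?L" if "w \<in> ball z R" for w
  proof -
    have "(w - z) / k + b + z / k = w / k + b" by (simp add: diff_divide_distrib)
    then show ?thesis using lattice_add_iff[OF zL, of "(w - z) / k + b"] ub[OF uw[OF that]] by metis
  qed
  moreover have "(S w)\<^sup>2 = sn_square a b (w / k)" if "w \<in> ball z R" for w
  proof -
    have eq: "(w - z) / k + b + z / k = w / k + b" by (simp add: diff_divide_distrib)
    have "sn_square a b (w / k) = sn_square a b ((w - z) / k)"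
      using weierstrass_p_periodic[OF ind zL ub[OF uw[OF that]]] by (simp only: sn_square_def eq)
    also have "\<dots> = (S w)\<^sup>2"
      unfolding sn[OF uw[OF that]] using k0 by (simp add: S_def F_def power_mult_distrib power_divide)
    finally show ?thesis by simp
  qed
  moreover have "S w \<noteq> 0" if "w \<in> ball z R - {z}" for w
    using that nz[of w] by (auto simp: S_def F_def)
  ultimately show ?thesis using R by (intro exI[of _ R] conjI exI[of _ S]) auto
qed

text \<open>Dividing the argument by k normalizes the differential equation. The root q is left
  abstract, so that the lemma serves both for paths in the plane and for a real
  substitution.\<close>

lemma weierstrass_p_elliptic_integral:
  fixes g g' q w :: "real \<Rightarrow> complex"
  assumes ind: "indep a b" and k: "k\<^sup>2 = wp_e1 a b - wp_e2 a b"
    and m: "m = (wp_e3 a b - wp_e2 a b) / (wp_e1 a b - wp_e2 a b)"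
    and init: "g 0 = 0"
    and contg: "continuous_on {0..1} g" and contq: "continuous_on {0..1} q"
    and K: "finite K" "\<And>x. x \<in> {0<..<1} - K \<Longrightarrow> (g has_vector_derivative g' x) (at x)"
    and q: "\<And>x. x \<in> {0..1} \<Longrightarrow> (q x)\<^sup>2 = (1 - (g x)\<^sup>2) * (1 - m * (g x)\<^sup>2)" "\<And>x. x \<in> {0..<1} \<Longrightarrow> q x \<noteq> 0"
    and w: "\<And>x. w x = 1 / q x * g' x" "w integrable_on {0..1}"
    and x: "x \<in> {0..1}"
  shows "g x = 0 \<Longrightarrow> integral {0..x} w / k \<in> period_lattice a b"
    and "g x \<noteq> 0 \<Longrightarrow> integral {0..x} w / k \<notin> period_lattice a b \<and>
      weierstrass_p a b (integral {0..x} w / k) = wp_e2 a b + (wp_e1 a b - wp_e2 a b) / (g x)\<^sup>2"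
proof -
  let ?L = "period_lattice a b" and ?P = "weierstrass_p a b"
  let ?e1 = "wp_e1 a b" and ?e2 = "wp_e2 a b" and ?e3 = "wp_e3 a b"
  note ne = weierstrass_p_half_periods_distinct[OF ind]
  have k0: "k \<noteq> 0" using k ne by auto
  define \<Omega> where "\<Omega> = {w. w / k + b \<notin> ?L}"
  define \<Phi> where "\<Phi> w = sn_square a b (w / k)" for w
  have \<Phi>_eq: "\<Phi> = (\<lambda>w. (?P (w / k + b) - ?e2) / (?e3 - ?e2))"
    by (rule ext) (simp add: \<Phi>_def sn_square_def)
  have op: "open \<Omega>"
  proof -
    have "\<Omega> = (\<lambda>w. w / k + b) -` (- ?L)" by (auto simp: \<Omega>_def)
    then show ?thesis
      using open_lattice_compl[OF ind] k0 by (auto intro!: continuous_open_vimage continuous_intros)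
  qed
  have der: "(\<Phi> has_field_derivative deriv ?P (z / k + b) / (k * (?e3 - ?e2))) (at z)" if "z \<in> \<Omega>" for z
  proof -
    have "((\<lambda>w. w / k + b) has_field_derivative 1 / k) (at z)"
      using k0 by (auto intro!: derivative_eq_intros)
    from DERIV_chain2[OF weierstrass_p_deriv[OF ind] this] that
    have "((\<lambda>w. ?P (w / k + b)) has_field_derivative deriv ?P (z / k + b) * (1 / k)) (at z)"
      by (simp add: \<Omega>_def)
    then have "((\<lambda>w. (?P (w / k + b) - ?e2) / (?e3 - ?e2)) has_field_derivative
        (deriv ?P (z / k + b) * (1 / k) - 0) / (?e3 - ?e2)) (at z)"
      by (intro DERIV_cdivide DERIV_diff DERIV_const)
    then show ?thesis by (simp add: \<Phi>_eq)
  qed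
  have hol: "\<Phi> holomorphic_on \<Omega>"
    unfolding holomorphic_on_open[OF op] using der by blast
  have ode: "(deriv \<Phi> z)\<^sup>2 = 4 * \<Phi> z * (1 - \<Phi> z) * (1 - m * \<Phi> z)" if z: "z \<in> \<Omega>" for z
  proof -
    define p where "p = ?P (z / k + b)"
    define d where "d = ?e3 - ?e2"
    have d0: "d \<noteq> 0" "k\<^sup>2 \<noteq> 0" using ne k0 by (auto simp: d_def)
    have p: "p - ?e2 = d * \<Phi> z" "p - ?e3 = - (d * (1 - \<Phi> z))" "p - ?e1 = - (k\<^sup>2 * (1 - m * \<Phi> z))"
    proof -
      show 1: "p - ?e2 = d * \<Phi> z" using d0 by (simp add: \<Phi>_def sn_square_def p_def d_def)
      have "k\<^sup>2 * m = d" using m k ne by (simp add: d_def)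
      then have "k\<^sup>2 * (m * \<Phi> z) = p - ?e2" using 1 by (metis mult.assoc)
      then show "p - ?e1 = - (k\<^sup>2 * (1 - m * \<Phi> z))" using k by (simp add: right_diff_distrib)
      show "p - ?e3 = - (d * (1 - \<Phi> z))" using 1 by (simp add: right_diff_distrib) (simp add: d_def algebra_simps)
    qed
    have "(deriv \<Phi> z)\<^sup>2 = (deriv ?P (z / k + b))\<^sup>2 / (k\<^sup>2 * d\<^sup>2)"
      using DERIV_imp_deriv[OF der[OF z]] by (simp add: power_divide power_mult_distrib d_def)
    also have "(deriv ?P (z / k + b))\<^sup>2 = 4 * (p - ?e1) * (p - ?e2) * (p - ?e3)"
      using weierstrass_p_ode[OF ind, of "z / k + b"] z by (simp add: \<Omega>_def p_def)
    also have "\<dots> = (k\<^sup>2 * d\<^sup>2) * (4 * \<Phi> z * (1 - \<Phi> z) * (1 - m * \<Phi> z))"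
      unfolding p by (simp add: power2_eq_square)
    finally show ?thesis using d0 by simp
  qed
  have zero: "\<exists>r>0. \<exists>S. S holomorphic_on ball z r \<and> ball z r \<subseteq> \<Omega> \<and> (\<forall>w\<in>ball z r. (S w)\<^sup>2 = \<Phi> w) \<and>
         (\<forall>w\<in>ball z r - {z}. S w \<noteq> 0) \<and> (deriv S z)\<^sup>2 = 1" if "z \<in> \<Omega>" "\<Phi> z = 0" for z
    using sn_square_local_root[OF ind k, of z] that unfolding \<Omega>_def \<Phi>_def by blast
  have pole: "filterlim \<Phi> at_infinity (at p within \<Omega>)" if "p \<notin> \<Omega>" for p
  proof -
    have "p / k + b \<in> ?L" using that by (simp add: \<Omega>_def)
    moreover have "filterlim (\<lambda>w. w / k + b) (at (p / k + b)) (at p within \<Omega>)"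
      using k0 by (auto simp: filterlim_at eventually_at_filter intro!: tendsto_eq_intros)
    ultimately have "filterlim (\<lambda>w. ?P (w / k + b)) at_infinity (at p within \<Omega>)"
      using filterlim_compose[OF weierstrass_p_at_lattice[OF ind]] by blast
    then have "filterlim (\<lambda>w. - ?e2 + ?P (w / k + b)) at_infinity (at p within \<Omega>)"
      by (rule tendsto_add_filterlim_at_infinity[OF tendsto_const])
    then have "filterlim (\<lambda>w. 1 / (?e3 - ?e2) * (- ?e2 + ?P (w / k + b))) at_infinity (at p within \<Omega>)"
      by (rule tendsto_mult_filterlim_at_infinity[OF tendsto_const, rotated]) (use ne in simp)
    then show ?thesis by (simp add: \<Phi>_eq)
  qed
  have "0 \<in> \<Omega>" "\<Phi> 0 = 0"
    using half_periods_not_lattice[OF ind] by (auto simp: \<Omega>_def \<Phi>_def sn_square_def wp_e2_def)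
  have "integral {0..x} w \<in> \<Omega> \<and> \<Phi> (integral {0..x} w) = (g x)\<^sup>2"
    by (rule elliptic_integral_inverts[OF op hol ode zero pole
          \<open>0 \<in> \<Omega>\<close> \<open>\<Phi> 0 = 0\<close> init contg contq K q w x])
  then have I: "integral {0..x} w \<in> \<Omega>" "\<Phi> (integral {0..x} w) = (g x)\<^sup>2" by blast+
  define u where "u = integral {0..x} w / k"
  have u: "u + b \<notin> ?L" "?P (u + b) - ?e2 = (?e3 - ?e2) * (g x)\<^sup>2"
    using I ne by (simp_all add: \<Omega>_def \<Phi>_def sn_square_def u_def field_simps)
  have lat: "u \<in> ?L \<longleftrightarrow> g x = 0"
  proof
    assume "u \<in> ?L"
    then have "?P (b + u) = ?e2"
      using weierstrass_p_periodic[OF ind _ half_periods_not_lattice(2)[OF ind]] by (simp add: wp_e2_def)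
    then show "g x = 0" using u ne by (simp add: add.commute)
  next
    assume "g x = 0"
    then have "?P (u + b) = ?P b" using u(2) by (simp add: wp_e2_def)
    then have "u + b + b \<in> ?L" using weierstrass_p_eq_half_period_value[OF ind _ u(1), of b] by auto
    then show "u \<in> ?L"
      using lattice_diff_iff[OF lattice_periods(2)[where b = b], of "u + b + b" a] by (simp add: algebra_simps)
  qed
  show "g x = 0 \<Longrightarrow> integral {0..x} w / k \<in> ?L" using lat by (simp add: u_def)
  show "integral {0..x} w / k \<notin> ?L \<and> ?P (integral {0..x} w / k) = ?e2 + (?e1 - ?e2) / (g x)\<^sup>2" if "g x \<noteq> 0"
  proof -
    have uL: "u \<notin> ?L" using lat that by blast
    \<comment> \<open>Inversion gives \<wp> at u + b; the shift formula for b carries this back to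
      u.\<close>
    have "(?P u - ?e2) * ((?e3 - ?e2) * (g x)\<^sup>2) = (?e1 - ?e2) * (?e3 - ?e2)"
      using half_period_shift_formula(2)[OF ind uL u(1)] u(2) by simp
    then have "(?P u - ?e2) * (g x)\<^sup>2 = ?e1 - ?e2" using ne(3) by (simp add: mult.left_commute)
    then have "?P u = ?e2 + (?e1 - ?e2) / (g x)\<^sup>2" using that by (simp add: field_simps)
    then show ?thesis using uL by (simp add: u_def)
  qed
qed

text \<open>A closed path from 0 to 0 yields a period. This case is kept because the upper limit of
  the first formula is 0 when e3 = 0.\<close>

lemma weierstrass_p_elliptic_integral_value:
  assumes ind: "indep a b" and k: "k\<^sup>2 = wp_e1 a b - wp_e2 a b"
    and I: "elliptic_integral_value ((wp_e3 a b - wp_e2 a b) / (wp_e1 a b - wp_e2 a b)) s I"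
  shows "s = 0 \<Longrightarrow> I / k \<in> period_lattice a b"
    and "s \<noteq> 0 \<Longrightarrow> I / k \<notin> period_lattice a b \<and>
      weierstrass_p a b (I / k) = wp_e2 a b + (wp_e1 a b - wp_e2 a b) / s\<^sup>2"
proof -
  let ?m = "(wp_e3 a b - wp_e2 a b) / (wp_e1 a b - wp_e2 a b)"
  obtain g r1 r2 where g: "valid_path g" "pathstart g = 0" "pathfinish g = s"
      "continuous_on {0..1} r1" "continuous_on {0..1} r2"
      "\<And>x. x \<in> {0..1} \<Longrightarrow> (r1 x)\<^sup>2 = 1 - (g x)\<^sup>2 \<and> (r2 x)\<^sup>2 = 1 - ?m * (g x)\<^sup>2"
      "\<And>x. x \<in> {0..<1} \<Longrightarrow> r1 x \<noteq> 0 \<and> r2 x \<noteq> 0"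
      "((\<lambda>x. 1 / (r1 x * r2 x) * vector_derivative g (at x within {0..1})) has_integral I) {0..1}"
    using I unfolding elliptic_integral_value_def by blast
  obtain K where K: "finite K" "g C1_differentiable_on ({0..1} - K)" and contg: "continuous_on {0..1} g"
    using g(1) by (auto simp: valid_path_def piecewise_C1_differentiable_on_def)
  define w where "w x = 1 / (r1 x * r2 x) * vector_derivative g (at x within {0..1})" for x
  have gd: "(g has_vector_derivative vector_derivative g (at x within {0..1})) (at x)"
    if "x \<in> {0<..<1} - K" for x
  proof -
    have "(g has_vector_derivative vector_derivative g (at x)) (at x)"
      using K(2) that by (auto simp: C1_differentiable_on_eq vector_derivative_works)
    then show ?thesis using vector_derivative_at_within_ivl[of g _ x 0 1] that by simp
  qed
  have int: "w integrable_on {0..1}" "integral {0..1} w = I"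
    using g(8) unfolding w_def[symmetric] by (auto intro: integral_unique)
  have g01: "g 0 = 0" "g 1 = s" using g(2,3) by (simp_all add: pathstart_def pathfinish_def)
  have cq: "continuous_on {0..1} (\<lambda>x. r1 x * r2 x)" by (intro continuous_intros g)
  have q1: "(r1 x * r2 x)\<^sup>2 = (1 - (g x)\<^sup>2) * (1 - ?m * (g x)\<^sup>2)" if "x \<in> {0..1}" for x
    using g(6)[OF that] by (simp add: power_mult_distrib)
  have q2: "r1 x * r2 x \<noteq> 0" if "x \<in> {0..<1}" for x using g(7)[OF that] by simp
  note W = weierstrass_p_elliptic_integral[OF ind k refl g01(1) contg cq K(1) gd q1 q2 w_def int(1), of 1]
  show "s = 0 \<Longrightarrow> I / k \<in> period_lattice a b"
    using W(1) by (simp add: g01 int)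
  show "s \<noteq> 0 \<Longrightarrow> I / k \<notin> period_lattice a b \<and>
      weierstrass_p a b (I / k) = wp_e2 a b + (wp_e1 a b - wp_e2 a b) / s\<^sup>2"
    using W(2) by (simp add: g01 int)
qed

text \<open>The upper limit makes (e1 - e2) / (2 * s)^2 equal to -e2. The ambiguous sign is harmless
  because \<wp> is even.\<close>

lemma zero_from_formula2:
  assumes ind: "indep a b" and norm: "wp_e1 a b - wp_e2 a b = 4" and "wp_e2 a b \<noteq> 0"
    and s: "s\<^sup>2 = - 1 / wp_e2 a b"
    and I: "elliptic_integral_value ((wp_e3 a b - wp_e2 a b) / (wp_e1 a b - wp_e2 a b)) (2 * s) I"
    and z: "z = 1 / csqrt (wp_e1 a b - wp_e2 a b) * I \<or> z = - (1 / csqrt (wp_e1 a b - wp_e2 a b) * I)"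
  shows "is_zero_of_wp a b z"
proof -
  let ?k = "csqrt (wp_e1 a b - wp_e2 a b)"
  have k: "?k\<^sup>2 = wp_e1 a b - wp_e2 a b" by simp
  have "s \<noteq> 0" using s assms(3) by auto
  then have W: "I / ?k \<notin> period_lattice a b"
      "weierstrass_p a b (I / ?k) = wp_e2 a b + (wp_e1 a b - wp_e2 a b) / (2 * s)\<^sup>2"
    using weierstrass_p_elliptic_integral_value(2)[OF ind k I] by auto
  have "(wp_e1 a b - wp_e2 a b) / (2 * s)\<^sup>2 = - wp_e2 a b"
    unfolding norm power_mult_distrib s using assms(3) by simp
  then have "is_zero_of_wp a b (I / ?k)" using W by (simp add: is_zero_of_wp_def)
  then show ?thesis
    using z by (auto simp: is_zero_of_wp_def lattice_uminus_iff weierstrass_p_minus[OF ind])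
qed

text \<open>With the half-periods exchanged, \<wp> u = e1 - 1 / (4 * s^2) for u = \<i> / 2 * I. As
  e1 = 2 - e3 / 2 and e2 = -2 - e3 / 2, the shift by a + b sends u to a zero just if e1 - \<wp> u =
  (e3 + 4) * (3 * e3 - 4) / (4 * e3), provided e3 is not 0; this is the given s.\<close>

lemma zero_from_formula1:
  assumes ind: "indep a b" and norm: "wp_e1 a b - wp_e2 a b = 4"
    and nz: "(wp_e3 a b + 4) * (3 * wp_e3 a b - 4) \<noteq> 0"
    and s: "s\<^sup>2 = wp_e3 a b / ((wp_e3 a b + 4) * (3 * wp_e3 a b - 4))"
    and I: "elliptic_integral_value ((wp_e1 a b - wp_e3 a b) / 4) (4 * s) I"
  shows "is_zero_of_wp a b (a + b - \<i> / 2 * I)"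
proof -
  let ?L = "period_lattice a b" and ?P = "weierstrass_p a b"
  let ?e1 = "wp_e1 a b" and ?e2 = "wp_e2 a b" and ?e3 = "wp_e3 a b"
  define u where "u = \<i> / 2 * I"
  have swap: "wp_e1 b a = ?e2" "wp_e2 b a = ?e1" "wp_e3 b a = ?e3"
    by (simp_all add: wp_e1_def wp_e2_def wp_e3_def weierstrass_p_lattice_cong[OF lattice_swap] add.commute)
  \<comment> \<open>Of the two roots of -4, this one makes I / k equal to \<i> / 2 * I.\<close>
  have k: "(- 2 * \<i>)\<^sup>2 = wp_e1 b a - wp_e2 b a" using norm by (simp add: swap power_mult_distrib algebra_simps)
  have "(?e1 - ?e3) / 4 = (?e3 - ?e1) / (?e2 - ?e1)"
  proof -
    have d: "?e2 - ?e1 = - 4" using norm by (simp add: algebra_simps)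
    show ?thesis unfolding d by (simp add: field_simps)
  qed
  then have "elliptic_integral_value ((wp_e3 b a - wp_e2 b a) / (wp_e1 b a - wp_e2 b a)) (4 * s) I"
    using I by (simp only: swap)
  note W = weierstrass_p_elliptic_integral_value[OF indep_swap[OF ind] k this]
  have uI: "I / (- 2 * \<i>) = u" by (simp add: u_def field_simps)
  have W1: "u \<in> ?L" if "s = 0"
    using W(1) that unfolding uI by (simp add: lattice_swap)
  have W2: "u \<notin> ?L" "?P u = ?e1 + (?e2 - ?e1) / (4 * s)\<^sup>2" if "s \<noteq> 0"
    using W(2) that unfolding uI by (simp_all add: lattice_swap swap weierstrass_p_lattice_cong[OF lattice_swap])
  note ne = weierstrass_p_half_periods_distinct[OF ind]
  have e1: "2 * ?e1 = 4 - ?e3" and e2: "2 * ?e2 = - 4 - ?e3"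
    using wp_e_sum[OF ind] norm by algebra+
  have eq: "a + b - \<i> / 2 * I = - u + (a + b)" by (simp add: u_def)
  show ?thesis
  proof (cases "s = 0")
    \<comment> \<open>Here e3 = 0 and u is a period, so the point is congruent to a + b, where \<wp>
      takes the value e3.\<close>
    case True
    then have "?e3 = 0" using s nz by auto
    have "- u \<in> ?L" using W1[OF True] by (simp add: lattice_uminus_iff)
    then have "(a + b) + - u \<notin> ?L" "?P ((a + b) + - u) = ?e3"
      using half_periods_not_lattice(3)[OF ind] lattice_add_iff[of "- u" a b "a + b"]
        weierstrass_p_periodic[OF ind, of "- u" "a + b"] unfolding wp_e3_def by blast+
    then show ?thesis using \<open>?e3 = 0\<close> by (simp add: is_zero_of_wp_def u_def)
  next
    case False
    note W2 = W2[OF False]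
    have e3: "?e3 \<noteq> 0" using s False by auto
    have "(4 * s)\<^sup>2 * ((?e3 + 4) * (3 * ?e3 - 4)) = 16 * ?e3"
      using s nz by (simp add: power_mult_distrib)
    moreover have "(4 * s)\<^sup>2 * (?P u - ?e1) = - 4"
    proof -
      have "?P u - ?e1 = (?e2 - ?e1) / (4 * s)\<^sup>2" using W2(2) by simp
      then have "(4 * s)\<^sup>2 * (?P u - ?e1) = ?e2 - ?e1" using False by (simp del: power_mult_distrib)
      then show ?thesis using norm by (simp add: algebra_simps)
    qed
    ultimately have "(4 * s)\<^sup>2 * (4 * ?e3 * (?P u - ?e1) + (?e3 + 4) * (3 * ?e3 - 4)) = 0" by algebra
    then have Pu: "4 * ?e3 * (?P u - ?e1) + (?e3 + 4) * (3 * ?e3 - 4) = 0" using False by simp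
    \<comment> \<open>This is the shift formula for a + b with the value 0 entered for the partner
      of u.\<close>
    have key: "- ?e3 * (?P u - ?e3) = (?e1 - ?e3) * (?e2 - ?e3)"
    proof -
      have "4 * (- ?e3 * (?P u - ?e3)) = 4 * ((?e1 - ?e3) * (?e2 - ?e3))"
        using Pu e1 e2 by algebra
      then show ?thesis by simp
    qed
    have Pu3: "?P u \<noteq> ?e3" using key ne by auto
    have uL: "- u \<notin> ?L" using W2(1) by (simp add: lattice_uminus_iff)
    have zL: "- u + (a + b) \<notin> ?L"
    proof
      assume *: "- u + (a + b) \<in> ?L"
      have "u + (- u + (a + b)) = a + b" by simp
      then have "?P (a + b) = ?P u" using weierstrass_p_periodic[OF ind * W2(1)] by metis
      then show False using Pu3 by (simp add: wp_e3_def)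
    qed
    have "(?P u - ?e3) * (?P (- u + (a + b)) - ?e3) = (?P u - ?e3) * (- ?e3)"
      using half_period_shift_formula(3)[OF ind uL zL] key by (simp add: weierstrass_p_minus[OF ind] mult.commute)
    then have "?P (- u + (a + b)) - ?e3 = - ?e3" unfolding mult_cancel_left using Pu3 by simp
    then have "?P (- u + (a + b)) = 0" by simp
    then show ?thesis unfolding is_zero_of_wp_def eq using zL by blast
  qed
qed

section \<open>Analytic continuation in the period ratio\<close>

lemma is_zero_of_wp_lattice_cong:
  assumes "period_lattice a b = period_lattice a' b'"
  shows "is_zero_of_wp a b z \<longleftrightarrow> is_zero_of_wp a' b' z"
  using assms weierstrass_p_lattice_cong[OF assms] by (simp add: is_zero_of_wp_def)

definition half_period_gap :: "complex \<Rightarrow> complex" where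
  "half_period_gap \<tau> = wp_e1 1 \<tau> - wp_e2 1 \<tau>"

lemma indep_1: "Im \<tau> > 0 \<Longrightarrow> indep 1 \<tau>"
  by (simp add: indep_def)

lemma half_period_gap_scale:
  assumes "Im \<tau> > 0" "a \<noteq> 0"
  shows "wp_e1 a (\<tau> * a) - wp_e2 a (\<tau> * a) = half_period_gap \<tau> / a\<^sup>2"
  using weierstrass_p_scale[OF indep_1[OF assms(1)] assms(2), of 1]
    weierstrass_p_scale[OF indep_1[OF assms(1)] assms(2), of \<tau>]
  by (simp add: wp_e1_def wp_e2_def half_period_gap_def diff_divide_distrib mult.commute)

text \<open>Homogeneity of degree -2 reduces the normalization to a quadratic equation for the first
  half-period.\<close>

lemma normalized_half_periods_iff:
  assumes "Im \<tau> > 0"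
  shows "normalized_half_periods \<tau> a b \<longleftrightarrow> a \<noteq> 0 \<and> b = \<tau> * a \<and> a\<^sup>2 = half_period_gap \<tau> / 4"
proof (cases "a = 0")
  case False
  have "b / a = \<tau> \<longleftrightarrow> b = \<tau> * a" using False by (simp add: field_simps)
  moreover have "half_period_gap \<tau> / a\<^sup>2 = 4 \<longleftrightarrow> a\<^sup>2 = half_period_gap \<tau> / 4"
    using False by (auto simp: field_simps)
  ultimately show ?thesis
    using half_period_gap_scale[OF assms False] False by (auto simp: normalized_half_periods_def)
qed (simp add: normalized_half_periods_def)

lemma normalized_indep:
  assumes "Im \<tau> > 0" "normalized_half_periods \<tau> a b"
  shows "indep a b"
  using assms indep_iff_quotient[of a b] by (auto simp: normalized_half_periods_def)

lemma normalized_lattice_unique: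
  assumes "Im \<tau> > 0" "normalized_half_periods \<tau> a b" "normalized_half_periods \<tau> a' b'"
  shows "period_lattice a b = period_lattice a' b'"
proof -
  have "a\<^sup>2 = a'\<^sup>2" "b = \<tau> * a" "b' = \<tau> * a'"
    using assms(2,3) normalized_half_periods_iff[OF assms(1)] by metis+
  then consider "a' = a" "b' = b" | "a' = - a" "b' = - b" by (auto simp: power2_eq_iff)
  then show ?thesis
  proof cases
    case 2
    have "period_lattice a b = period_lattice a (- b)"
      using lattice_minus_left[of b a] lattice_swap by metis
    then show ?thesis using 2 lattice_minus_left[of a "- b"] by simp
  qed simp
qed

lemma is_zero_normalized_cong:
  assumes "Im \<tau> > 0" "normalized_half_periods \<tau> a b" "normalized_half_periods \<tau> a' b'"
  shows "is_zero_of_wp a b z \<longleftrightarrow> is_zero_of_wp a' b' z"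
  by (rule is_zero_of_wp_lattice_cong[OF normalized_lattice_unique[OF assms]])

lemma z0_formula1_zero:
  assumes "Im \<tau> > 0" "normalized_half_periods \<tau> a b" "z0_formula1 \<tau> z"
  shows "is_zero_of_wp a b z"
proof -
  obtain a' b' s I where *: "normalized_half_periods \<tau> a' b'"
    "(wp_e3 a' b' + 4) * (3 * wp_e3 a' b' - 4) \<noteq> 0"
    "s\<^sup>2 = wp_e3 a' b' / ((wp_e3 a' b' + 4) * (3 * wp_e3 a' b' - 4))"
    "elliptic_integral_value ((wp_e1 a' b' - wp_e3 a' b') / 4) (4 * s) I"
    "z = a' + b' - \<i> / 2 * I"
    using assms(3) unfolding z0_formula1_def Let_def by blast
  have "wp_e1 a' b' - wp_e2 a' b' = 4" using *(1) by (simp add: normalized_half_periods_def)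
  from zero_from_formula1[OF normalized_indep[OF assms(1) *(1)] this *(2-4)]
  show ?thesis using is_zero_normalized_cong[OF assms(1,2) *(1)] *(5) by simp
qed

lemma z0_formula2_zero:
  assumes "Im \<tau> > 0" "normalized_half_periods \<tau> a b" "z0_formula2 \<tau> z"
  shows "is_zero_of_wp a b z"
proof -
  obtain a' b' s I where *: "normalized_half_periods \<tau> a' b'" "wp_e2 a' b' \<noteq> 0" "s\<^sup>2 = - 1 / wp_e2 a' b'"
    "elliptic_integral_value ((wp_e3 a' b' - wp_e2 a' b') / (wp_e1 a' b' - wp_e2 a' b')) (2 * s) I"
    "z = 1 / csqrt (wp_e1 a' b' - wp_e2 a' b') * I \<or> z = - (1 / csqrt (wp_e1 a' b' - wp_e2 a' b') * I)"
    using assms(3) unfolding z0_formula2_def Let_def by blast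
  have "wp_e1 a' b' - wp_e2 a' b' = 4" using *(1) by (simp add: normalized_half_periods_def)
  from zero_from_formula2[OF normalized_indep[OF assms(1) *(1)] this *(2-5)]
  show ?thesis using is_zero_normalized_cong[OF assms(1,2) *(1)] by simp
qed

text \<open>The gap has no zeros on the simply connected half-plane, so a normalized half-period can
  be chosen holomorphically for all \<tau> at once.\<close>

lemma holomorphic_normalized_half_period:
  obtains \<rho> where "\<rho> holomorphic_on {\<tau>. Im \<tau> > 0}"
    "\<And>\<tau>. Im \<tau> > 0 \<Longrightarrow> normalized_half_periods \<tau> (\<rho> \<tau>) (\<tau> * \<rho> \<tau>)"
proof -
  let ?H = "{\<tau>. Im \<tau> > 0}"
  have opH: "open ?H" by (rule open_halfspace_Im_gt)
  have "half_period_gap holomorphic_on ?H"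
    unfolding half_period_gap_def[abs_def] wp_e1_def wp_e2_def
    by (intro holomorphic_on_diff holomorphic_on_weierstrass_p_curve opH)
       (auto intro!: holomorphic_intros indep_1 dest: half_periods_not_lattice(1,2)[OF indep_1])
  then have hol: "(\<lambda>\<tau>. half_period_gap \<tau> / 4) holomorphic_on ?H" by (intro holomorphic_intros) auto
  have nz: "half_period_gap \<tau> / 4 \<noteq> 0" if "\<tau> \<in> ?H" for \<tau>
    using weierstrass_p_half_periods_distinct(1)[OF indep_1] that by (simp add: half_period_gap_def)
  have "simply_connected ?H" by (intro convex_imp_simply_connected convex_halfspace_Im_gt)
  moreover have "locally path_connected ?H" by (rule open_imp_locally_path_connected[OF opH])
  ultimately obtain \<rho> where \<rho>: "\<rho> holomorphic_on ?H" "\<And>\<tau>. \<tau> \<in> ?H \<Longrightarrow> half_period_gap \<tau> / 4 = (\<rho> \<tau>)\<^sup>2"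
    using simply_connected_imp_holomorphic_sqrt[OF hol _ _ nz] by blast
  have "normalized_half_periods \<tau> (\<rho> \<tau>) (\<tau> * \<rho> \<tau>)" if "Im \<tau> > 0" for \<tau>
    using \<rho>(2)[of \<tau>] nz[of \<tau>] that by (auto simp: normalized_half_periods_iff)
  then show ?thesis using that \<rho>(1) by blast
qed

lemma eventually_not_lattice:
  assumes ind: "indep a0 b0" and z0: "z0 \<notin> period_lattice a0 b0"
    and lim: "(z \<longlongrightarrow> z0) F" "(a \<longlongrightarrow> a0) F" "(b \<longlongrightarrow> b0) F"
  shows "\<forall>\<^sub>F t in F. z t \<notin> period_lattice (a t) (b t)"
proof -
  have dom: "(z0, a0, b0) \<in> wp_reg_dom" using ind z0 by (simp add: wp_reg_dom_iff)
  obtain c d where cd: "c > 0" "d > 0"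
    "\<And>z a b p. dist z z0 \<le> d \<Longrightarrow> dist a a0 \<le> d \<Longrightarrow> dist b b0 \<le> d \<Longrightarrow> p \<in> nonzero_idx
       \<Longrightarrow> cmod (z - latpt a b p) \<ge> c * isize p"
    using latpt_dist_ge_nbhd[OF dom] by metis
  have "z0 \<noteq> 0" using z0 lattice_0 by metis
  then have "\<forall>\<^sub>F t in F. z t \<noteq> 0" using lim(1) tendsto_imp_eventually_ne by blast
  moreover have "\<forall>\<^sub>F t in F. dist (z t) z0 < d" "\<forall>\<^sub>F t in F. dist (a t) a0 < d" "\<forall>\<^sub>F t in F. dist (b t) b0 < d"
    using lim cd(2) by (auto intro: tendstoD)
  ultimately show ?thesis
  proof eventually_elim
    case (elim t)
    have "z t \<noteq> latpt (a t) (b t) p" for p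
    proof (cases "p = (0, 0)")
      case False
      then have "c * isize p > 0" using cd(1) isize_ge_1[of p] by (intro mult_pos_pos) auto
      also have "c * isize p \<le> cmod (z t - latpt (a t) (b t) p)"
        by (rule cd(3)) (use elim False in auto)
      finally show ?thesis by auto
    qed (use elim in simp)
    then show ?case by (auto simp: period_lattice_eq)
  qed
qed

text \<open>Zeros cannot converge to a pole: after subtraction of a period they would tend to 0,
  where \<wp> v = 0 says that 1 + v^2 times the regular part is 0, while this expression tends to
  1.\<close>

lemma is_zero_of_wp_limit:
  assumes ind: "indep a0 b0" and F: "F \<noteq> bot"
    and lim: "(z \<longlongrightarrow> z0) F" "(a \<longlongrightarrow> a0) F" "(b \<longlongrightarrow> b0) F"
    and zero: "\<forall>\<^sub>F t in F. indep (a t) (b t) \<and> is_zero_of_wp (a t) (b t) (z t)"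
  shows "is_zero_of_wp a0 b0 z0"
proof (cases "z0 \<in> period_lattice a0 b0")
  case False
  have ev: "\<forall>\<^sub>F t in F. indep (a t) (b t)" using zero by (rule eventually_mono) simp
  have "((\<lambda>t. weierstrass_p (a t) (b t) (z t)) \<longlongrightarrow> weierstrass_p a0 b0 z0) F"
    by (rule tendsto_weierstrass_p[OF ind False lim ev])
  moreover have "((\<lambda>t. weierstrass_p (a t) (b t) (z t)) \<longlongrightarrow> 0) F"
    by (rule tendsto_eventually, rule eventually_mono[OF zero]) (simp add: is_zero_of_wp_def)
  ultimately have "weierstrass_p a0 b0 z0 = 0" by (rule tendsto_unique[OF F])
  then show ?thesis using False by (simp add: is_zero_of_wp_def)
next
  case True
  then obtain p where p: "z0 = latpt a0 b0 p" by (auto simp: period_lattice_eq)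
  \<comment> \<open>The index of the period stays fixed while the lattice moves.\<close>
  define v where "v t = z t - latpt (a t) (b t) p" for t
  have "(v \<longlongrightarrow> z0 - latpt a0 b0 p) F"
    unfolding v_def latpt_def by (intro tendsto_intros lim)
  then have v: "(v \<longlongrightarrow> 0) F" by (simp add: p)
  have dom: "(0, a0, b0) \<in> wp_reg_dom" using ind by (simp add: wp_reg_dom_iff)
  have "((\<lambda>t. 1 + (v t)\<^sup>2 * wp_reg (a t) (b t) (v t)) \<longlongrightarrow> 1 + 0\<^sup>2 * wp_reg a0 b0 0) F"
    by (intro tendsto_intros v tendsto_wp_reg[OF dom] lim)
  moreover have "((\<lambda>t. 1 + (v t)\<^sup>2 * wp_reg (a t) (b t) (v t)) \<longlongrightarrow> 0) F"
  proof (rule tendsto_eventually, rule eventually_mono[OF zero])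
    fix t assume t: "indep (a t) (b t) \<and> is_zero_of_wp (a t) (b t) (z t)"
    then have ind: "indep (a t) (b t)" by blast
    have pL: "latpt (a t) (b t) p \<in> period_lattice (a t) (b t)" by (simp add: period_lattice_eq)
    have vL: "v t \<notin> period_lattice (a t) (b t)"
      using t lattice_diff_iff[OF pL] by (simp add: v_def is_zero_of_wp_def)
    then have v0: "v t \<noteq> 0" using lattice_0 by metis
    have "weierstrass_p (a t) (b t) (v t) = 0"
      using weierstrass_p_periodic[OF ind pL vL] t by (simp add: v_def is_zero_of_wp_def)
    then have "(v t)\<^sup>2 * (1 / (v t)\<^sup>2 + wp_reg (a t) (b t) (v t)) = 0"
      by (simp add: weierstrass_p_eq[OF ind])
    then show "1 + (v t)\<^sup>2 * wp_reg (a t) (b t) (v t) = 0"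
      using v0 by (simp add: distrib_left)
  qed
  ultimately have "1 + 0\<^sup>2 * wp_reg a0 b0 0 = 0" by (rule tendsto_unique[OF F])
  then show ?thesis by simp
qed

text \<open>The interior of the set of zeros is clopen in V. At a limit point the zero persists, so
  \<wp> along g is holomorphic nearby and vanishes on a nonempty open set, hence on a ball.\<close>

lemma is_zero_analytic_continuation:
  assumes \<rho>: "\<rho> holomorphic_on {\<tau>. Im \<tau> > 0}"
      "\<And>\<tau>. Im \<tau> > 0 \<Longrightarrow> normalized_half_periods \<tau> (\<rho> \<tau>) (\<tau> * \<rho> \<tau>)"
    and V: "open V" "connected V" "V \<subseteq> {\<tau>. Im \<tau> > 0}" "g holomorphic_on V"
    and W: "open W" "W \<noteq> {}" "W \<subseteq> V" "\<And>\<tau>. \<tau> \<in> W \<Longrightarrow> is_zero_of_wp (\<rho> \<tau>) (\<tau> * \<rho> \<tau>) (g \<tau>)"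
    and \<tau>: "\<tau> \<in> V"
  shows "is_zero_of_wp (\<rho> \<tau>) (\<tau> * \<rho> \<tau>) (g \<tau>)"
proof -
  define A where "A = {\<tau> \<in> V. is_zero_of_wp (\<rho> \<tau>) (\<tau> * \<rho> \<tau>) (g \<tau>)}"
  have ind: "indep (\<rho> \<tau>) (\<tau> * \<rho> \<tau>)" if "\<tau> \<in> V" for \<tau>
    using normalized_indep \<rho>(2) V(3) that by blast
  have hol\<rho>: "\<rho> holomorphic_on V" using \<rho>(1) V(3) holomorphic_on_subset by blast
  have isC: "isCont \<rho> x" "isCont g x" if "x \<in> V" for x
    using holomorphic_on_imp_continuous_on[OF hol\<rho>] holomorphic_on_imp_continuous_on[OF V(4)] V(1) that
    by (auto simp: continuous_on_eq_continuous_at)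
  have lims: "(g \<longlongrightarrow> g x) (at x within S)" "(\<rho> \<longlongrightarrow> \<rho> x) (at x within S)"
      "((\<lambda>t. t * \<rho> t) \<longlongrightarrow> x * \<rho> x) (at x within S)" if "x \<in> V" for x S
  proof -
    show 1: "(g \<longlongrightarrow> g x) (at x within S)" "(\<rho> \<longlongrightarrow> \<rho> x) (at x within S)"
      using isC[OF that] by (auto simp: isCont_def intro: tendsto_within_subset)
    show "((\<lambda>t. t * \<rho> t) \<longlongrightarrow> x * \<rho> x) (at x within S)" by (intro tendsto_intros 1)
  qed
  have "closedin (top_of_set V) (interior A)"
    unfolding closedin_limpt
  proof (intro conjI allI impI)
    show "interior A \<subseteq> V" using interior_subset by (auto simp: A_def)
    fix x assume x: "x islimpt interior A \<and> x \<in> V"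
    have ne: "at x within interior A \<noteq> bot" using x trivial_limit_within by blast
    have "\<forall>\<^sub>F t in at x within interior A. indep (\<rho> t) (t * \<rho> t) \<and> is_zero_of_wp (\<rho> t) (t * \<rho> t) (g t)"
      unfolding eventually_at using ind interior_subset[of A] by (intro exI[of _ 1]) (auto simp: A_def)
    then have zx: "is_zero_of_wp (\<rho> x) (x * \<rho> x) (g x)"
      using is_zero_of_wp_limit[OF ind ne lims] x by blast
    have "\<forall>\<^sub>F t in at x. g t \<notin> period_lattice (\<rho> t) (t * \<rho> t)"
      using eventually_not_lattice[OF ind _ lims] zx x by (auto simp: is_zero_of_wp_def)
    then obtain d where d: "d > 0" "\<And>t. t \<noteq> x \<Longrightarrow> dist t x < d \<Longrightarrow> g t \<notin> period_lattice (\<rho> t) (t * \<rho> t)"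
      by (auto simp: eventually_at)
    obtain d' where d': "d' > 0" "ball x d' \<subseteq> V" using V(1) x open_contains_ball by blast
    define r where "r = min d d'"
    have r: "r > 0" "ball x r \<subseteq> V" using d(1) d' by (auto simp: r_def)
    have nl: "g t \<notin> period_lattice (\<rho> t) (t * \<rho> t)" if "t \<in> ball x r" for t
      using d(2)[of t] zx that by (cases "t = x") (auto simp: r_def dist_commute is_zero_of_wp_def)
    let ?f = "\<lambda>t. weierstrass_p (\<rho> t) (t * \<rho> t) (g t)"
    have holf: "?f holomorphic_on ball x r"
      by (intro holomorphic_on_weierstrass_p_curve holomorphic_intros holomorphic_on_subset[OF hol\<rho> r(2)]
            holomorphic_on_subset[OF V(4) r(2)] open_ball nl ind)
         (use r(2) in blast)
    have "ball x r \<inter> interior A \<noteq> {}"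
      using x r(1) unfolding islimpt_approachable by (metis Int_iff dist_commute empty_iff mem_ball)
    moreover have "open (ball x r \<inter> interior A)" by (intro open_Int open_ball open_interior)
    moreover have "?f t = 0" if "t \<in> ball x r \<inter> interior A" for t
      using that interior_subset[of A] by (auto simp: A_def is_zero_of_wp_def)
    ultimately have "?f t = 0" if "t \<in> ball x r" for t
      using analytic_continuation_open[of "ball x r \<inter> interior A" "ball x r" ?f "\<lambda>_. 0" t] holf that
      by auto
    then have "ball x r \<subseteq> A" using nl r(2) by (auto simp: A_def is_zero_of_wp_def)
    then show "x \<in> interior A" using r(1) by (meson centre_in_ball interiorI open_ball)
  qed
  moreover have "openin (top_of_set V) (interior A)"
    using interior_subset[of A] by (intro open_openin_trans V(1) open_interior) (auto simp: A_def)
  moreover have "W \<subseteq> interior A" by (rule interior_maximal) (use W in \<open>auto simp: A_def\<close>)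
  ultimately have "interior A = V"
    using V(2) W(2) connected_clopen[of V] by (metis subset_empty)
  then show ?thesis using \<tau> interior_subset[of A] by (auto simp: A_def)
qed

text \<open>Induction on the chain of continuations, all compared with one global choice of
  half-periods; a value at a boundary point is then a limit of zeros.\<close>

lemma analytic_value_is_zero:
  assumes R: "\<And>\<tau> z a b. Im \<tau> > 0 \<Longrightarrow> normalized_half_periods \<tau> a b \<Longrightarrow> R \<tau> z \<Longrightarrow> is_zero_of_wp a b z"
    and \<tau>: "Im \<tau> > 0" "normalized_half_periods \<tau> a b" and z: "analytic_value R \<tau> z"
  shows "is_zero_of_wp a b z"
proof -
  obtain \<rho> where \<rho>: "\<rho> holomorphic_on {\<tau>. Im \<tau> > 0}"
    "\<And>\<tau>. Im \<tau> > 0 \<Longrightarrow> normalized_half_periods \<tau> (\<rho> \<tau>) (\<tau> * \<rho> \<tau>)"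
    using holomorphic_normalized_half_period by blast
  have branch: "open U \<and> U \<subseteq> {\<tau>. Im \<tau> > 0} \<and> (\<forall>\<tau>\<in>U. is_zero_of_wp (\<rho> \<tau>) (\<tau> * \<rho> \<tau>) (f \<tau>))"
    if "analytic_branch R U f" for U f
    using that
  proof (induction rule: analytic_branch.induct)
    case (formula U f)
    then show ?case using R \<rho>(2) by blast
  next
    case (continuation U f V g W)
    have "is_zero_of_wp (\<rho> \<tau>) (\<tau> * \<rho> \<tau>) (g \<tau>)" if "\<tau> \<in> V" for \<tau>
    proof (rule is_zero_analytic_continuation[OF \<rho> _ _ _ _ _ _ _ _ that])
      show "is_zero_of_wp (\<rho> \<tau>) (\<tau> * \<rho> \<tau>) (g \<tau>)" if "\<tau> \<in> W" for \<tau>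
        using continuation that by (metis Int_iff subsetD)
    qed (use continuation in auto)
    then show ?case using continuation by blast
  qed
  from z show ?thesis
    unfolding analytic_value_def
  proof (elim disjE exE conjE)
    assume "R \<tau> z"
    then show ?thesis using R \<tau> by blast
  next
    fix U f assume Uf: "analytic_branch R U f" "\<tau> \<in> closure U" "(f \<longlongrightarrow> z) (at \<tau> within U)"
    note B = branch[OF Uf(1)]
    \<comment> \<open>Needed also for \<tau> in U: the limit says something only along a nontrivial
      filter.\<close>
    have "\<tau> islimpt U"
    proof (cases "\<tau> \<in> U")
      case True
      then show ?thesis using B interior_limit_point by (metis interior_open)
    next
      case False
      then show ?thesis using Uf(2) by (simp add: closure_def)
    qed
    then have ne: "at \<tau> within U \<noteq> bot" using trivial_limit_within by blast
    have "isCont \<rho> \<tau>"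
      using holomorphic_on_imp_continuous_on[OF \<rho>(1)] open_halfspace_Im_gt[of 0] \<tau>(1)
      by (simp add: continuous_on_eq_continuous_at)
    then have l: "(\<rho> \<longlongrightarrow> \<rho> \<tau>) (at \<tau> within U)" by (auto simp: isCont_def intro: tendsto_within_subset)
    have "is_zero_of_wp (\<rho> \<tau>) (\<tau> * \<rho> \<tau>) z"
    proof (rule is_zero_of_wp_limit[OF _ ne Uf(3) l])
      show "indep (\<rho> \<tau>) (\<tau> * \<rho> \<tau>)" using normalized_indep \<rho>(2) \<tau>(1) by blast
      show "((\<lambda>t. t * \<rho> t) \<longlongrightarrow> \<tau> * \<rho> \<tau>) (at \<tau> within U)" by (intro tendsto_intros l)
      show "\<forall>\<^sub>F t in at \<tau> within U. indep (\<rho> t) (t * \<rho> t) \<and> is_zero_of_wp (\<rho> t) (t * \<rho> t) (f t)"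
        unfolding eventually_at
      proof (intro exI[of _ 1] conjI ballI impI)
        fix t assume t: "t \<in> U"
        then show "is_zero_of_wp (\<rho> t) (t * \<rho> t) (f t)" using B by blast
        show "indep (\<rho> t) (t * \<rho> t)" using normalized_indep \<rho>(2) B t by blast
      qed simp
    qed
    then show ?thesis using is_zero_normalized_cong[OF \<tau>(1) \<rho>(2)[OF \<tau>(1)] \<tau>(2)] by blast
  qed
qed

section \<open>Rectangular lattices\<close>

text \<open>The complete elliptic integral of the first kind with parameter \<open>m = k\<^sup>2\<close>: the substitution
  \<open>v = 2 u / (1 + u\<^sup>2)\<close> turns \<open>dv / (sqrt (1 - v\<^sup>2) * sqrt (1 - m * v\<^sup>2))\<close> into a proper integrand.\<close>

definition kint :: "real \<Rightarrow> real \<Rightarrow> real" where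
  "kint m u = 2 / sqrt ((1 + u\<^sup>2)\<^sup>2 - 4 * m * u\<^sup>2)"

definition ellK :: "real \<Rightarrow> real" where
  "ellK m = integral {0..1} (kint m)"

lemma kint_radicand_pos:
  assumes "m < 1" shows "(1 + u\<^sup>2)\<^sup>2 - 4 * m * u\<^sup>2 > (0 :: real)"
proof (cases "u = 0")
  case False
  have "(1 + u\<^sup>2)\<^sup>2 - 4 * m * u\<^sup>2 = (1 - u\<^sup>2)\<^sup>2 + 4 * (1 - m) * u\<^sup>2"
    by (simp add: power2_eq_square algebra_simps)
  also have "\<dots> > 0" using assms False by (intro add_nonneg_pos) auto
  finally show ?thesis .
qed simp

lemma continuous_on_kint: "m < 1 \<Longrightarrow> continuous_on S (kint m)"
  unfolding kint_def using kint_radicand_pos[of m]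
  by (intro continuous_intros) (auto simp: less_imp_neq[symmetric])

lemma kint_integrable: "m < 1 \<Longrightarrow> kint m integrable_on {s..t}"
  by (rule integrable_continuous_interval[OF continuous_on_kint])

lemma kint_pos: "m < 1 \<Longrightarrow> kint m u > 0"
  unfolding kint_def using kint_radicand_pos[of m u] by simp

lemma ellK_pos: assumes "m < 1" shows "ellK m > 0"
proof -
  have "integral {0..1} (\<lambda>x::real. 0) < integral {0..1} (kint m)"
    by (rule integral_less_real) (use assms kint_pos in \<open>auto intro: continuous_on_kint\<close>)
  then show ?thesis by (simp add: ellK_def)
qed

lemma ellK_strict_mono: assumes "m < m'" "m' < 1" shows "ellK m < ellK m'"
  unfolding ellK_def
proof (rule integral_less_real)
  fix u :: real assume "u \<in> {0<..<1}"
  then have "m * u\<^sup>2 < m' * u\<^sup>2" using assms by simp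
  then have "(1 + u\<^sup>2)\<^sup>2 - 4 * m' * u\<^sup>2 < (1 + u\<^sup>2)\<^sup>2 - 4 * m * u\<^sup>2" by simp
  then show "kint m u < kint m' u"
    unfolding kint_def using kint_radicand_pos[OF assms(2), of u]
    by (intro divide_strict_left_mono) (auto intro!: mult_pos_pos)
qed (use assms in \<open>auto intro: continuous_on_kint\<close>)

text \<open>For real a and imaginary b, conjugation permutes the lattice by changing the sign of the
  second index.\<close>

lemma cnj_weierstrass_p_rectangular:
  assumes "cnj a = a" "cnj b = - b" "indep a b"
  shows "cnj (weierstrass_p a b z) = weierstrass_p a b (cnj z)"
proof -
  have bij: "bij_betw (\<lambda>p. (fst p, - snd p)) nonzero_idx nonzero_idx"
    by (rule bij_betwI[where g = "\<lambda>p. (fst p, - snd p)"]) auto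
  have l: "cnj (latpt a b p) = latpt a b (fst p, - snd p)" for p
    using assms by (simp add: latpt_def)
  have t: "cnj (wp_term z w) = wp_term (cnj z) (cnj w)" for w by (simp add: wp_term_def)
  have "cnj (wp_reg a b z) = (\<Sum>\<^sub>\<infinity>p\<in>nonzero_idx. wp_term (cnj z) (latpt a b (fst p, - snd p)))"
    unfolding wp_reg_def infsum_cnj[symmetric] t l ..
  also have "\<dots> = wp_reg a b (cnj z)"
    unfolding wp_reg_def using infsum_reindex_bij_betw[OF bij, of "\<lambda>p. wp_term (cnj z) (latpt a b p)"] .
  finally show ?thesis by (simp add: weierstrass_p_eq[OF assms(3)])
qed

locale rectangular =
  fixes x y :: real
  assumes x: "x > 0" and y: "y > 0"
begin

abbreviation "a \<equiv> complex_of_real x"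
abbreviation "b \<equiv> \<i> * complex_of_real y"
abbreviation "L \<equiv> period_lattice a b"
abbreviation "P \<equiv> weierstrass_p a b"

definition "E1 = Re (wp_e1 a b)"
definition "E2 = Re (wp_e2 a b)"
definition "E3 = Re (wp_e3 a b)"

lemma ind: "indep a b"
  using x y by (simp add: indep_def)

lemma real_on_real_axis: "P (of_real t) = of_real (Re (P (of_real t)))"
  using cnj_weierstrass_p_rectangular[OF _ _ ind, of "of_real t"]
  by (simp add: complex_eq_iff)

lemma real_values: "wp_e1 a b = of_real E1" "wp_e2 a b = of_real E2" "wp_e3 a b = of_real E3"
proof -
  show 1: "wp_e1 a b = of_real E1"
    using real_on_real_axis[of x] by (simp add: E1_def wp_e1_def)
  show 2: "wp_e2 a b = of_real E2"
    using cnj_weierstrass_p_rectangular[OF _ _ ind, of b] weierstrass_p_minus[OF ind, of b]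
    by (simp add: E2_def wp_e2_def complex_eq_iff)
  have "wp_e3 a b = - wp_e1 a b - wp_e2 a b" using wp_e_sum[OF ind] by (simp add: algebra_simps eq_neg_iff_add_eq_0)
  then show "wp_e3 a b = of_real E3" unfolding E3_def 1 2 by simp
qed

lemma E_sum: "E1 + E2 + E3 = 0"
  using wp_e_sum[OF ind] unfolding real_values by (metis of_real_add of_real_eq_0_iff)

lemma real_lattice_coords: "of_real s + of_real t * b \<in> L \<longleftrightarrow> s / (2 * x) \<in> \<int> \<and> t / 2 \<in> \<int>"
proof -
  have "of_real s + of_real t * b = of_real (s / (2 * x)) * (2 * a) + of_real (t / 2) * (2 * b)"
    using x by simp
  then show ?thesis using lattice_real_coords[OF ind, of "s / (2 * x)" "t / 2"] by simp
qed

lemma real_not_lattice: "0 < t \<Longrightarrow> t < 2 * x \<Longrightarrow> of_real t \<notin> L"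
proof
  assume t: "0 < t" "t < 2 * x" and "of_real t \<in> L"
  then have "t / (2 * x) \<in> \<int>" using real_lattice_coords[of t 0] by simp
  then obtain n :: int where n: "t / (2 * x) = of_int n" by (auto elim: Ints_cases)
  have "0 < t / (2 * x)" "t / (2 * x) < 1" using t x by auto
  then show False unfolding n by auto
qed

lemma continuous_on_P_real: "continuous_on {0<..x} (\<lambda>t. Re (P (of_real t)))"
proof -
  have "continuous_on (- L) P"
    by (rule holomorphic_on_imp_continuous_on[OF holomorphic_on_weierstrass_p[OF ind]])
  then have "continuous_on {0<..x} (\<lambda>t. P (of_real t))"
    by (rule continuous_on_compose2) (use x real_not_lattice in \<open>auto intro!: continuous_intros\<close>)
  then show ?thesis by (intro continuous_intros)
qed

lemma P_real_unbounded: "\<exists>t. 0 < t \<and> t < x \<and> Re (P (of_real t)) > B"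
proof -
  have dom: "(0, a, b) \<in> wp_reg_dom" using ind by (simp add: wp_reg_dom_iff)
  have "((\<lambda>t. of_real t) \<longlongrightarrow> complex_of_real 0) (at_right 0)" by (intro tendsto_intros)
  then have "((\<lambda>t. complex_of_real t) \<longlongrightarrow> 0) (at_right 0)" by simp
  from tendsto_Re[OF tendsto_wp_reg[OF dom this tendsto_const tendsto_const]]
  have "((\<lambda>t. Re (wp_reg a b (of_real t))) \<longlongrightarrow> 0) (at_right 0)" by (simp add: wp_reg_at_0)
  moreover have "filterlim (\<lambda>t::real. 1 / t\<^sup>2) at_top (at_right 0)"
    unfolding divide_inverse mult_1_left
    by (rule filterlim_inverse_at_top)
       (auto intro!: tendsto_eq_intros simp: eventually_at_filter)
  ultimately have "filterlim (\<lambda>t. Re (wp_reg a b (of_real t)) + 1 / t\<^sup>2) at_top (at_right 0)"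
    by (rule filterlim_tendsto_add_at_top)
  then have "\<forall>\<^sub>F t in at_right 0. Re (wp_reg a b (of_real t)) + 1 / t\<^sup>2 > B"
    by (simp add: filterlim_at_top_dense)
  moreover have "\<forall>\<^sub>F t in at_right 0. t \<in> {0<..<x}" using x by (rule eventually_at_right_real)
  ultimately have "\<forall>\<^sub>F t in at_right 0. t \<in> {0<..<x} \<and> Re (wp_reg a b (of_real t)) + 1 / t\<^sup>2 > B"
    by (rule eventually_conj[rotated])
  from eventually_happens'[OF trivial_limit_at_right_real this]
  obtain t where t: "t \<in> {0<..<x}" "Re (wp_reg a b (of_real t)) + 1 / t\<^sup>2 > B"
    by blast
  have "P (of_real t) = of_real (1 / t\<^sup>2) + wp_reg a b (of_real t)"
    by (simp add: weierstrass_p_eq[OF ind])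
  then have "Re (P (of_real t)) = 1 / t\<^sup>2 + Re (wp_reg a b (of_real t))" by simp
  then show ?thesis using t by (intro exI[of _ t]) auto
qed

text \<open>On the real segment from 0 to x the function decreases from arbitrarily large values to
  E1 at least in the sense of intermediate values, so any H \<ge> E1 is attained there; but \<wp> h
  is attained only at h modulo periods, and these are not real.\<close>

lemma half_period_value_less_E1:
  assumes h: "h \<in> {b, a + b}" "P h = of_real H"
  shows "H < E1"
proof (rule ccontr)
  assume "\<not> H < E1"
  then have le: "Re (P (of_real x)) \<le> H" by (simp add: E1_def wp_e1_def)
  obtain t0 where t0: "0 < t0" "t0 < x" "Re (P (of_real t0)) > H" using P_real_unbounded by blast
  have "\<exists>t. t0 \<le> t \<and> t \<le> x \<and> Re (P (of_real t)) = H"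
    by (rule IVT2'[where f = "\<lambda>t. Re (P (of_real t))", OF le]) (use t0 in \<open>auto intro: continuous_on_subset[OF continuous_on_P_real]\<close>)
  then obtain t where t: "t0 \<le> t" "t \<le> x" "Re (P (of_real t)) = H" by blast
  then have "P (of_real t) = P h" using real_on_real_axis[of t] h(2) by simp
  moreover have "of_real t \<notin> L" by (rule real_not_lattice) (use t t0 x in auto)
  ultimately have "of_real t + h \<in> L"
    using weierstrass_p_eq_half_period_value[OF ind, of h "of_real t"] h(1) by auto
  then have "(1 :: real) / 2 \<in> \<int>"
    using h(1) real_lattice_coords[of t 1] real_lattice_coords[of "t + x" 1] by (auto simp: algebra_simps)
  then show False using half_not_Ints by blast
qed

lemma E_less_E1: "E2 < E1" "E3 < E1"
  using half_period_value_less_E1[of b E2] half_period_value_less_E1[of "a + b" E3] real_values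
  by (auto simp: wp_e2_def wp_e3_def)

definition "m = (E3 - E2) / (E1 - E2)"

text \<open>Inverting the integral up to v = 1 leads to the value e1, which determines the
  half-period up to an odd factor.\<close>

lemma elliptic_quarter_period:
  assumes E32: "E2 < E3"
  shows "ellK m = sqrt (E1 - E2) * x"
proof -
  define k where "k = sqrt (E1 - E2)"
  have k: "k > 0" "k\<^sup>2 = E1 - E2" using E_less_E1 by (simp_all add: k_def)
  have m01: "0 < m" "m < 1" using E32 E_less_E1 by (simp_all add: m_def)
  define v where "v u = 2 * u / (1 + u\<^sup>2)" for u :: real
  define v' where "v' u = 2 * (1 - u\<^sup>2) / (1 + u\<^sup>2)\<^sup>2" for u :: real
  \<comment> \<open>Under the substitution 1 - v^2 is the square of (1 - u^2) / (1 + u^2), so only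
    the second root survives. On the unit interval \<rho> vanishes at u = 1 alone.\<close>
  define \<rho> where "\<rho> u = (1 - u\<^sup>2) * sqrt ((1 + u\<^sup>2)\<^sup>2 - 4 * m * u\<^sup>2) / (1 + u\<^sup>2)\<^sup>2" for u :: real
  define w :: "real \<Rightarrow> complex" where "w u = 1 / of_real (\<rho> u) * of_real (v' u)" for u
  define J where "J t = integral {0..t} (kint m)" for t
  have pos: "1 + u\<^sup>2 > (0 :: real)" for u :: real by (simp add: add_pos_nonneg)
  have vder: "((\<lambda>u. complex_of_real (v u)) has_vector_derivative of_real (v' u)) (at u)" for u
  proof -
    have "(v has_real_derivative v' u) (at u)"
      unfolding v_def v'_def using pos[of u]
      by (auto intro!: derivative_eq_intros simp: field_simps power2_eq_square)
    then show ?thesis by (simp add: has_real_derivative_iff_has_vector_derivative has_vector_derivative_of_real)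
  qed
  have \<rho>2: "(\<rho> u)\<^sup>2 = (1 - (v u)\<^sup>2) * (1 - m * (v u)\<^sup>2)" for u
  proof -
    have "1 - (v u)\<^sup>2 = (1 - u\<^sup>2)\<^sup>2 / (1 + u\<^sup>2)\<^sup>2"
      using pos[of u] by (simp add: v_def power_divide field_simps) (simp add: power2_eq_square algebra_simps)
    moreover have "1 - m * (v u)\<^sup>2 = ((1 + u\<^sup>2)\<^sup>2 - 4 * m * u\<^sup>2) / (1 + u\<^sup>2)\<^sup>2"
      using pos[of u] by (simp add: v_def power_divide power_mult_distrib diff_divide_distrib)
    ultimately show ?thesis
      using kint_radicand_pos[OF m01(2), of u]
      by (simp add: \<rho>_def power_divide power_mult_distrib flip: power_add)
  qed
  have \<rho>nz: "\<rho> u \<noteq> 0" if "u \<in> {0..<1}" for u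
  proof -
    have "u\<^sup>2 \<noteq> 1" using that by (auto simp: power2_eq_1_iff)
    then show ?thesis using kint_radicand_pos[OF m01(2), of u] pos[of u] by (auto simp: \<rho>_def)
  qed
  have wk: "w u = of_real (kint m u)" if "u \<in> {0..<1}" for u
  proof -
    have u: "1 - u\<^sup>2 \<noteq> 0" "(1 + u\<^sup>2)\<^sup>2 \<noteq> 0" using that pos[of u] by (auto simp: power2_eq_1_iff)
    have "v' u / \<rho> u = kint m u"
    proof -
      have "2 * p / c / (p * r / c) = 2 / r" if "p \<noteq> 0" "c \<noteq> 0" for p c r :: real
        using that by simp
      from this[OF u] show ?thesis unfolding v'_def \<rho>_def kint_def .
    qed
    then show ?thesis by (simp add: w_def flip: of_real_divide)
  qed
  have int: "(w has_integral of_real (J t)) {0..t}" if t: "t \<in> {0..1}" for t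
  \<comment> \<open>At u = 1 the quotient of v' and \<rho> is 0 / 0, so the two integrands may
    differ there.\<close>
  proof (rule has_integral_spike_finite[of "{1}" _ _ "\<lambda>u. of_real (kint m u)"])
    show "((\<lambda>u. complex_of_real (kint m u)) has_integral of_real (J t)) {0..t}"
      unfolding J_def by (intro has_integral_of_real integrable_integral kint_integrable m01)
    show "w u = of_real (kint m u)" if "u \<in> {0..t} - {1}" for u
      by (rule wk) (use that t in auto)
  qed simp
  have cv: "continuous_on {0..1} (\<lambda>u. complex_of_real (v u))"
    unfolding v_def using pos by (intro continuous_intros) (auto simp: less_imp_neq[symmetric])
  have c\<rho>: "continuous_on {0..1} (\<lambda>u. complex_of_real (\<rho> u))"
    unfolding \<rho>_def using pos by (intro continuous_intros) (auto simp: less_imp_neq[symmetric])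
  have kk: "(complex_of_real k)\<^sup>2 = wp_e1 a b - wp_e2 a b"
    using k(2) by (simp add: real_values flip: of_real_power of_real_diff)
  have mm: "complex_of_real m = (wp_e3 a b - wp_e2 a b) / (wp_e1 a b - wp_e2 a b)"
    by (simp add: real_values m_def)
  have \<rho>2c: "(complex_of_real (\<rho> u))\<^sup>2 = (1 - (complex_of_real (v u))\<^sup>2) * (1 - of_real m * (complex_of_real (v u))\<^sup>2)" for u
    unfolding of_real_power[symmetric] \<rho>2 by simp
  have value_at: "P (of_real (J t / k)) = wp_e2 a b + (wp_e1 a b - wp_e2 a b) / (of_real (v t))\<^sup>2 \<and> of_real (J t / k) \<notin> L"
    if t: "t \<in> {0<..1}" for t
  proof -
    have t01: "t \<in> {0..1}" using t by auto
    have "v t > 0" using t pos[of t] by (simp add: v_def)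
    then have vt: "complex_of_real (v t) \<noteq> 0" by simp
    have v0: "complex_of_real (v 0) = 0" by (simp add: v_def)
    have wi: "w integrable_on {0..1}" using int[of 1] by auto
    have "integral {0..t} w / of_real k \<notin> L \<and>
      P (integral {0..t} w / of_real k) = wp_e2 a b + (wp_e1 a b - wp_e2 a b) / (of_real (v t))\<^sup>2"
      by (rule weierstrass_p_elliptic_integral(2)[where g = "\<lambda>u. complex_of_real (v u)"
            and q = "\<lambda>u. complex_of_real (\<rho> u)" and K = "{}" and m = "of_real m" and g' = "\<lambda>u. of_real (v' u)",
            OF ind kk mm v0 cv c\<rho> _ vder \<rho>2c _ w_def wi t01 vt]) (use \<rho>nz in auto)
    moreover have "integral {0..t} w = of_real (J t)" using int[OF t01] by (rule integral_unique)
    ultimately show ?thesis by simp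
  qed
  have J1: "J 1 = ellK m" by (simp add: J_def ellK_def)
  have Kpos: "ellK m > 0" by (rule ellK_pos[OF m01(2)])
  have "P (of_real (ellK m / k)) = P a" "of_real (ellK m / k) \<notin> L"
    using value_at[of 1] by (simp_all add: J1 v_def wp_e1_def)
  then have "of_real (ellK m / k) + a \<in> L"
    using weierstrass_p_eq_half_period_value[OF ind, of a] by simp
  then have "(ellK m / k + x) / (2 * x) \<in> \<int>"
    using real_lattice_coords[of "ellK m / k + x" 0] by simp
  then obtain n :: int where n: "(ellK m / k + x) / (2 * x) = of_int n" by (auto elim: Ints_cases)
  then have Kn: "ellK m / k = (2 * of_int n - 1) * x" using x by (simp add: field_simps)
  \<comment> \<open>Otherwise the integral would reach x * k at some t < 1 by continuity. There
    \<wp> already has the value e1, which forces v t = 1 and thus t = 1.\<close>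
  have "n = 1"
  proof (rule ccontr)
    assume "n \<noteq> 1"
    have "(2 * of_int n - 1) * x > 0" using Kpos k(1) Kn by (metis divide_pos_pos)
    then have "2 * of_int n - 1 > (0 :: real)" using x by (simp add: zero_less_mult_iff)
    then have "n \<ge> 2" using \<open>n \<noteq> 1\<close> by linarith
    then have "2 * of_int n - 1 \<ge> (3 :: real)" by linarith
    then have "ellK m / k \<ge> 3 * x" unfolding Kn using x by (intro mult_right_mono) auto
    then have "x < ellK m / k" using x by linarith
    then have xJ: "x * k < J 1" using k(1) by (simp add: J1 pos_less_divide_eq)
    have "continuous_on {0..1} J"
      unfolding J_def by (rule indefinite_integral_continuous_1[OF kint_integrable[OF m01(2)]])
    moreover have "J 0 \<le> x * k" using x k by (simp add: J_def)
    ultimately obtain t where t: "0 \<le> t" "t \<le> 1" "J t = x * k"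
      using IVT'[of J 0 "x * k" 1] xJ by auto
    have "t \<noteq> 0" using t(3) x k(1) by (auto simp: J_def)
    moreover have "t \<noteq> 1" using t(3) xJ by auto
    ultimately have t': "t \<in> {0<..1}" "t < 1" using t by auto
    have "J t / k = x" using t(3) k(1) by simp
    then have "wp_e1 a b = wp_e2 a b + (wp_e1 a b - wp_e2 a b) / (of_real (v t))\<^sup>2"
      using value_at[OF t'(1)] by (simp add: wp_e1_def)
    then have "E1 = E2 + (E1 - E2) / (v t)\<^sup>2"
      unfolding real_values by (simp only: of_real_eq_iff flip: of_real_power of_real_diff of_real_divide of_real_add)
    moreover have "v t > 0" using t' pos[of t] by (simp add: v_def)
    ultimately have "(E1 - E2) * (v t)\<^sup>2 = E1 - E2" by (simp add: field_simps)
    then have "(v t)\<^sup>2 = 1" using E_less_E1 by simp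
    then have "v t = 1" using \<open>v t > 0\<close> by (simp add: power2_eq_1_iff)
    then have "(1 - t)\<^sup>2 = 0" using pos[of t] by (simp add: v_def field_simps power2_eq_square)
    then show False using t'(2) by simp
  qed
  then have "ellK m / k = x" using Kn by simp
  then show ?thesis using k(1) by (simp add: k_def field_simps)
qed

end

text \<open>Multiplication by -\<i> carries one rectangle to the other and changes the sign of
  \<wp>, as (-\<i>)^2 = -1.\<close>

lemma rectangular_rotate:
  assumes "x > 0" "y > 0"
  shows "rectangular.E1 y x = - rectangular.E2 x y" "rectangular.E2 y x = - rectangular.E1 x y"
    "rectangular.E3 y x = - rectangular.E3 x y"
proof -
  interpret r: rectangular x y by standard (use assms in auto)
  interpret r': rectangular y x by standard (use assms in auto)
  have "period_lattice r'.a r'.b = period_lattice (- r'.b) r'.a"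
    using lattice_swap lattice_minus_left by metis
  moreover have "- \<i> * r.a = - r'.b" "- \<i> * r.b = r'.a" by simp_all
  ultimately have L: "r'.P = weierstrass_p (- \<i> * r.a) (- \<i> * r.b)"
    using weierstrass_p_lattice_cong by metis
  have sc: "r'.P (- \<i> * z) = - r.P z" for z
    unfolding L using weierstrass_p_scale[OF r.ind, of "- \<i>" z] by simp
  have 1: "r'.P r'.a = - r.P r.b" using sc[of r.b] by simp
  have 2: "r'.P r'.b = - r.P r.a"
    using sc[of r.a] weierstrass_p_minus[OF r'.ind, of r'.b] by simp
  show e: "r'.E1 = - r.E2" "r'.E2 = - r.E1"
    using 1 2 by (simp_all add: r.E1_def r.E2_def r'.E1_def r'.E2_def wp_e1_def wp_e2_def)
  show "r'.E3 = - r.E3" using r.E_sum r'.E_sum e by linarith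
qed

text \<open>The rotated rectangle has the complementary parameter 1 - m, which gives the second
  period. Its inequality E3 < E1 becomes E2 < E3 here.\<close>

lemma rectangular_periods:
  assumes "x > 0" "y > 0"
  obtains E1 E2 E3 :: real where
    "wp_e1 (of_real x) (\<i> * of_real y) = of_real E1" "wp_e2 (of_real x) (\<i> * of_real y) = of_real E2"
    "wp_e3 (of_real x) (\<i> * of_real y) = of_real E3" "E1 + E2 + E3 = 0" "E2 < E3" "E3 < E1"
    "ellK ((E3 - E2) / (E1 - E2)) = sqrt (E1 - E2) * x"
    "ellK (1 - (E3 - E2) / (E1 - E2)) = sqrt (E1 - E2) * y"
proof -
  interpret r: rectangular x y by standard (use assms in auto)
  interpret r': rectangular y x by standard (use assms in auto)
  note rot = rectangular_rotate[OF assms]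
  have lt: "r.E2 < r.E3" "r'.E2 < r'.E3" using r'.E_less_E1 r.E_less_E1 rot by simp_all
  have "1 - (r.E3 - r.E2) / (r.E1 - r.E2) = r'.m"
    using r.E_less_E1(1) by (simp add: r'.m_def rot field_simps)
  then show ?thesis
    using that[OF r.real_values r.E_sum lt(1) r.E_less_E1(2)] r.elliptic_quarter_period[OF lt(1)]
      r'.elliptic_quarter_period[OF lt(2)] by (simp add: r.m_def rot)
qed

section \<open>The quartic integral\<close>

lemma quartic_radicand:
  fixes u c :: real
  shows "(1 + u\<^sup>2)\<^sup>2 - 4 * ((1 + c) / 2) * u\<^sup>2 = u ^ 4 - 2 * c * u\<^sup>2 + 1"
  by (simp add: power2_eq_square eval_nat_numeral field_simps)

text \<open>On the ray S has a positive radicand and starts at 1. It serves for d = 1 with e = cos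
  (2t) and for d = \<i> with e = -cos (2t), whence the parameters cos^2 t and sin^2 t.\<close>

lemma elliptic_E_ray:
  fixes c e :: real
  assumes S: "S holomorphic_on ball 0 1" "S 0 = 1"
    and d: "cmod d = 1" "e < 1"
    and sq: "\<And>u :: real. u \<in> {0..<1} \<Longrightarrow> (S (d * of_real u))\<^sup>2 = of_real (u ^ 4 - 2 * e * u\<^sup>2 + 1)"
  shows "elliptic_E S d = d * of_real (ellK ((1 + e) / 2) / 2)"
proof -
  define m where "m = (1 + e) / 2"
  have m: "m < 1" using d by (simp add: m_def)
  define R where "R u = sqrt (u ^ 4 - 2 * e * u\<^sup>2 + 1)" for u :: real
  have R: "R u > 0" "(R u)\<^sup>2 = u ^ 4 - 2 * e * u\<^sup>2 + 1" "kint m u = 2 / R u" for u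
  proof -
    have eq: "(1 + u\<^sup>2)\<^sup>2 - 4 * m * u\<^sup>2 = u ^ 4 - 2 * e * u\<^sup>2 + 1"
      unfolding m_def by (rule quartic_radicand)
    then show "R u > 0" "(R u)\<^sup>2 = u ^ 4 - 2 * e * u\<^sup>2 + 1"
      using kint_radicand_pos[OF m, of u] by (simp_all add: R_def)
    show "kint m u = 2 / R u" unfolding kint_def R_def eq ..
  qed
  have in_ball: "d * of_real u \<in> ball 0 1" if "u \<in> {0..<1}" for u :: real
    using that d by (simp add: norm_mult)
  define f where "f u = S (d * of_real u) / of_real (R u)" for u :: real
  have "continuous_on {0..<1} f"
  proof -
    have "continuous_on {0..<1::real} (\<lambda>u. S (d * of_real u))"
      by (rule continuous_on_compose2[OF holomorphic_on_imp_continuous_on[OF S(1)]])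
         (use in_ball in \<open>auto intro!: continuous_intros\<close>)
    moreover have "continuous_on {0..<1} (\<lambda>u. complex_of_real (R u))"
      unfolding R_def by (intro continuous_intros)
    ultimately show ?thesis
      unfolding f_def using R(1) by (intro continuous_intros) (auto simp: less_imp_neq[symmetric])
  qed
  \<comment> \<open>A continuous function with values 1 and -1 on an interval is constant, so S is
    the positive root all along the ray.\<close>
  moreover have f2: "(f u)\<^sup>2 = 1" if "u \<in> {0..<1}" for u
  proof -
    have "(f u)\<^sup>2 = of_real ((R u)\<^sup>2) / of_real ((R u)\<^sup>2)"
      unfolding f_def power_divide sq[OF that] R(2)[symmetric] by simp
    then show ?thesis using R(1)[of u] by simp
  qed
  then have "f ` {0..<1} \<subseteq> {1, - 1}" unfolding power2_eq_1_iff by blast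
  then have "finite (f ` {0..<1})" by (rule finite_subset) simp
  ultimately have "f constant_on {0..<1}"
    by (rule continuous_finite_range_constant[OF connected_Ico])
  then have "f u = f 0" if "u \<in> {0..<1}" for u
    using that unfolding constant_on_def by fastforce
  moreover have "f 0 = 1" using S(2) by (simp add: f_def R_def)
  ultimately have S_eq: "S (d * of_real u) = of_real (R u)" if "u \<in> {0..<1}" for u
    using that R(1)[of u] by (simp add: f_def)
  have "(kint m has_integral ellK m) {0..1}"
    unfolding ellK_def by (rule integrable_integral[OF kint_integrable[OF m]])
  then have "((\<lambda>u. d * (of_real (kint m u) / 2)) has_integral d * (of_real (ellK m) / 2)) {0..1}"
    by (intro has_integral_mult_right has_integral_divide has_integral_of_real)
  then have "((\<lambda>u. 1 / S (linepath 0 d u) * (d - 0)) has_integral d * (of_real (ellK m) / 2)) {0..1}"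
  proof (rule has_integral_spike_finite[of "{1}", rotated 2])
    fix u :: real assume "u \<in> {0..1} - {1}"
    then have "S (d * of_real u) = of_real (R u)" by (intro S_eq) auto
    then show "1 / S (linepath 0 d u) * (d - 0) = d * (of_real (kint m u) / 2)"
      by (simp add: linepath_def scaleR_conv_of_real mult.commute R(3))
  qed simp
  then have "((\<lambda>u. 1 / S u) has_contour_integral d * (of_real (ellK m) / 2)) (linepath 0 d)"
    by (simp add: has_contour_integral_linepath)
  then have "elliptic_E S d = d * (of_real (ellK m) / 2)"
    unfolding elliptic_E_def by (rule contour_integral_unique)
  then show ?thesis by (simp add: m_def)
qed

text \<open>Both radicands stay positive on the segment, so the principal roots are the ones
  continued from 1.\<close>

lemma elliptic_integral_value_principal:
  fixes \<sigma> M :: real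
  assumes "0 \<le> \<sigma>" "\<sigma> < 1" "0 \<le> M" "M \<le> 1"
  shows "elliptic_integral_value (of_real M) (of_real \<sigma>)
    (contour_integral (linepath 0 (of_real \<sigma>)) (\<lambda>v. 1 / (csqrt (1 - v\<^sup>2) * csqrt (1 - of_real M * v\<^sup>2))))"
proof -
  let ?g = "linepath 0 (complex_of_real \<sigma>)"
  let ?f = "\<lambda>v. 1 / (csqrt (1 - v\<^sup>2) * csqrt (1 - of_real M * v\<^sup>2))"
  have g: "?g x = of_real (x * \<sigma>)" for x by (simp add: linepath_def scaleR_conv_of_real)
  have rad: "1 - (x * \<sigma>)\<^sup>2 > 0" "1 - M * (x * \<sigma>)\<^sup>2 > 0" if "x \<in> {0..1}" for x
  proof -
    have "x * \<sigma> \<le> 1 * \<sigma>" using that assms by (intro mult_right_mono) auto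
    then have 0: "0 \<le> x * \<sigma>" "x * \<sigma> < 1" using that assms by auto
    then have "(x * \<sigma>)\<^sup>2 < 1" unfolding abs_square_less_1 by simp
    then show 1: "1 - (x * \<sigma>)\<^sup>2 > 0" by linarith
    have "M * (x * \<sigma>)\<^sup>2 \<le> 1 * (x * \<sigma>)\<^sup>2" using assms by (intro mult_right_mono) auto
    then show "1 - M * (x * \<sigma>)\<^sup>2 > 0" using 1 by simp
  qed
  have eq: "1 - (?g x)\<^sup>2 = of_real (1 - (x * \<sigma>)\<^sup>2)"
      "1 - of_real M * (?g x)\<^sup>2 = of_real (1 - M * (x * \<sigma>)\<^sup>2)" for x
    unfolding g by simp_all
  have cs: "csqrt (1 - (?g x)\<^sup>2) = of_real (sqrt (1 - (x * \<sigma>)\<^sup>2))"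
      "csqrt (1 - of_real M * (?g x)\<^sup>2) = of_real (sqrt (1 - M * (x * \<sigma>)\<^sup>2))" if "x \<in> {0..1}" for x
    unfolding eq using rad[OF that] by (simp_all add: csqrt_of_real_nonneg del: of_real_diff)
  have nonneg: "1 - v\<^sup>2 \<in> - \<real>\<^sub>\<le>\<^sub>0" "1 - of_real M * v\<^sup>2 \<in> - \<real>\<^sub>\<le>\<^sub>0"
    if "v \<in> closed_segment 0 (complex_of_real \<sigma>)" for v
  proof -
    have "v \<in> ?g ` {0..1}" using that by (metis linepath_image_01)
    then obtain x where x: "x \<in> {0..1}" "v = ?g x" by blast
    show "1 - v\<^sup>2 \<in> - \<real>\<^sub>\<le>\<^sub>0" "1 - of_real M * v\<^sup>2 \<in> - \<real>\<^sub>\<le>\<^sub>0"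
      unfolding x(2) eq using rad[OF x(1)] by (simp_all add: complex_nonpos_Reals_iff del: of_real_diff)
  qed
  have c1: "continuous_on (closed_segment 0 (complex_of_real \<sigma>)) (\<lambda>v. csqrt (1 - v\<^sup>2))"
    by (rule continuous_on_compose2[OF continuous_on_csqrt]) (use nonneg in \<open>auto intro!: continuous_intros\<close>)
  have c2: "continuous_on (closed_segment 0 (complex_of_real \<sigma>)) (\<lambda>v. csqrt (1 - of_real M * v\<^sup>2))"
    by (rule continuous_on_compose2[OF continuous_on_csqrt]) (use nonneg in \<open>auto intro!: continuous_intros\<close>)
  have "csqrt (1 - v\<^sup>2) \<noteq> 0" "csqrt (1 - of_real M * v\<^sup>2) \<noteq> 0" if "v \<in> closed_segment 0 (complex_of_real \<sigma>)" for v
    using nonneg[OF that] by auto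
  then have "continuous_on (closed_segment 0 (complex_of_real \<sigma>)) ?f"
    using c1 c2 by (intro continuous_intros) auto
  then have "(?f has_contour_integral contour_integral ?g ?f) ?g"
    by (intro has_contour_integral_integral contour_integrable_continuous_linepath)
  then have int: "((\<lambda>x. 1 / (csqrt (1 - (?g x)\<^sup>2) * csqrt (1 - of_real M * (?g x)\<^sup>2)) *
      vector_derivative ?g (at x within {0..1})) has_integral contour_integral ?g ?f) {0..1}"
    by (simp add: has_contour_integral_def)
  have seg: "?g x \<in> closed_segment 0 (complex_of_real \<sigma>)" if "x \<in> {0..1}" for x
    using that by (metis image_eqI linepath_image_01)
  have cg: "continuous_on {0..1} ?g" by (rule continuous_on_linepath)
  show ?thesis
    unfolding elliptic_integral_value_def
  proof (rule exI[of _ ?g], rule exI[of _ "\<lambda>x. csqrt (1 - (?g x)\<^sup>2)"],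
      rule exI[of _ "\<lambda>x. csqrt (1 - of_real M * (?g x)\<^sup>2)"], intro conjI ballI)
    show "continuous_on {0..1} (\<lambda>x. csqrt (1 - (?g x)\<^sup>2))"
      by (rule continuous_on_compose2[OF c1 cg]) (use seg in auto)
    show "continuous_on {0..1} (\<lambda>x. csqrt (1 - of_real M * (?g x)\<^sup>2))"
      by (rule continuous_on_compose2[OF c2 cg]) (use seg in auto)
    show "csqrt (1 - (?g x)\<^sup>2) \<noteq> 0" "csqrt (1 - of_real M * (?g x)\<^sup>2) \<noteq> 0" if "x \<in> {0..<1}" for x
      using cs[of x] rad[of x] that by auto
    show "csqrt (1 - (?g 0)\<^sup>2) = 1" "csqrt (1 - of_real M * (?g 0)\<^sup>2) = 1"
      unfolding g by simp_all
  qed (use int in simp_all)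
qed

text \<open>The half-periods are K(cos^2 t) / 2 and \<i> * K(sin^2 t) / 2. Comparison with the
  periods of a rectangular lattice gives two equations for its parameter m and the scale k; with m
  and k known, the vanishing sum determines all three values.\<close>

lemma quartic_lattice_values:
  assumes t: "pi / 4 < t" "t < pi / 2" and S: "is_quartic_sqrt t S"
    and a: "a = elliptic_E S 1" and b: "b = elliptic_E S \<i>"
  shows "indep a b" "wp_e1 a b = of_real (2 - 2 / 3 * cos (2 * t))"
    "wp_e2 a b = of_real (- 2 - 2 / 3 * cos (2 * t))" "wp_e3 a b = of_real (4 / 3 * cos (2 * t))"
proof -
  define c where "c = cos (2 * t)"
  have "cos (2 * t) < cos (pi / 2)" by (rule cos_monotone_0_pi) (use t in auto)
  moreover have "cos pi < cos (2 * t)" by (rule cos_monotone_0_pi) (use t in auto)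
  ultimately have c: "- 1 < c" "c < 0" by (simp_all add: c_def)
  have holS: "S holomorphic_on ball 0 1" "S 0 = 1"
    and sqS: "\<And>u. u \<in> ball 0 1 \<Longrightarrow> (S u)\<^sup>2 = u ^ 4 - 2 * of_real c * u\<^sup>2 + 1"
    using S by (auto simp: is_quartic_sqrt_def c_def)
  define x y where "x = ellK ((1 + c) / 2) / 2" and "y = ellK ((1 - c) / 2) / 2"
  have "elliptic_E S 1 = 1 * of_real (ellK ((1 + c) / 2) / 2)"
  proof (rule elliptic_E_ray[OF holS])
    show "(S (1 * of_real u))\<^sup>2 = of_real (u ^ 4 - 2 * c * u\<^sup>2 + 1)" if "u \<in> {0..<1}" for u :: real
      using sqS[of "of_real u"] that by simp
  qed (use c in auto)
  then have ax: "a = of_real x" by (simp add: a x_def)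
  have "elliptic_E S \<i> = \<i> * of_real (ellK ((1 + - c) / 2) / 2)"
  proof (rule elliptic_E_ray[OF holS])
    show "(S (\<i> * of_real u))\<^sup>2 = of_real (u ^ 4 - 2 * (- c) * u\<^sup>2 + 1)" if "u \<in> {0..<1}" for u :: real
      using sqS[of "\<i> * of_real u"] that by (simp add: norm_mult power_mult_distrib)
  qed (use c in auto)
  then have bY: "b = \<i> * of_real y" by (simp add: b y_def)
  have xy: "x > 0" "y > 0" unfolding x_def y_def using c by (auto intro!: ellK_pos)
  show "indep a b" unfolding ax bY using rectangular.ind[of x y] xy by (simp add: rectangular_def)
  obtain E1 E2 E3 :: real where E: "wp_e1 a b = of_real E1" "wp_e2 a b = of_real E2" "wp_e3 a b = of_real E3"
    "E1 + E2 + E3 = 0" "E2 < E3" "E3 < E1"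
    "ellK ((E3 - E2) / (E1 - E2)) = sqrt (E1 - E2) * x" "ellK (1 - (E3 - E2) / (E1 - E2)) = sqrt (E1 - E2) * y"
    by (rule rectangular_periods[OF xy, folded ax bY]) (rule that; assumption)
  define m where "m = (E3 - E2) / (E1 - E2)"
  define k where "k = sqrt (E1 - E2)"
  have k: "k > 0" "k\<^sup>2 = E1 - E2" using E(5,6) by (simp_all add: k_def)
  have m: "0 < m" "m < 1" using E(5,6) by (simp_all add: m_def)
  have Km: "2 * ellK m = k * ellK ((1 + c) / 2)" "2 * ellK (1 - m) = k * ellK (1 - (1 + c) / 2)"
    using E(7,8) by (simp_all add: m_def[symmetric] k_def[symmetric] x_def y_def field_simps)
  \<comment> \<open>For a different m, monotonicity of K in the two equations yields opposite strict
    inequalities between k and 2, because m and 1 - m err in opposite directions.\<close>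
  have m_eq: "m = (1 + c) / 2"
  proof (rule ccontr)
    assume "m \<noteq> (1 + c) / 2"
    then consider "m < (1 + c) / 2" | "m > (1 + c) / 2" by linarith
    then show False
    proof cases
      case 1
      have "ellK m < ellK ((1 + c) / 2)" by (rule ellK_strict_mono) (use 1 c in auto)
      then have "k * ellK ((1 + c) / 2) < 2 * ellK ((1 + c) / 2)" using Km(1) by linarith
      then have "k < 2" using ellK_pos[of "(1 + c) / 2"] c by simp
      have "ellK (1 - (1 + c) / 2) < ellK (1 - m)" by (rule ellK_strict_mono) (use 1 m in auto)
      then have "2 * ellK (1 - (1 + c) / 2) < k * ellK (1 - (1 + c) / 2)" using Km(2) by linarith
      then have "2 < k" using ellK_pos[of "1 - (1 + c) / 2"] c by simp
      with \<open>k < 2\<close> show False by simp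
    next
      case 2
      have "ellK ((1 + c) / 2) < ellK m" by (rule ellK_strict_mono) (use 2 m in auto)
      then have "2 * ellK ((1 + c) / 2) < k * ellK ((1 + c) / 2)" using Km(1) by linarith
      then have "2 < k" using ellK_pos[of "(1 + c) / 2"] c by simp
      have "ellK (1 - m) < ellK (1 - (1 + c) / 2)" by (rule ellK_strict_mono) (use 2 c in auto)
      then have "k * ellK (1 - (1 + c) / 2) < 2 * ellK (1 - (1 + c) / 2)" using Km(2) by linarith
      then have "k < 2" using ellK_pos[of "1 - (1 + c) / 2"] c by simp
      with \<open>2 < k\<close> show False by simp
    qed
  qed
  have "ellK ((1 + c) / 2) > 0" by (rule ellK_pos) (use c in auto)
  then have "k = 2" using Km(1) unfolding m_eq by simp
  then have E12: "E1 - E2 = 4" using k(2) by simp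
  then have E32: "E3 - E2 = 2 + 2 * c" using m_eq by (simp add: m_def field_simps)
  have "E1 = 2 - 2 / 3 * c" "E2 = - 2 - 2 / 3 * c" "E3 = 4 / 3 * c"
    using E12 E32 E(4) by linarith+
  then show "wp_e1 a b = of_real (2 - 2 / 3 * cos (2 * t))" "wp_e2 a b = of_real (- 2 - 2 / 3 * cos (2 * t))"
    "wp_e3 a b = of_real (4 / 3 * cos (2 * t))"
    unfolding E(1-3) by (simp_all only: c_def)
qed

text \<open>For these t the value e3 lies between -4/3 and 0, so the upper limit is real and below 1
  and the principal roots are legitimate.\<close>

lemma z0_principal_is_zero:
  assumes t: "pi / 4 < t" "t < pi / 2" and S: "is_quartic_sqrt t S"
    and a: "a = elliptic_E S 1" and b: "b = elliptic_E S \<i>"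
  shows "is_zero_of_wp a b (z0_principal a b)"
proof -
  note V = quartic_lattice_values[OF assms]
  define e where "e = 4 / 3 * cos (2 * t)"
  have "cos (2 * t) < cos (pi / 2)" by (rule cos_monotone_0_pi) (use t in auto)
  moreover have "cos pi < cos (2 * t)" by (rule cos_monotone_0_pi) (use t in auto)
  ultimately have e: "- 4 / 3 < e" "e < 0" by (simp_all add: e_def)
  define D where "D = (e + 4) * (3 * e - 4)"
  have D: "D < 0" unfolding D_def using e by (intro mult_pos_neg) auto
  have e3: "wp_e3 a b = of_real e" and e1: "wp_e1 a b = of_real (2 - e / 2)" and e2: "wp_e2 a b = of_real (- 2 - e / 2)"
    using V by (simp_all add: e_def)
  define \<sigma> where "\<sigma> = sqrt (e / D)"
  have pos: "e / D \<ge> 0" using e(2) D by (intro divide_nonpos_nonpos) auto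
  \<comment> \<open>Since D < 0, this says that the square 16 * e / D of the upper limit is below 1;
    16 * e - D factors as (3 * e + 4) * (4 - e).\<close>
  have "16 * e > D"
  proof -
    have "(3 * e + 4) * (4 - e) > 0" using e by (intro mult_pos_pos) auto
    then show ?thesis by (simp add: D_def algebra_simps)
  qed
  then have "16 * (e / D) < 1" using D by (simp add: field_simps)
  moreover have "(4 * \<sigma>)\<^sup>2 = 16 * (e / D)" using pos by (simp add: \<sigma>_def power_mult_distrib)
  ultimately have "(4 * \<sigma>)\<^sup>2 < 1\<^sup>2" by simp
  then have "4 * \<sigma> < 1" by (rule power_less_imp_less_base) simp
  moreover have "\<sigma> \<ge> 0" using pos by (simp add: \<sigma>_def)
  ultimately have \<sigma>: "0 \<le> 4 * \<sigma>" "4 * \<sigma> < 1" by simp_all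
  have eD: "wp_e3 a b / ((wp_e3 a b + 4) * (3 * wp_e3 a b - 4)) = of_real (e / D)"
    by (simp add: e3 D_def)
  have cs: "csqrt (wp_e3 a b / ((wp_e3 a b + 4) * (3 * wp_e3 a b - 4))) = of_real \<sigma>"
    unfolding eD using pos by (simp add: \<sigma>_def csqrt_of_real_nonneg del: of_real_divide)
  \<comment> \<open>This is sin^2 t.\<close>
  define M where "M = (2 - e / 2 - e) / 4"
  have M: "(wp_e1 a b - wp_e3 a b) / 4 = of_real M" by (simp add: e1 e3 M_def)
  have M01: "0 \<le> M" "M \<le> 1" using e by (simp_all add: M_def)
  define I where "I = contour_integral (linepath 0 (of_real (4 * \<sigma>)))
      (\<lambda>v. 1 / (csqrt (1 - v\<^sup>2) * csqrt (1 - of_real M * v\<^sup>2)))"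
  have z: "z0_principal a b = a + b - \<i> / 2 * I"
    unfolding z0_principal_def Let_def cs M I_def by simp
  show ?thesis
    unfolding z
  proof (rule zero_from_formula1[OF V(1), of "of_real \<sigma>"])
    show "wp_e1 a b - wp_e2 a b = 4" by (simp add: e1 e2)
    have "(wp_e3 a b + 4) * (3 * wp_e3 a b - 4) = of_real D" by (simp add: e3 D_def)
    then show "(wp_e3 a b + 4) * (3 * wp_e3 a b - 4) \<noteq> 0" using D by simp
    show "(complex_of_real \<sigma>)\<^sup>2 = wp_e3 a b / ((wp_e3 a b + 4) * (3 * wp_e3 a b - 4))"
      using pos unfolding eD by (simp add: \<sigma>_def flip: of_real_power)
    show "elliptic_integral_value ((wp_e1 a b - wp_e3 a b) / 4) (4 * of_real \<sigma>) I"
      using elliptic_integral_value_principal[OF \<sigma> M01] unfolding M I_def by simp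
  qed
qed

theorem mainTheorem3:
  shows "(\<forall>(t::real) S \<omega>\<^sub>1 \<omega>\<^sub>2.
            pi / 4 < t \<longrightarrow> t < pi / 2 \<longrightarrow> is_quartic_sqrt t S \<longrightarrow>
            \<omega>\<^sub>1 = elliptic_E S 1 \<longrightarrow> \<omega>\<^sub>2 = elliptic_E S \<i> \<longrightarrow>
            is_zero_of_wp \<omega>\<^sub>1 \<omega>\<^sub>2 (z0_principal \<omega>\<^sub>1 \<omega>\<^sub>2))
       \<and> (\<forall>\<tau> \<omega>\<^sub>1 \<omega>\<^sub>2.
            Im \<tau> > 0 \<longrightarrow> normalized_half_periods \<tau> \<omega>\<^sub>1 \<omega>\<^sub>2 \<longrightarrow>
            (\<forall>z\<^sub>0. analytic_value z0_formula1 \<tau> z\<^sub>0 \<longrightarrow> is_zero_of_wp \<omega>\<^sub>1 \<omega>\<^sub>2 z\<^sub>0) \<and>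
            (\<forall>z\<^sub>0. analytic_value z0_formula2 \<tau> z\<^sub>0 \<longrightarrow> is_zero_of_wp \<omega>\<^sub>1 \<omega>\<^sub>2 z\<^sub>0))"
proof (intro conjI allI impI)
  show "is_zero_of_wp \<omega>\<^sub>1 \<omega>\<^sub>2 (z0_principal \<omega>\<^sub>1 \<omega>\<^sub>2)"
    if "pi / 4 < t" "t < pi / 2" "is_quartic_sqrt t S" "\<omega>\<^sub>1 = elliptic_E S 1" "\<omega>\<^sub>2 = elliptic_E S \<i>"
    for t S \<omega>\<^sub>1 \<omega>\<^sub>2
    by (rule z0_principal_is_zero[OF that])
  show "is_zero_of_wp \<omega>\<^sub>1 \<omega>\<^sub>2 z"
    if "Im \<tau> > 0" "normalized_half_periods \<tau> \<omega>\<^sub>1 \<omega>\<^sub>2" "analytic_value z0_formula1 \<tau> z" for \<tau> \<omega>\<^sub>1 \<omega>\<^sub>2 z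
    by (rule analytic_value_is_zero[OF z0_formula1_zero that])
  show "is_zero_of_wp \<omega>\<^sub>1 \<omega>\<^sub>2 z"
    if "Im \<tau> > 0" "normalized_half_periods \<tau> \<omega>\<^sub>1 \<omega>\<^sub>2" "analytic_value z0_formula2 \<tau> z" for \<tau> \<omega>\<^sub>1 \<omega>\<^sub>2 z
    by (rule analytic_value_is_zero[OF z0_formula2_zero that])
qed

end
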